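(* Let $\theta\in\mathbb{R}$ and let $\mathcal{A}(\mathcal{M}_\theta)=\{a\in\mathcal{A}(\mathrm{SL}_\theta(2,\mathbb{H})) : (\pi\otimes\mathrm{id})\Delta(a)=1\otimes a\}$ be the algebra of the quantum quotient of $\mathrm{SL}_\theta(2,\mathbb{H})$ by $\mathrm{Sp}_\theta(2)$. Put \begin{align*} m&=a_1^*a_1+a_2^*a_2+c_1^*c_1+c_2^*c_2, & n&=b_1^*b_1+b_2^*b_2+d_1^*d_1+d_2^*d_2, \\ g_1&=a_1^*b_1+\mu\,b_2^*a_2+c_1^*d_1+\mu\,d_2^*c_2, & g_2&=b_2^*a_1-\mu\,a_2^*b_1+d_2^*c_1-\mu\,c_2^*d_1 . \end{align*} Then $\mathcal{A}(\mathcal{M}_\theta)$ is generated as an algebra by the six elements $m=m^*$, $n=n^*$, $g_1,g_1^*,g_2,g_2^*$; the matrix $M=(m_{ij})$ with $m_{ij}=\sum_k(A_{ki})^*A_{kj}$ equals $$M=\begin{pmatrix} m&0&g_1&g_2^* \\ 0&m&-\bar\mu\,g_2&\mu\,g_1^* \\ g_1^*&-\mu\,g_2^*&n&0 \\ g_2&\bar\mu\,g_1&0&n \end{pmatrix};$$ and the following relations hold: $m$ and $n$ are central in $\mathcal{A}(\mathcal{M}_\theta)$; $g_1g_1^*=g_1^*g_1$ and $g_2g_2^*=g_2^*g_2$; $g_1g_2=\mu^2g_2g_1$ and $g_1g_2^*=\bar\mu^2g_2^*g_1$ (together with their conjugates); and $$mn-(g_1^*g_1+g_2^*g_2)=1 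.$$
   Context: Let $\theta\in\mathbb{R}$, $\mu=e^{\pi \mathrm{i}\theta}$, and let $\eta=(\eta_{ij})$ be $$\eta=\begin{pmatrix} 1&1&\bar\mu&\mu \\ 1&1&\mu&\bar\mu \\ \mu&\bar\mu&1&1 \\ \bar\mu&\mu&1&1 \end{pmatrix}.$$ $\mathcal{A}(M_\theta(2,\mathbb{H}))$ is the unital complex $*$-algebra generated by the entries of $$A_\theta=(A_{ij})=\begin{pmatrix} a_1&a_2&b_1&b_2 \\ -a_2^*&a_1^*&-b_2^*&b_1^* \\ c_1&c_2&d_1&d_2 \\ -c_2^*&c_1^*&-d_2^*&d_1^* \end{pmatrix}$$ with relations $A_{ij}A_{kl}=\eta_{ki}\eta_{jl}A_{kl}A_{ij}$. The determinant is $\det(A_\theta)=\sum_{\sigma\in S_4}(-1)^{|\sigma|}\varepsilon^{\sigma(1)\sigma(2)\sigma(3)\sigma(4)}A_{1,\sigma(1)}\cdots A_{4,\sigma(4)}$, where $\varepsilon^{ijkl}=\mu$ if $(i,j,k,l)$ is $(1,3,2,4)$ or one of its cyclic rotations, $\bar\mu$ if it is $(1,4,2,3)$ or one of its cyclic rotations, and $1$ for all other permutations; it is central. $\mathcal{A}(\mathrm{SL}_\theta(2,\mathbb{H}))$ is the quotient of $\mathcal{A}(M_\theta(2,\mathbb{H}))$ by the ideal generated by $\det(A_\theta)-1$; it is a Hopf algebra with $\Delta(A_{ij})=\sum_kA_{ik}\otimes A_{kj}$ and $\epsilon(A_{ij})=\delta_{ij}$. $\mathcal{A}(\mathrm{Sp}_\theta(2))$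 is the quotient Hopf algebra of $\mathcal{A}(\mathrm{SL}_\theta(2,\mathbb{H}))$ by the two-sided $*$-ideal generated by the elements $\sum_k(A_{ki})^*A_{kj}-\delta_{ij}$, $i,j=1,\dots,4$, and $\pi:\mathcal{A}(\mathrm{SL}_\theta(2,\mathbb{H}))\to\mathcal{A}(\mathrm{Sp}_\theta(2))$ is the quotient map. *)

theory Defs
  imports
    Complex_Main
    "HOL-Library.Poly_Mapping"
    "HOL-Combinatorics.Permutations"
    "HOL-Algebra.QuotRing"
    "HOL-Algebra.Subrings"
    "HOL-Algebra.Module"
begin

section \<open>Complex *-algebras with explicit carriers\<close>

text \<open>The algebras below depend on the real parameter \<open>\<theta>\<close>, so they are records in the
  style of HOL-Algebra rather than types.\<close>

record 'a star_algebra = "(complex, 'a) module" +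
  invol :: "'a \<Rightarrow> 'a" ("star\<index> _" [81] 80)

definition alg_hom ::
  "(complex, 'a, 'c) module_scheme \<Rightarrow> (complex, 'b, 'd) module_scheme \<Rightarrow> ('a \<Rightarrow> 'b) set" where
  "alg_hom A B =
     {h \<in> ring_hom A B. \<forall>c. \<forall>x\<in>carrier A. h (c \<odot>\<^bsub>A\<^esub> x) = c \<odot>\<^bsub>B\<^esub> h x}"

definition generated_subalgebra :: "(complex, 'a, 'c) module_scheme \<Rightarrow> 'a set \<Rightarrow> 'a set" where
  "generated_subalgebra A S =
     \<Inter>{B. subring B A \<and> (\<forall>c. \<forall>x\<in>B. c \<odot>\<^bsub>A\<^esub> x \<in> B) \<and> S \<subseteq> B}"

definition star_ideal_gen :: "('a, 'c) star_algebra_scheme \<Rightarrow> 'a set \<Rightarrow> 'a set" where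
  "star_ideal_gen A S = \<Inter>{I. ideal I A \<and> invol A ` I \<subseteq> I \<and> S \<subseteq> I}"

text \<open>The ring structure is that of \<^const>\<open>FactRing\<close>. The operations are well defined when
  \<open>I\<close> is a two-sided ideal stable under scalars and the involution.\<close>

definition quotient_algebra ::
  "('a, 'c) star_algebra_scheme \<Rightarrow> 'a set \<Rightarrow> 'a set star_algebra" where
  "quotient_algebra A I =
     ring.extend (A Quot I)
       \<lparr>smult = (\<lambda>c X. \<Union>x\<in>X. I +>\<^bsub>A\<^esub> (c \<odot>\<^bsub>A\<^esub> x)),
        invol = (\<lambda>X. \<Union>x\<in>X. I +>\<^bsub>A\<^esub> (star\<^bsub>A\<^esub> x))\<rparr>"

text \<open>The algebra of formal complex combinations of elements of a monoid \<open>G\<close>, with the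
  antilinear extension of an involution \<open>s\<close> of \<open>G\<close>.\<close>

definition scale_pm :: "complex \<Rightarrow> ('g \<Rightarrow>\<^sub>0 complex) \<Rightarrow> ('g \<Rightarrow>\<^sub>0 complex)" where
  "scale_pm c p = Poly_Mapping.map (\<lambda>z. c * z) p"

definition monoid_algebra ::
  "('g, 'c) monoid_scheme \<Rightarrow> ('g \<Rightarrow> 'g) \<Rightarrow> ('g \<Rightarrow>\<^sub>0 complex) star_algebra" where
  "monoid_algebra G s =
     \<lparr>carrier = {p. Poly_Mapping.keys p \<subseteq> carrier G},
      mult = (\<lambda>p q. \<Sum>g\<in>Poly_Mapping.keys p. \<Sum>h\<in>Poly_Mapping.keys q.
               Poly_Mapping.single (g \<otimes>\<^bsub>G\<^esub> h) (Poly_Mapping.lookup p g * Poly_Mapping.lookup q h)),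
      one = Poly_Mapping.single \<one>\<^bsub>G\<^esub> 1,
      zero = 0,
      add = (\<lambda>p q. p + q),
      smult = scale_pm,
      invol = (\<lambda>p. \<Sum>g\<in>Poly_Mapping.keys p.
               Poly_Mapping.single (s g) (cnj (Poly_Mapping.lookup p g)))\<rparr>"

text \<open>The free unital *-algebra on \<open>'x\<close>: words in the letters \<open>(x, False)\<close>, standing for \<open>x\<close>,
  and \<open>(x, True)\<close>, standing for \<open>x\<^sup>*\<close>.\<close>

definition free_star_algebra :: "(('x \<times> bool) list \<Rightarrow>\<^sub>0 complex) star_algebra" where
  "free_star_algebra =
     monoid_algebra \<lparr>carrier = UNIV, mult = (\<lambda>u v. u @ v), one = []\<rparr>
       (\<lambda>w. rev (map (\<lambda>(x, b). (x, \<not> b)) w))"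

definition free_gen :: "'x \<Rightarrow> (('x \<times> bool) list \<Rightarrow>\<^sub>0 complex)" where
  "free_gen x = Poly_Mapping.single [(x, False)] 1"


section \<open>Tensor products\<close>

text \<open>\<open>A \<otimes> B\<close> is the space of formal combinations of pairs \<open>(a, b)\<close> modulo the linear span of
  the bilinearity relations, with the product and involution taken componentwise on pairs.\<close>

definition pair_algebra ::
  "('a, 'c) star_algebra_scheme \<Rightarrow> ('b, 'd) star_algebra_scheme
     \<Rightarrow> ('a \<times> 'b \<Rightarrow>\<^sub>0 complex) star_algebra" where
  "pair_algebra A B = monoid_algebra (A \<times>\<times> B) (\<lambda>(a, b). (star\<^bsub>A\<^esub> a, star\<^bsub>B\<^esub> b))"

definition pair_pm :: "'a \<Rightarrow> 'b \<Rightarrow> ('a \<times> 'b \<Rightarrow>\<^sub>0 complex)" where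
  "pair_pm a b = Poly_Mapping.single (a, b) 1"

definition bilinear_relations ::
  "('a, 'c) star_algebra_scheme \<Rightarrow> ('b, 'd) star_algebra_scheme \<Rightarrow> ('a \<times> 'b \<Rightarrow>\<^sub>0 complex) set" where
  "bilinear_relations A B =
     {pair_pm (a \<oplus>\<^bsub>A\<^esub> a') b - pair_pm a b - pair_pm a' b | a a' b.
        a \<in> carrier A \<and> a' \<in> carrier A \<and> b \<in> carrier B} \<union>
     {pair_pm a (b \<oplus>\<^bsub>B\<^esub> b') - pair_pm a b - pair_pm a b' | a b b'.
        a \<in> carrier A \<and> b \<in> carrier B \<and> b' \<in> carrier B} \<union>
     {pair_pm (c \<odot>\<^bsub>A\<^esub> a) b - scale_pm c (pair_pm a b) | c a b.
        a \<in> carrier A \<and> b \<in> carrier B} \<union>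
     {pair_pm a (c \<odot>\<^bsub>B\<^esub> b) - scale_pm c (pair_pm a b) | c a b.
        a \<in> carrier A \<and> b \<in> carrier B}"

definition bilinear_kernel ::
  "('a, 'c) star_algebra_scheme \<Rightarrow> ('b, 'd) star_algebra_scheme \<Rightarrow> ('a \<times> 'b \<Rightarrow>\<^sub>0 complex) set" where
  "bilinear_kernel A B = Modules.module.span scale_pm (bilinear_relations A B)"

definition tensor_algebra ::
  "('a, 'c) star_algebra_scheme \<Rightarrow> ('b, 'd) star_algebra_scheme
     \<Rightarrow> ('a \<times> 'b \<Rightarrow>\<^sub>0 complex) set star_algebra" where
  "tensor_algebra A B = quotient_algebra (pair_algebra A B) (bilinear_kernel A B)"

definition tensor ::
  "('a, 'c) star_algebra_scheme \<Rightarrow> ('b, 'd) star_algebra_scheme \<Rightarrow> 'a \<Rightarrow> 'b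
     \<Rightarrow> ('a \<times> 'b \<Rightarrow>\<^sub>0 complex) set" where
  "tensor A B a b = bilinear_kernel A B +>\<^bsub>pair_algebra A B\<^esub> pair_pm a b"

text \<open>The map \<open>f \<otimes> g\<close> into \<open>C \<otimes> D\<close> induced by linear maps \<open>f\<close> into \<open>C\<close> and \<open>g\<close> into \<open>D\<close>.\<close>

definition tensor_map ::
  "('c, 'u) star_algebra_scheme \<Rightarrow> ('d, 'v) star_algebra_scheme \<Rightarrow> ('a \<Rightarrow> 'c) \<Rightarrow> ('b \<Rightarrow> 'd)
     \<Rightarrow> ('a \<times> 'b \<Rightarrow>\<^sub>0 complex) set \<Rightarrow> ('c \<times> 'd \<Rightarrow>\<^sub>0 complex) set" where
  "tensor_map C D f g X =
     (\<Union>p\<in>X. bilinear_kernel C D +>\<^bsub>pair_algebra C D\<^esub>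
        (\<Sum>(a, b)\<in>Poly_Mapping.keys p.
           Poly_Mapping.single (f a, g b) (Poly_Mapping.lookup p (a, b))))"


section \<open>The quaternionic matrix algebra and its quotients\<close>

datatype gen = GA1 | GA2 | GB1 | GB2 | GC1 | GC2 | GD1 | GD2

definition mu :: "real \<Rightarrow> complex" where
  "mu \<theta> = exp (of_real pi * \<i> * of_real \<theta>)"

text \<open>Matrix indices run over \<open>1, 2, 3, 4\<close>.\<close>

definition eta :: "real \<Rightarrow> nat \<Rightarrow> nat \<Rightarrow> complex" where
  "eta \<theta> i j =
     [[1, 1, cnj (mu \<theta>), mu \<theta>],
      [1, 1, mu \<theta>, cnj (mu \<theta>)],
      [mu \<theta>, cnj (mu \<theta>), 1, 1],
      [cnj (mu \<theta>), mu \<theta>, 1, 1]] ! (i - 1) ! (j - 1)"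

text \<open>The matrix \<open>A\<^sub>\<theta>\<close> with the generators interpreted in \<open>A\<close> by \<open>x\<close>.\<close>

definition quat_matrix ::
  "('a, 'c) star_algebra_scheme \<Rightarrow> (gen \<Rightarrow> 'a) \<Rightarrow> nat \<Rightarrow> nat \<Rightarrow> 'a" where
  "quat_matrix A x i j =
     [[x GA1, x GA2, x GB1, x GB2],
      [\<ominus>\<^bsub>A\<^esub> (star\<^bsub>A\<^esub> (x GA2)), star\<^bsub>A\<^esub> (x GA1), \<ominus>\<^bsub>A\<^esub> (star\<^bsub>A\<^esub> (x GB2)), star\<^bsub>A\<^esub> (x GB1)],
      [x GC1, x GC2, x GD1, x GD2],
      [\<ominus>\<^bsub>A\<^esub> (star\<^bsub>A\<^esub> (x GC2)), star\<^bsub>A\<^esub> (x GC1), \<ominus>\<^bsub>A\<^esub> (star\<^bsub>A\<^esub> (x GD2)), star\<^bsub>A\<^esub> (x GD1)]]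
     ! (i - 1) ! (j - 1)"

definition M_relations :: "real \<Rightarrow> ((gen \<times> bool) list \<Rightarrow>\<^sub>0 complex) set" where
  "M_relations \<theta> =
     (let F = free_star_algebra; A = quat_matrix F free_gen in
      {(A i j \<otimes>\<^bsub>F\<^esub> A k l) \<ominus>\<^bsub>F\<^esub> ((eta \<theta> k i * eta \<theta> j l) \<odot>\<^bsub>F\<^esub> (A k l \<otimes>\<^bsub>F\<^esub> A i j)) | i j k l.
         i \<in> {1..4} \<and> j \<in> {1..4} \<and> k \<in> {1..4} \<and> l \<in> {1..4}})"

definition M_ideal :: "real \<Rightarrow> ((gen \<times> bool) list \<Rightarrow>\<^sub>0 complex) set" where
  "M_ideal \<theta> = star_ideal_gen free_star_algebra (M_relations \<theta>)"

definition M_alg :: "real \<Rightarrow> ((gen \<times> bool) list \<Rightarrow>\<^sub>0 complex) set star_algebra" where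
  "M_alg \<theta> = quotient_algebra free_star_algebra (M_ideal \<theta>)"

definition M_gen :: "real \<Rightarrow> gen \<Rightarrow> ((gen \<times> bool) list \<Rightarrow>\<^sub>0 complex) set" where
  "M_gen \<theta> x = M_ideal \<theta> +>\<^bsub>free_star_algebra\<^esub> free_gen x"

definition eps :: "real \<Rightarrow> nat list \<Rightarrow> complex" where
  "eps \<theta> is =
     (if \<exists>r. is = rotate r [1, 3, 2, 4] then mu \<theta>
      else if \<exists>r. is = rotate r [1, 4, 2, 3] then cnj (mu \<theta>)
      else 1)"

definition M_det :: "real \<Rightarrow> ((gen \<times> bool) list \<Rightarrow>\<^sub>0 complex) set" where
  "M_det \<theta> =
     (let R = M_alg \<theta>; A = quat_matrix R (M_gen \<theta>) in
      \<Oplus>\<^bsub>R\<^esub>\<sigma>\<in>{\<sigma>. \<sigma> permutes {1..4::nat}}.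
        (of_int (sign \<sigma>) * eps \<theta> [\<sigma> 1, \<sigma> 2, \<sigma> 3, \<sigma> 4]) \<odot>\<^bsub>R\<^esub>
          (A 1 (\<sigma> 1) \<otimes>\<^bsub>R\<^esub> A 2 (\<sigma> 2) \<otimes>\<^bsub>R\<^esub> A 3 (\<sigma> 3) \<otimes>\<^bsub>R\<^esub> A 4 (\<sigma> 4)))"

definition SL_ideal :: "real \<Rightarrow> ((gen \<times> bool) list \<Rightarrow>\<^sub>0 complex) set set" where
  "SL_ideal \<theta> = Idl\<^bsub>M_alg \<theta>\<^esub> {M_det \<theta> \<ominus>\<^bsub>M_alg \<theta>\<^esub> \<one>\<^bsub>M_alg \<theta>\<^esub>}"

definition SL_alg :: "real \<Rightarrow> ((gen \<times> bool) list \<Rightarrow>\<^sub>0 complex) set set star_algebra" where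
  "SL_alg \<theta> = quotient_algebra (M_alg \<theta>) (SL_ideal \<theta>)"

definition SL_gen :: "real \<Rightarrow> gen \<Rightarrow> ((gen \<times> bool) list \<Rightarrow>\<^sub>0 complex) set set" where
  "SL_gen \<theta> x = SL_ideal \<theta> +>\<^bsub>M_alg \<theta>\<^esub> M_gen \<theta> x"

definition SL_matrix ::
  "real \<Rightarrow> nat \<Rightarrow> nat \<Rightarrow> ((gen \<times> bool) list \<Rightarrow>\<^sub>0 complex) set set" where
  "SL_matrix \<theta> = quat_matrix (SL_alg \<theta>) (SL_gen \<theta>)"

text \<open>The entries of \<open>A\<^sub>\<theta>\<^sup>* A\<^sub>\<theta>\<close>.\<close>

definition SL_gram ::
  "real \<Rightarrow> nat \<Rightarrow> nat \<Rightarrow> ((gen \<times> bool) list \<Rightarrow>\<^sub>0 complex) set set" where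
  "SL_gram \<theta> i j =
     (\<Oplus>\<^bsub>SL_alg \<theta>\<^esub>k\<in>{1..4}.
        (star\<^bsub>SL_alg \<theta>\<^esub> (SL_matrix \<theta> k i)) \<otimes>\<^bsub>SL_alg \<theta>\<^esub> SL_matrix \<theta> k j)"

definition Sp_ideal :: "real \<Rightarrow> ((gen \<times> bool) list \<Rightarrow>\<^sub>0 complex) set set set" where
  "Sp_ideal \<theta> =
     star_ideal_gen (SL_alg \<theta>)
       {SL_gram \<theta> i j \<ominus>\<^bsub>SL_alg \<theta>\<^esub> (if i = j then \<one>\<^bsub>SL_alg \<theta>\<^esub> else \<zero>\<^bsub>SL_alg \<theta>\<^esub>) | i j.
          i \<in> {1..4} \<and> j \<in> {1..4}}"

definition Sp_alg :: "real \<Rightarrow> ((gen \<times> bool) list \<Rightarrow>\<^sub>0 complex) set set set star_algebra" where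
  "Sp_alg \<theta> = quotient_algebra (SL_alg \<theta>) (Sp_ideal \<theta>)"

definition Sp_proj ::
  "real \<Rightarrow> ((gen \<times> bool) list \<Rightarrow>\<^sub>0 complex) set set
     \<Rightarrow> ((gen \<times> bool) list \<Rightarrow>\<^sub>0 complex) set set set" where
  "Sp_proj \<theta> a = Sp_ideal \<theta> +>\<^bsub>SL_alg \<theta>\<^esub> a"


section \<open>The coproduct and the coinvariants\<close>

text \<open>The entries of \<open>A\<^sub>\<theta>\<close> generate the algebra, so the conditions determine the coproduct
  on the carrier; nothing is said about it elsewhere.\<close>

definition is_coproduct ::
  "real \<Rightarrow> (((gen \<times> bool) list \<Rightarrow>\<^sub>0 complex) set set \<Rightarrow>
     (((gen \<times> bool) list \<Rightarrow>\<^sub>0 complex) set set \<times> ((gen \<times> bool) list \<Rightarrow>\<^sub>0 complex) set set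
        \<Rightarrow>\<^sub>0 complex) set) \<Rightarrow> bool" where
  "is_coproduct \<theta> h \<longleftrightarrow>
     (let H = SL_alg \<theta>; A = SL_matrix \<theta> in
      h \<in> alg_hom H (tensor_algebra H H) \<and>
      (\<forall>i\<in>{1..4}. \<forall>j\<in>{1..4}.
         h (A i j) = (\<Oplus>\<^bsub>tensor_algebra H H\<^esub>k\<in>{1..4}. tensor H H (A i k) (A k j))))"

definition coproduct ::
  "real \<Rightarrow> ((gen \<times> bool) list \<Rightarrow>\<^sub>0 complex) set set \<Rightarrow>
     (((gen \<times> bool) list \<Rightarrow>\<^sub>0 complex) set set \<times> ((gen \<times> bool) list \<Rightarrow>\<^sub>0 complex) set set
        \<Rightarrow>\<^sub>0 complex) set" where
  "coproduct \<theta> = (SOME h. is_coproduct \<theta> h)"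

definition quotient_space :: "real \<Rightarrow> ((gen \<times> bool) list \<Rightarrow>\<^sub>0 complex) set set set" where
  "quotient_space \<theta> =
     {a \<in> carrier (SL_alg \<theta>).
        tensor_map (Sp_alg \<theta>) (SL_alg \<theta>) (Sp_proj \<theta>) id (coproduct \<theta> a)
          = tensor (Sp_alg \<theta>) (SL_alg \<theta>) \<one>\<^bsub>Sp_alg \<theta>\<^esub> a}"

end

theory Submission
  imports Defs "HOL-Computational_Algebra.Polynomial"
begin

text \<open>The algebra of \<open>M\<^sub>\<theta>(2, \<H>)\<close> is a cocycle twist of the polynomial functions on complex
  \<open>4 \<times> 4\<close> matrices: evaluating words at a matrix with suitable phases identifies the two as vector
  spaces, and also as coalgebras, because the phases of the row and column indices are inverse to each
  other and cancel along \<open>\<Delta>(A\<^sub>i\<^sub>j) = \<Sum>\<^sub>k A\<^sub>i\<^sub>k \<otimes> A\<^sub>k\<^sub>j\<close>. Under this identification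
  the determinant becomes the classical one, the Gram entries \<open>m\<^sub>i\<^sub>j\<close> become, up to phases, the
  symplectic products of the columns, the ideal of \<open>Sp\<^sub>\<theta>(2)\<close> vanishes on \<open>Sp(4, \<complex>)\<close>, and all
  relations turn into commutative identities; \<open>mn - (g\<^sub>1\<^sup>*g\<^sub>1 + g\<^sub>2\<^sup>*g\<^sub>2) = 1\<close> says that the Pfaffian
  of the Gram matrix is the determinant.

  A coinvariant thus gives a polynomial function on \<open>SL(4, \<complex>)\<close> that is invariant under left
  multiplication by \<open>Sp(4, \<complex>)\<close>. Using \<open>det = 1\<close> to make its parts of degree \<open>r\<close> modulo 4
  homogeneous, one may assume invariance on all invertible matrices. Symplectic Gram-Schmidt moves a
  matrix to a triangular one with entries polynomial in the symplectic products, up to a power of \<open>m\<close>;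
  since every alternating form with \<open>m = 0\<close> and nonzero \<open>(1,3)\<close> entry is the Gram matrix of some
  matrix, the power of \<open>m\<close> can be divided out.\<close>

text \<open>The phases use \<open>eta (\<theta> / 2)\<close>: as \<open>eta\<close> is skew,
  exchanging two letters inverts the half-phase, and the ratio of the two is the commutation factor
  at \<theta>. The price is that evaluation is not multiplicative: a factor on one side moves the
  point at which the other factor is evaluated. All these moves lie in the diagonal torus of Sp(4),
  acting on rows and columns. It preserves SL(4), Sp(4) and, up to column factors, the symplectic
  products, so the elements vanishing on such a set still form a two-sided ideal.

  Evaluation decides equality exactly in \<open>M_alg\<close>. For the further quotients it gives
  one implication: equal classes have equal values on SL(4), respectively Sp(4). Equalities in
  \<open>SL_alg\<close> are obtained from identities valid at all matrices, combined with the
  relation det = 1. Hence a function known to be invariant only at determinant 1 has to be replaced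
  by one that is invariant at all invertible matrices before it can be brought back to the
  algebra.\<close>

abbreviation "lookup \<equiv> Poly_Mapping.lookup"
abbreviation "keys \<equiv> Poly_Mapping.keys"
abbreviation "single \<equiv> Poly_Mapping.single"

section \<open>Formal linear combinations\<close>

lemma lookup_scale_pm [simp]: "lookup (scale_pm c p) k = c * lookup p k"
  unfolding scale_pm_def by (simp add: Poly_Mapping.map.rep_eq when_def)

interpretation pm: Modules.module "scale_pm :: complex \<Rightarrow> ('g \<Rightarrow>\<^sub>0 complex) \<Rightarrow> ('g \<Rightarrow>\<^sub>0 complex)"
  by unfold_locales (auto intro!: poly_mapping_eqI simp: lookup_add algebra_simps)

lemma scale_pm_single [simp]: "scale_pm c (single g d) = single g (c * d)"
  by (rule poly_mapping_eqI) (simp add: lookup_single when_def)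

lemma keys_scale_pm: "keys (scale_pm c p) \<subseteq> keys p"
  by (auto simp: in_keys_iff)

lemma poly_mapping_sum_singles: "(\<Sum>g\<in>keys p. single g (lookup p g)) = p"
proof (rule poly_mapping_eqI)
  fix k
  have "lookup (\<Sum>g\<in>keys p. single g (lookup p g)) k
      = (\<Sum>g\<in>keys p. if g = k then lookup p g else 0)"
    by (simp add: lookup_sum lookup_single when_def)
  also have "\<dots> = lookup p k" by (simp add: sum.delta in_keys_iff)
  finally show "lookup (\<Sum>g\<in>keys p. single g (lookup p g)) k = lookup p k" .
qed

lemma pm_induct [consumes 1, case_names zero single add]:
  fixes p :: "'g \<Rightarrow>\<^sub>0 complex"
  assumes "keys p \<subseteq> C" and "P 0" and "\<And>g c. g \<in> C \<Longrightarrow> P (single g c)"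
    and add: "\<And>p q. keys p \<subseteq> C \<Longrightarrow> keys q \<subseteq> C \<Longrightarrow> P p \<Longrightarrow> P q \<Longrightarrow> P (p + q)"
  shows "P p"
proof -
  have "keys (\<Sum>g\<in>S. single g (lookup p g)) \<subseteq> C \<and> P (\<Sum>g\<in>S. single g (lookup p g))"
    if "finite S" "S \<subseteq> keys p" for S
    using that
  proof induction
    case (insert x S)
    have "keys (single x (lookup p x) + (\<Sum>g\<in>S. single g (lookup p g))) \<subseteq> C"
      using insert assms(1) by (intro subset_trans[OF keys_add]) (auto simp: keys_single)
    moreover have "keys (single x (lookup p x)) \<subseteq> C"
      using insert assms(1) by (auto simp: keys_single)
    ultimately show ?case using insert assms(1) by (auto intro!: add assms(3))
  qed (simp add: assms(2))
  from this[of "keys p"] show ?thesis by (simp add: poly_mapping_sum_singles)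
qed

section \<open>Linear extension of maps prescribed on basis elements\<close>

definition lin :: "('g \<Rightarrow> ('h \<Rightarrow>\<^sub>0 complex)) \<Rightarrow> ('g \<Rightarrow>\<^sub>0 complex) \<Rightarrow> ('h \<Rightarrow>\<^sub>0 complex)" where
  "lin f p = (\<Sum>g\<in>keys p. scale_pm (lookup p g) (f g))"

definition lin_functional :: "('g \<Rightarrow> complex) \<Rightarrow> ('g \<Rightarrow>\<^sub>0 complex) \<Rightarrow> complex" where
  "lin_functional f p = (\<Sum>g\<in>keys p. lookup p g * f g)"

lemma lin_superset:
  "finite S \<Longrightarrow> keys p \<subseteq> S \<Longrightarrow> lin f p = (\<Sum>g\<in>S. scale_pm (lookup p g) (f g))"
  unfolding lin_def by (rule sum.mono_neutral_left) (auto simp: in_keys_iff)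

lemma lin_functional_superset:
  "finite S \<Longrightarrow> keys p \<subseteq> S \<Longrightarrow> lin_functional f p = (\<Sum>g\<in>S. lookup p g * f g)"
  unfolding lin_functional_def by (rule sum.mono_neutral_left) (auto simp: in_keys_iff)

lemma lin_add: "lin f (p + q) = lin f p + lin f q"
proof -
  let ?S = "keys p \<union> keys q"
  have "keys (p + q) \<subseteq> ?S" by (rule keys_add)
  then show ?thesis
    by (simp add: lin_superset[of ?S] lookup_add pm.scale_left_distrib sum.distrib)
qed

lemma lin_functional_add: "lin_functional f (p + q) = lin_functional f p + lin_functional f q"
proof -
  let ?S = "keys p \<union> keys q"
  have "keys (p + q) \<subseteq> ?S" by (rule keys_add)
  then show ?thesis
    by (simp add: lin_functional_superset[of ?S] lookup_add ring_distribs sum.distrib)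
qed

lemma lin_scale: "lin f (scale_pm c p) = scale_pm c (lin f p)"
  unfolding lin_superset[OF finite_keys keys_scale_pm, of _ _ p] by (simp add: lin_def pm.scale_sum_right)

lemma lin_functional_scale: "lin_functional f (scale_pm c p) = c * lin_functional f p"
  unfolding lin_functional_superset[OF finite_keys keys_scale_pm, of _ _ p] by (simp add: lin_functional_def sum_distrib_left mult_ac)

lemma lin_single [simp]: "lin f (single g c) = scale_pm c (f g)"
  by (simp add: lin_superset[of "{g}"])

lemma lin_functional_single [simp]: "lin_functional f (single g c) = c * f g"
  by (simp add: lin_functional_superset[of "{g}"])

lemma lin_zero [simp]: "lin f 0 = 0"
  by (simp add: lin_def)

lemma lin_functional_zero [simp]: "lin_functional f 0 = 0"
  by (simp add: lin_functional_def)

lemma scale_pm_minus1: "scale_pm (- 1) p = - p"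
  by (rule poly_mapping_eqI) simp

lemma lin_uminus: "lin f (- p) = - lin f p"
  using lin_scale[of f "-1" p] by (simp add: scale_pm_minus1)

lemma lin_functional_uminus: "lin_functional f (- p) = - lin_functional f p"
  using lin_functional_scale[of f "-1" p] by (simp add: scale_pm_minus1)

lemma lin_diff: "lin f (p - q) = lin f p - lin f q"
  using lin_add[of f p "- q"] by (simp add: lin_uminus)

lemma lin_functional_diff: "lin_functional f (p - q) = lin_functional f p - lin_functional f q"
  using lin_functional_add[of f p "- q"] by (simp add: lin_functional_uminus)

lemma lin_sum: "lin f (sum g S) = (\<Sum>x\<in>S. lin f (g x))"
  by (induction S rule: infinite_finite_induct) (auto simp: lin_add)

lemma lin_functional_sum: "lin_functional f (sum g S) = (\<Sum>x\<in>S. lin_functional f (g x))"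
  by (induction S rule: infinite_finite_induct) (auto simp: lin_functional_add)

lemma lin_functional_cong: "keys p \<subseteq> C \<Longrightarrow> (\<And>g. g \<in> C \<Longrightarrow> f g = f' g) \<Longrightarrow> lin_functional f p = lin_functional f' p"
  unfolding lin_functional_def by (intro sum.cong) auto

lemma keys_sum: "keys (sum f S) \<subseteq> (\<Union>x\<in>S. keys (f x))"
proof (induction S rule: infinite_finite_induct)
  case (insert x F)
  then show ?case using keys_add[of "f x" "sum f F"] by auto
qed auto

lemma keys_lin: "(\<And>g. g \<in> keys p \<Longrightarrow> keys (f g) \<subseteq> C) \<Longrightarrow> keys (lin f p) \<subseteq> C"
  unfolding lin_def by (rule subset_trans[OF keys_sum]) (use keys_scale_pm in fast)

lemma lin_lin_add: "lin (\<lambda>g. f g + f' g) p = lin f p + lin f' p"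
  by (simp add: lin_def pm.scale_right_distrib sum.distrib)

lemma lin_lin_scale: "lin (\<lambda>g. scale_pm c (f g)) p = scale_pm c (lin f p)"
  by (simp add: lin_def pm.scale_sum_right mult.commute)

section \<open>Monoid algebras\<close>

text \<open>Nesting two linear extensions makes bilinearity an instance of the rules for
  \<open>lin\<close>; the value is the double sum in the product of
  \<open>monoid_algebra\<close>.\<close>

definition conv :: "('g, 'c) monoid_scheme \<Rightarrow> ('g \<Rightarrow>\<^sub>0 complex) \<Rightarrow> ('g \<Rightarrow>\<^sub>0 complex) \<Rightarrow> ('g \<Rightarrow>\<^sub>0 complex)" where
  "conv G p q = lin (\<lambda>g. lin (\<lambda>h. single (g \<otimes>\<^bsub>G\<^esub> h) 1) q) p"

lemma monoid_algebra_simps: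
  "carrier (monoid_algebra G s) = {p. keys p \<subseteq> carrier G}"
  "p \<otimes>\<^bsub>monoid_algebra G s\<^esub> q = conv G p q"
  "\<one>\<^bsub>monoid_algebra G s\<^esub> = single \<one>\<^bsub>G\<^esub> 1"
  "\<zero>\<^bsub>monoid_algebra G s\<^esub> = 0"
  "p \<oplus>\<^bsub>monoid_algebra G s\<^esub> q = p + q"
  "c \<odot>\<^bsub>monoid_algebra G s\<^esub> p = scale_pm c p"
  "star\<^bsub>monoid_algebra G s\<^esub> p = (\<Sum>g\<in>keys p. single (s g) (cnj (lookup p g)))"
  by (simp_all add: monoid_algebra_def conv_def lin_def pm.scale_sum_right)

lemma conv_add_left: "conv G (p + p') q = conv G p q + conv G p' q"
  by (simp add: conv_def lin_add)
lemma conv_add_right: "conv G p (q + q') = conv G p q + conv G p q'"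
  by (simp add: conv_def lin_add lin_lin_add)
lemma conv_scale_left: "conv G (scale_pm c p) q = scale_pm c (conv G p q)"
  by (simp add: conv_def lin_scale)
lemma conv_scale_right: "conv G p (scale_pm c q) = scale_pm c (conv G p q)"
  by (simp add: conv_def lin_scale lin_lin_scale)
lemma conv_single [simp]: "conv G (single g c) (single h d) = single (g \<otimes>\<^bsub>G\<^esub> h) (c * d)"
  by (simp add: conv_def)
lemma conv_zero [simp]: "conv G 0 q = 0" "conv G p 0 = 0"
  by (simp_all add: conv_def lin_def)
lemma conv_uminus_left: "conv G (- p) q = - conv G p q"
  by (simp add: conv_def lin_uminus)
lemma conv_uminus_right: "conv G p (- q) = - conv G p q"
  using conv_scale_right[of G p "-1" q] by (simp add: scale_pm_minus1)
lemma conv_diff_left: "conv G (p - p') q = conv G p q - conv G p' q"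
  by (simp add: conv_def lin_diff)
lemma conv_diff_right: "conv G p (q - q') = conv G p q - conv G p q'"
  using conv_add_right[of G p q "-q'"] by (simp add: conv_uminus_right)
lemma conv_sum_left: "conv G (sum f S) q = (\<Sum>x\<in>S. conv G (f x) q)"
  by (simp add: conv_def lin_sum)
lemma conv_sum_right: "conv G p (sum f S) = (\<Sum>x\<in>S. conv G p (f x))"
  by (induction S rule: infinite_finite_induct) (auto simp: conv_add_right)

lemma keys_conv:
  assumes "monoid G" "keys p \<subseteq> carrier G" "keys q \<subseteq> carrier G"
  shows "keys (conv G p q) \<subseteq> carrier G"
proof -
  interpret monoid G by fact
  show ?thesis unfolding conv_def
    using assms by (intro keys_lin) (auto simp: keys_single split: if_splits)
qed

lemma conv_assoc:
  assumes "monoid G" and p: "keys p \<subseteq> carrier G" and q: "keys q \<subseteq> carrier G" and r: "keys r \<subseteq> carrier G"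
  shows "conv G (conv G p q) r = conv G p (conv G q r)"
proof -
  interpret monoid G by fact
  show ?thesis using p
  proof (induction p rule: pm_induct)
    case (single g c)
    show ?case using q
    proof (induction q rule: pm_induct)
      case (single h d)
      show ?case using r
        by (induction r rule: pm_induct)
          (use \<open>g \<in> carrier G\<close> \<open>h \<in> carrier G\<close> in \<open>auto simp: conv_add_right m_assoc mult_ac\<close>)
    qed (auto simp: conv_add_left conv_add_right)
  qed (auto simp: conv_add_left)
qed

lemma conv_one:
  assumes "monoid G" and p: "keys p \<subseteq> carrier G"
  shows "conv G (single \<one>\<^bsub>G\<^esub> 1) p = p" "conv G p (single \<one>\<^bsub>G\<^esub> 1) = p"
proof -
  interpret monoid G by fact
  show "conv G (single \<one>\<^bsub>G\<^esub> 1) p = p" "conv G p (single \<one>\<^bsub>G\<^esub> 1) = p" using p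
    by (induction p rule: pm_induct) (auto simp: conv_add_right conv_add_left)
qed

lemma ring_monoid_algebra:
  assumes "monoid G"
  shows "ring (monoid_algebra G s)"
proof -
  interpret monoid G by fact
  have "\<exists>q. keys q \<subseteq> carrier G \<and> q + p = 0" if "keys p \<subseteq> carrier G" for p :: "'a \<Rightarrow>\<^sub>0 complex"
    by (rule exI[of _ "- p"]) (use that in auto)
  moreover have "keys (p + q) \<subseteq> carrier G" if "keys p \<subseteq> carrier G" "keys q \<subseteq> carrier G" for p q :: "'a \<Rightarrow>\<^sub>0 complex"
    using keys_add[of p q] that by blast
  ultimately show ?thesis
    by (intro ringI abelian_groupI monoid.intro)
      (auto simp: monoid_algebra_simps keys_conv conv_assoc conv_one assms conv_add_left conv_add_right
        algebra_simps keys_single)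
qed

section \<open>Complex algebras and their quotients\<close>

locale calg = ring A for A :: "('a, 'c) star_algebra_scheme" (structure) +
  assumes smult_closed [simp]: "x \<in> carrier A \<Longrightarrow> c \<odot> x \<in> carrier A"
    and smult_add: "x \<in> carrier A \<Longrightarrow> y \<in> carrier A \<Longrightarrow> c \<odot> (x \<oplus> y) = c \<odot> x \<oplus> c \<odot> y"
    and smult_assoc_l: "x \<in> carrier A \<Longrightarrow> y \<in> carrier A \<Longrightarrow> (c \<odot> x) \<otimes> y = c \<odot> (x \<otimes> y)"
    and smult_assoc_r: "x \<in> carrier A \<Longrightarrow> y \<in> carrier A \<Longrightarrow> x \<otimes> (c \<odot> y) = c \<odot> (x \<otimes> y)"

locale salg = calg +
  assumes star_closed [simp]: "x \<in> carrier A \<Longrightarrow> star x \<in> carrier A"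
    and star_add: "x \<in> carrier A \<Longrightarrow> y \<in> carrier A \<Longrightarrow> star (x \<oplus> y) = star x \<oplus> star y"
    and star_mult: "x \<in> carrier A \<Longrightarrow> y \<in> carrier A \<Longrightarrow> star (x \<otimes> y) = star y \<otimes> star x"

lemma (in salg) star_zero: "star \<zero> = \<zero>"
proof -
  have "star \<zero> \<oplus> star \<zero> = star \<zero>" using star_add[of \<zero> \<zero>] by simp
  then show ?thesis using add.l_cancel_one[of "star \<zero>" "star \<zero>"] by simp
qed

lemma (in salg) star_uminus: assumes x: "x \<in> carrier A" shows "star (\<ominus> x) = \<ominus> (star x)"
proof -
  have "star (\<ominus> x) \<oplus> star x = \<zero>" using star_add[of "\<ominus> x" x] x by (simp add: l_neg star_zero)
  from minus_equality[OF this] x show ?thesis by simp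
qed

lemma calg_monoid_algebra:
  assumes "monoid G"
  shows "calg (monoid_algebra G s)"
  by (intro calg.intro ring_monoid_algebra[OF assms] calg_axioms.intro)
    (auto simp: monoid_algebra_simps conv_scale_left conv_scale_right pm.scale_right_distrib
        dest: subsetD[OF keys_scale_pm])

lemma monoid_algebra_minus:
  assumes "monoid G" "keys p \<subseteq> carrier G"
  shows "\<ominus>\<^bsub>monoid_algebra G s\<^esub> p = - p"
proof -
  interpret ring "monoid_algebra G s" by (rule ring_monoid_algebra) fact
  show ?thesis
    by (rule minus_equality[symmetric] minus_equality) (use assms in \<open>auto simp: monoid_algebra_simps\<close>)
qed

text \<open>The ring axioms see only five record fields, so the quotient record extended by scalars
  and an involution inherits them from \<open>A Quot I\<close>.\<close>

lemma ring_scheme_cong: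
  assumes "carrier R = carrier S" "mult R = mult S" "one R = one S" "zero R = zero S" "add R = add S"
  shows "ring R \<longleftrightarrow> ring S"
  unfolding ring_def abelian_group_def abelian_monoid_def abelian_group_axioms_def
    monoid_def ring_axioms_def comm_group_def comm_monoid_def comm_monoid_axioms_def
    group_def group_axioms_def Units_def monoid.simps partial_object.simps assms ..

context calg begin

lemma smult_minus:
  assumes "x \<in> carrier A" "y \<in> carrier A"
  shows "c \<odot> (x \<ominus> y) = c \<odot> x \<ominus> c \<odot> y"
proof -
  have "c \<odot> (x \<ominus> y) \<oplus> c \<odot> y = c \<odot> ((x \<ominus> y) \<oplus> y)" using assms by (simp add: smult_add)
  also have "(x \<ominus> y) \<oplus> y = x" using assms by (simp add: a_assoc minus_eq l_neg)
  finally show ?thesis using assms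
    using add.inv_solve_right[of "c \<odot> (x \<ominus> y)" "c \<odot> x" "c \<odot> y"] by (simp add: minus_eq)
qed

text \<open>Scaling by \<open>c\<close> is multiplication by \<open>c\<close> times the unit, so
  every ring ideal is a subspace and scalars descend to the quotient.\<close>

lemma ideal_smult:
  assumes "ideal I A" "x \<in> I"
  shows "c \<odot> x \<in> I"
proof -
  interpret ideal I A by fact
  have x: "x \<in> carrier A" using assms(2) by (rule Icarr)
  have "(c \<odot> \<one>) \<otimes> x \<in> I" using assms by (intro I_l_closed) auto
  also have "(c \<odot> \<one>) \<otimes> x = c \<odot> x" using x by (simp add: smult_assoc_l)
  finally show ?thesis .
qed

end

lemma quotient_algebra_simps:
  "carrier (quotient_algebra A I) = (\<lambda>x. I +>\<^bsub>A\<^esub> x) ` carrier A"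
  "\<zero>\<^bsub>quotient_algebra A I\<^esub> = I"
  "\<one>\<^bsub>quotient_algebra A I\<^esub> = I +>\<^bsub>A\<^esub> \<one>\<^bsub>A\<^esub>"
  "X \<oplus>\<^bsub>quotient_algebra A I\<^esub> Y = X <+>\<^bsub>A\<^esub> Y"
  "X \<otimes>\<^bsub>quotient_algebra A I\<^esub> Y = rcoset_mult A I X Y"
  "c \<odot>\<^bsub>quotient_algebra A I\<^esub> X = (\<Union>x\<in>X. I +>\<^bsub>A\<^esub> (c \<odot>\<^bsub>A\<^esub> x))"
  "star\<^bsub>quotient_algebra A I\<^esub> X = (\<Union>x\<in>X. I +>\<^bsub>A\<^esub> (star\<^bsub>A\<^esub> x))"
  by (auto simp: quotient_algebra_def ring.defs FactRing_def A_RCOSETS_def RCOSETS_def a_r_coset_def)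

lemma ring_quotient_algebra:
  assumes "ideal I A"
  shows "ring (quotient_algebra A I)"
proof -
  have "ring (A Quot I)" using assms by (rule ideal.quotient_is_ring)
  then show ?thesis
    by (subst ring_scheme_cong[of _ "A Quot I"]) (simp_all add: quotient_algebra_def ring.defs)
qed

context ideal begin

lemma cls_eq_iff: "x \<in> carrier R \<Longrightarrow> y \<in> carrier R \<Longrightarrow> (I +> x) = (I +> y) \<longleftrightarrow> x \<ominus> y \<in> I"
  using quotient_eq_iff_same_a_r_cos[OF is_ideal] by simp

lemma cls_mem: "y \<in> (I +> x) \<Longrightarrow> x \<in> carrier R \<Longrightarrow> y \<in> carrier R \<and> (I +> y) = (I +> x)"
  by (metis a_r_coset_subset_G a_repr_independence a_subset a_subgroup subsetD)

lemma cls_self: "x \<in> carrier R \<Longrightarrow> x \<in> (I +> x)"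
  by (simp add: a_rcos_self)

text \<open>Scalars and involution of a quotient are unions over representatives. A map compatible
  with the ideal yields the same coset for each representative, so the union collapses.\<close>

lemma UN_cls:
  assumes "x \<in> carrier R" "\<And>y. y \<in> carrier R \<Longrightarrow> f y \<in> carrier R"
    "\<And>y. y \<in> carrier R \<Longrightarrow> y \<ominus> x \<in> I \<Longrightarrow> f y \<ominus> f x \<in> I"
  shows "(\<Union>y\<in>(I +> x). (I +> (f y))) = (I +> (f x))"
proof -
  have "(I +> (f y)) = (I +> (f x))" if "y \<in> (I +> x)" for y
    using cls_mem[OF that assms(1)] assms cls_eq_iff by metis
  then show ?thesis using cls_self[OF assms(1)] by blast
qed

end

locale calg_quot = calg A + ideal I A for A :: "('a, 'c) star_algebra_scheme" (structure) and I
begin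

abbreviation (input) "Q \<equiv> quotient_algebra A I"

lemma cls_add: "x \<in> carrier A \<Longrightarrow> y \<in> carrier A \<Longrightarrow> (I +> x) \<oplus>\<^bsub>Q\<^esub> (I +> y) = (I +> (x \<oplus> y))"
  by (simp add: quotient_algebra_simps a_rcos_sum)
lemma cls_mult: "x \<in> carrier A \<Longrightarrow> y \<in> carrier A \<Longrightarrow> (I +> x) \<otimes>\<^bsub>Q\<^esub> (I +> y) = (I +> (x \<otimes> y))"
  by (simp add: quotient_algebra_simps rcoset_mult_add)
lemma cls_smult: "x \<in> carrier A \<Longrightarrow> c \<odot>\<^bsub>Q\<^esub> (I +> x) = (I +> (c \<odot> x))"
  unfolding quotient_algebra_simps
  by (rule UN_cls) (auto simp: smult_minus[symmetric] ideal_smult[OF is_ideal])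
lemma cls_one: "\<one>\<^bsub>Q\<^esub> = (I +> \<one>)" by (simp add: quotient_algebra_simps)
lemma cls_zero: "\<zero>\<^bsub>Q\<^esub> = (I +> \<zero>)"
  by (simp add: quotient_algebra_simps a_coset_add_zero[OF a_subset])
lemma carrier_Q: "carrier Q = (\<lambda>x. I +> x) ` carrier A"
  by (simp add: quotient_algebra_simps)
lemma cls_carrier: "x \<in> carrier A \<Longrightarrow> (I +> x) \<in> carrier Q"
  by (simp add: carrier_Q)
lemma calg_Q: "calg Q"
proof (intro calg.intro ring_quotient_algebra[OF is_ideal] calg_axioms.intro)
qed (auto simp: carrier_Q cls_add cls_mult cls_smult smult_add smult_assoc_l smult_assoc_r)

lemma cls_uminus: assumes x: "x \<in> carrier A" shows "\<ominus>\<^bsub>Q\<^esub> ((I +> x)) = (I +> (\<ominus> x))"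
proof -
  interpret Q: ring Q by (rule ring_quotient_algebra[OF is_ideal])
  show ?thesis
    by (rule Q.minus_equality) (use x in \<open>auto simp: cls_carrier cls_add cls_zero l_neg\<close>)
qed

lemma cls_minus: "x \<in> carrier A \<Longrightarrow> y \<in> carrier A \<Longrightarrow> (I +> x) \<ominus>\<^bsub>Q\<^esub> (I +> y) = (I +> (x \<ominus> y))"
  by (simp add: a_minus_def cls_uminus cls_add)

text \<open>Lets an ideal of the free algebra, described by evaluations, serve as an upper bound for
  an ideal generated in a quotient.\<close>

lemma image_ideal:
  assumes "ideal J A"
  shows "ideal ((\<lambda>x. I +> x) ` J) Q"
proof -
  interpret J: ideal J A by fact
  interpret Q: ring Q by (rule ring_quotient_algebra[OF is_ideal])
  show ?thesis
  proof (rule idealI)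
    show "ring Q" ..
    show "subgroup ((\<lambda>x. I +> x) ` J) (add_monoid Q)"
    proof (rule Q.add.subgroupI)
      have "\<zero> \<in> J" by (rule additive_subgroup.zero_closed[OF J.is_additive_subgroup])
      then show "(\<lambda>x. I +> x) ` J \<noteq> {}" by blast
    next
      fix X assume "X \<in> (\<lambda>x. I +> x) ` J"
      then obtain x where x: "X = I +> x" "x \<in> J" by blast
      then have "\<ominus> x \<in> J" using J.additive_subgroup_axioms additive_subgroup.a_inv_closed by blast
      then show "\<ominus>\<^bsub>Q\<^esub> X \<in> (\<lambda>x. I +> x) ` J" using x by (simp add: cls_uminus J.Icarr)
    next
      fix X Y assume "X \<in> (\<lambda>x. I +> x) ` J" "Y \<in> (\<lambda>x. I +> x) ` J"
      then obtain x y where x: "X = I +> x" "x \<in> J" "Y = I +> y" "y \<in> J" by blast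
      then have "x \<oplus> y \<in> J" using additive_subgroup.a_closed[OF J.is_additive_subgroup] by blast
      then show "X \<oplus>\<^bsub>Q\<^esub> Y \<in> (\<lambda>x. I +> x) ` J" using x by (simp add: cls_add J.Icarr)
    qed (auto simp: J.Icarr carrier_Q)
  qed (auto simp: carrier_Q cls_mult J.Icarr J.I_l_closed J.I_r_closed)
qed

lemma cls_finsum:
  assumes "finite S" "f \<in> S \<rightarrow> carrier A"
  shows "(\<Oplus>\<^bsub>Q\<^esub>x\<in>S. (I +> (f x))) = (I +> (\<Oplus>x\<in>S. f x))"
proof -
  interpret Q: ring Q by (rule ring_quotient_algebra[OF is_ideal])
  show ?thesis using assms
  proof induction
    case empty then show ?case by (simp add: cls_zero)
  next
    case (insert x F)
    then have "f \<in> F \<rightarrow> carrier A" "f x \<in> carrier A" by auto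
    moreover from this have "(\<lambda>x. (I +> (f x))) \<in> F \<rightarrow> carrier Q" by (auto intro!: cls_carrier)
    ultimately show ?case using insert by (simp add: cls_add cls_carrier finsum_closed)
  qed
qed

end

locale salg_quot = salg A + calg_quot A I for A :: "('a, 'c) star_algebra_scheme" (structure) and I +
  assumes star_I: "x \<in> I \<Longrightarrow> star x \<in> I"
begin

lemma cls_star: "x \<in> carrier A \<Longrightarrow> star\<^bsub>Q\<^esub> ((I +> x)) = (I +> (star x))"
  unfolding quotient_algebra_simps
proof (rule UN_cls, simp_all)
  fix y assume "x \<in> carrier A" "y \<in> carrier A" "y \<ominus> x \<in> I"
  then show "star y \<ominus> star x \<in> I"
    using star_I[of "y \<ominus> x"] by (simp add: minus_eq star_add star_uminus)
qed

lemma salg_Q: "salg Q"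
proof (intro salg.intro calg_Q salg_axioms.intro)
qed (auto simp: carrier_Q cls_add cls_mult cls_star star_add star_mult)

end

context salg begin

text \<open>The involution reverses products, so the star-stable part of a two-sided ideal is again
  one. Minimality of a generated ideal, applied to this part, reduces questions about stars to the
  generators.\<close>

lemma ideal_Int_star:
  assumes "ideal I A"
  shows "ideal {x \<in> I. star x \<in> I} A"
proof -
  interpret ideal I A by fact
  let ?J = "{x \<in> I. star x \<in> I}"
  show ?thesis
  proof (rule idealI)
    show "ring A" ..
    show "subgroup ?J (add_monoid A)"
    proof (rule add.subgroupI)
      show "?J \<subseteq> carrier A" using Icarr by blast
      have "\<zero> \<in> ?J" by (simp add: star_zero)
      then show "?J \<noteq> {}" by blast
      fix x assume x: "x \<in> ?J"
      then have "x \<in> carrier A" using Icarr by blast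
      then show "\<ominus> x \<in> ?J" using x star_uminus[of x] by simp
      fix y assume y: "y \<in> ?J"
      then have "y \<in> carrier A" using Icarr by blast
      then show "x \<oplus> y \<in> ?J" using x y star_add[of x y] \<open>x \<in> carrier A\<close> by simp
    qed
  qed (auto simp: star_mult I_l_closed I_r_closed Icarr)
qed

lemma star_ideal_gen_subset:
  assumes "ideal I A" "S \<subseteq> I" "\<And>x. x \<in> S \<Longrightarrow> star x \<in> I" "\<And>x. x \<in> carrier A \<Longrightarrow> star (star x) = x"
  shows "star_ideal_gen A S \<subseteq> I"
proof -
  interpret ideal I A by fact
  have "star_ideal_gen A S \<subseteq> {x \<in> I. star x \<in> I}"
    unfolding star_ideal_gen_def using assms ideal_Int_star[OF assms(1)]
    by (intro Inter_lower) (auto simp: Icarr)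
  then show ?thesis by blast
qed

lemma star_ideal_gen_ideal:
  assumes "S \<subseteq> carrier A"
  shows "ideal (star_ideal_gen A S) A" "S \<subseteq> star_ideal_gen A S"
    "x \<in> star_ideal_gen A S \<Longrightarrow> star x \<in> star_ideal_gen A S"
proof -
  have "ideal (carrier A) A" by (rule oneideal)
  then show "ideal (star_ideal_gen A S) A" 
    unfolding star_ideal_gen_def using assms
    by (intro i_Intersect) (auto intro!: exI[of _ "carrier A"])
qed (auto simp: star_ideal_gen_def)

end

section \<open>The free *-algebra and its twisted evaluations\<close>

lemma atLeastAtMost_1_4: "{1..4::nat} = {1, 2, 3, 4}"
  by auto

lemma index_cases: "i \<in> {1..4::nat} \<Longrightarrow> i = 1 \<or> i = 2 \<or> i = 3 \<or> i = 4"
  by auto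

abbreviation word_monoid :: "'x list monoid" where
  "word_monoid \<equiv> \<lparr>carrier = UNIV, mult = (\<lambda>u v. u @ v), one = []\<rparr>"

abbreviation flip_letter :: "'x \<times> bool \<Rightarrow> 'x \<times> bool" where
  "flip_letter \<equiv> \<lambda>(x, b). (x, \<not> b)"

lemma monoid_word: "monoid word_monoid"
  by unfold_locales auto

lemma star_monoid_algebra_superset:
  "finite S \<Longrightarrow> keys p \<subseteq> S \<Longrightarrow>
     star\<^bsub>monoid_algebra G s\<^esub> p = (\<Sum>g\<in>S. single (s g) (cnj (lookup p g)))"
  unfolding monoid_algebra_simps by (rule sum.mono_neutral_left) (auto simp: in_keys_iff)

lemma star_monoid_algebra_add:
  "star\<^bsub>monoid_algebra G s\<^esub> (p + q) = star\<^bsub>monoid_algebra G s\<^esub> p + star\<^bsub>monoid_algebra G s\<^esub> q"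
proof -
  let ?S = "keys p \<union> keys q"
  have "keys (p + q) \<subseteq> ?S" by (rule keys_add)
  then show ?thesis
    by (simp add: star_monoid_algebra_superset[of ?S] lookup_add single_add sum.distrib)
qed

lemma star_monoid_algebra_single: "star\<^bsub>monoid_algebra G s\<^esub> (single g c) = single (s g) (cnj c)"
  by (simp add: star_monoid_algebra_superset[of "{g}"])

lemma star_monoid_algebra_zero: "star\<^bsub>monoid_algebra G s\<^esub> 0 = 0"
  by (simp add: monoid_algebra_simps)

lemma free_simps:
  "carrier free_star_algebra = UNIV"
  "\<one>\<^bsub>free_star_algebra\<^esub> = single [] 1"
  "\<zero>\<^bsub>free_star_algebra\<^esub> = 0"
  "p \<oplus>\<^bsub>free_star_algebra\<^esub> q = p + q"
  "c \<odot>\<^bsub>free_star_algebra\<^esub> p = scale_pm c p"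
  "\<ominus>\<^bsub>free_star_algebra\<^esub> p = - p"
  "p \<ominus>\<^bsub>free_star_algebra\<^esub> q = p - q"
  "star\<^bsub>free_star_algebra\<^esub> (single w d) = single (rev (map flip_letter w)) (cnj d)"
  "star\<^bsub>free_star_algebra\<^esub> (p + q) = star\<^bsub>free_star_algebra\<^esub> p + star\<^bsub>free_star_algebra\<^esub> q"
  "star\<^bsub>free_star_algebra\<^esub> 0 = 0"
  by (simp_all add: free_star_algebra_def monoid_algebra_simps(1-6) monoid_algebra_minus[OF monoid_word]
      a_minus_def star_monoid_algebra_single star_monoid_algebra_add star_monoid_algebra_zero)

abbreviation free_times (infixl "\<star>" 70) where
  "p \<star> q \<equiv> p \<otimes>\<^bsub>free_star_algebra\<^esub> q"

lemma free_mult: "p \<star> q = conv word_monoid p q"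
  by (simp add: free_star_algebra_def monoid_algebra_simps)

lemma free_mult_linear:
  "(p + q) \<star> r = p \<star> r + q \<star> r"
  "r \<star> (p + q) = r \<star> p + r \<star> q"
  "(p - q) \<star> r = p \<star> r - q \<star> r"
  "r \<star> (p - q) = r \<star> p - r \<star> q"
  "(- p) \<star> r = - (p \<star> r)"
  "r \<star> (- p) = - (r \<star> p)"
  "scale_pm c p \<star> r = scale_pm c (p \<star> r)"
  "r \<star> scale_pm c p = scale_pm c (r \<star> p)"
  "sum f S \<star> r = (\<Sum>x\<in>S. f x \<star> r)"
  "r \<star> sum f S = (\<Sum>x\<in>S. r \<star> f x)"
  "0 \<star> r = 0" "r \<star> 0 = 0"
  by (simp_all add: free_mult conv_add_left conv_add_right conv_diff_left conv_diff_right
      conv_uminus_left conv_uminus_right conv_scale_left conv_scale_right conv_sum_left conv_sum_right)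

lemma free_mult_single [simp]:
  "single u c \<star> single v d = single (u @ v) (c * d)"
  by (simp add: free_mult)

lemma free_induct [case_names zero single add]:
  fixes p :: "'g \<Rightarrow>\<^sub>0 complex"
  assumes "P 0" "\<And>g c. P (single g c)" "\<And>p q. P p \<Longrightarrow> P q \<Longrightarrow> P (p + q)"
  shows "P p"
  by (rule pm_induct[of p UNIV]) (use assms in auto)

lemma calg_free: "calg free_star_algebra"
  unfolding free_star_algebra_def by (rule calg_monoid_algebra[OF monoid_word])

lemma salg_free: "salg free_star_algebra"
proof (intro salg.intro calg_free salg_axioms.intro)
  fix x y :: "('a \<times> bool) list \<Rightarrow>\<^sub>0 complex"
  show "star\<^bsub>free_star_algebra\<^esub> (x \<star> y)
      = star\<^bsub>free_star_algebra\<^esub> y \<star> star\<^bsub>free_star_algebra\<^esub> x"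
  proof (induction x rule: free_induct)
    case (single u c)
    show ?case by (induction y rule: free_induct) (auto simp: free_mult_linear free_simps mult_ac)
  qed (auto simp: free_mult_linear free_simps)
qed (auto simp: free_simps)

lemma star_star_free: "star\<^bsub>free_star_algebra\<^esub> (star\<^bsub>free_star_algebra\<^esub> p) = p"
  by (induction p rule: free_induct) (auto simp: free_simps rev_map o_def case_prod_beta)

type_synonym letter = "gen \<times> bool"
type_synonym point = "nat \<Rightarrow> nat \<Rightarrow> complex"

text \<open>The eight generators and their adjoints fill the sixteen matrix positions exactly once,
  up to sign. Words in the free algebra are therefore words in the matrix entries;
  \<open>row\<close> and \<open>col\<close> invert the table, and the signs are kept apart in
  \<open>letter_sign\<close>.\<close>

fun letter :: "nat \<Rightarrow> nat \<Rightarrow> letter" where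
  "letter i j =
     [[(GA1, False), (GA2, False), (GB1, False), (GB2, False)],
      [(GA2, True), (GA1, True), (GB2, True), (GB1, True)],
      [(GC1, False), (GC2, False), (GD1, False), (GD2, False)],
      [(GC2, True), (GC1, True), (GD2, True), (GD1, True)]] ! (i - 1) ! (j - 1)"

fun gen_row :: "gen \<Rightarrow> nat" where
  "gen_row GA1 = 1" | "gen_row GA2 = 1" | "gen_row GB1 = 1" | "gen_row GB2 = 1"
| "gen_row GC1 = 3" | "gen_row GC2 = 3" | "gen_row GD1 = 3" | "gen_row GD2 = 3"

fun gen_col :: "gen \<Rightarrow> nat" where
  "gen_col GA1 = 1" | "gen_col GA2 = 2" | "gen_col GB1 = 3" | "gen_col GB2 = 4"
| "gen_col GC1 = 1" | "gen_col GC2 = 2" | "gen_col GD1 = 3" | "gen_col GD2 = 4"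

text \<open>\<open>A\<^sub>i\<^sub>j\<^sup>*\<close> is, up to sign, the entry at the partners of \<open>i\<close> and \<open>j\<close>.\<close>

definition partner :: "nat \<Rightarrow> nat" where
  "partner i = [2, 1, 4, 3] ! (i - 1)"

fun row :: "letter \<Rightarrow> nat" where "row (x, b) = (if b then partner (gen_row x) else gen_row x)"
fun col :: "letter \<Rightarrow> nat" where "col (x, b) = (if b then partner (gen_col x) else gen_col x)"
fun letter_sign :: "letter \<Rightarrow> complex" where
  "letter_sign (x, b) = (if b \<and> x \<in> {GA2, GB2, GC2, GD2} then - 1 else 1)"

lemma partner_simps [simp]:
  "partner 1 = 2" "partner (Suc 0) = 2" "partner 2 = 1" "partner 3 = 4" "partner 4 = 3"
  by (simp_all add: partner_def)

lemma row_range: "row a \<in> {1..4}" and col_range: "col a \<in> {1..4}"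
  by (cases a; cases "fst a"; simp)+

lemma letter_row_col [simp]: "letter (row a) (col a) = a"
  by (cases a; cases "fst a"; cases "snd a"; simp)

lemma row_letter: "i \<in> {1..4} \<Longrightarrow> j \<in> {1..4} \<Longrightarrow> row (letter i j) = i"
  and col_letter: "i \<in> {1..4} \<Longrightarrow> j \<in> {1..4} \<Longrightarrow> col (letter i j) = j"
  by (drule index_cases, drule index_cases, elim disjE; simp)+

lemma letter_sign_sq [simp]: "letter_sign a * letter_sign a = 1" "letter_sign a * (letter_sign a * c) = c" and letter_sign_nz [simp]: "letter_sign a \<noteq> 0"
  by (cases a; simp)+

lemma partner_range: "i \<in> {1..4} \<Longrightarrow> partner i \<in> {1..4}"
  by (drule index_cases, elim disjE; simp)+

lemma row_flip: "row (flip_letter a) = partner (row a)" and col_flip: "col (flip_letter a) = partner (col a)"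
  by (cases a; cases "fst a"; cases "snd a"; simp)+

lemma letter_sign_flip: "letter_sign (flip_letter a) = letter_sign a * (- 1) ^ (row a + col a)"
  by (cases a; cases "fst a"; cases "snd a"; simp)

declare letter.simps [simp del] row.simps [simp del] col.simps [simp del] letter_sign.simps [simp del]

subsection \<open>The twisting factors\<close>

lemma mu_cnj [simp]: "mu \<theta> * cnj (mu \<theta>) = 1" "cnj (mu \<theta>) * mu \<theta> = 1"
proof -
  have "cmod (mu \<theta>) = 1" by (simp add: mu_def)
  then show "mu \<theta> * cnj (mu \<theta>) = 1" by (simp add: complex_norm_square[symmetric])
  then show "cnj (mu \<theta>) * mu \<theta> = 1" by (simp add: mult.commute)
qed

lemma mu_half: "mu (\<theta> / 2) * mu (\<theta> / 2) = mu \<theta>"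
  by (simp add: mu_def exp_add[symmetric] mult_ac)

lemma cnj_mu_half: "cnj (mu (\<theta> / 2)) * cnj (mu (\<theta> / 2)) = cnj (mu \<theta>)"
  by (simp flip: complex_cnj_mult add: mu_half)

lemma eta_simps:
  "eta \<theta> 1 1 = 1" "eta \<theta> 1 2 = 1" "eta \<theta> 1 3 = cnj (mu \<theta>)" "eta \<theta> 1 4 = mu \<theta>"
  "eta \<theta> 2 1 = 1" "eta \<theta> 2 2 = 1" "eta \<theta> 2 3 = mu \<theta>" "eta \<theta> 2 4 = cnj (mu \<theta>)"
  "eta \<theta> 3 1 = mu \<theta>" "eta \<theta> 3 2 = cnj (mu \<theta>)" "eta \<theta> 3 3 = 1" "eta \<theta> 3 4 = 1"
  "eta \<theta> 4 1 = cnj (mu \<theta>)" "eta \<theta> 4 2 = mu \<theta>" "eta \<theta> 4 3 = 1" "eta \<theta> 4 4 = 1"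
  by (simp_all add: eta_def)

declare eta_simps [simp] eta_simps [unfolded One_nat_def, simp]

lemma mu_cnj_cancel [simp]: "mu \<theta> * (cnj (mu \<theta>) * x) = x" "cnj (mu \<theta>) * (mu \<theta> * x) = x"
  by (simp_all flip: mult.assoc)

lemma eta_inverse: "i \<in> {1..4} \<Longrightarrow> j \<in> {1..4} \<Longrightarrow> eta \<theta> i j * eta \<theta> j i = 1"
  by (drule index_cases, drule index_cases, elim disjE; simp)

lemma eta_partner: "i \<in> {1..4} \<Longrightarrow> j \<in> {1..4} \<Longrightarrow> eta \<theta> (partner i) (partner j) = eta \<theta> i j"
  by (drule index_cases, drule index_cases, elim disjE; simp)

lemma eta_cnj: "i \<in> {1..4} \<Longrightarrow> j \<in> {1..4} \<Longrightarrow> cnj (eta \<theta> i j) = eta \<theta> j i"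
  by (drule index_cases, drule index_cases, elim disjE; simp)

lemma eta_square: "i \<in> {1..4} \<Longrightarrow> j \<in> {1..4} \<Longrightarrow> eta (\<theta> / 2) i j * eta (\<theta> / 2) i j = eta \<theta> i j"
  by (drule index_cases, drule index_cases, elim disjE; simp add: mu_half cnj_mu_half)

text \<open>The half-twist is skew and squares to \<open>eta \<theta>\<close>, so the full twist
  turns a half-twist into its reverse. This is what makes the evaluations respect the commutation
  relations.\<close>

lemma eta_half: "i \<in> {1..4} \<Longrightarrow> j \<in> {1..4} \<Longrightarrow> eta \<theta> i j * eta (\<theta> / 2) j i = eta (\<theta> / 2) i j"
  by (simp add: eta_square[of i j \<theta>, symmetric] mult.assoc eta_inverse)

lemma eta_nz: "i \<in> {1..4} \<Longrightarrow> j \<in> {1..4} \<Longrightarrow> eta \<theta> i j \<noteq> 0"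
  using eta_inverse[of i j \<theta>] by auto

subsection \<open>Twisted evaluation at a matrix\<close>

text \<open>Reading off the first letter \<open>A\<^sub>i\<^sub>j\<close> of a word rescales the rows and columns of the point by
  half-twists, so that \<open>A\<^sub>i\<^sub>jA\<^sub>k\<^sub>l\<close> gets the phase \<open>eta (\<theta> / 2) k i * eta (\<theta> / 2) j l\<close>. The
  commutation factor \<open>\<eta>\<^sub>k\<^sub>i\<eta>\<^sub>j\<^sub>l\<close> is the quotient of this phase and that of \<open>A\<^sub>k\<^sub>lA\<^sub>i\<^sub>j\<close>.\<close>

definition rescale :: "(nat \<Rightarrow> complex) \<Rightarrow> (nat \<Rightarrow> complex) \<Rightarrow> point \<Rightarrow> point" where
  "rescale f h A = (\<lambda>k l. f k * h l * A k l)"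

definition letter_value :: "letter \<Rightarrow> point \<Rightarrow> complex" where
  "letter_value a A = letter_sign a * A (row a) (col a)"

fun phi :: "real \<Rightarrow> letter list \<Rightarrow> point \<Rightarrow> complex" where
  "phi \<theta> [] A = 1"
| "phi \<theta> (a # w) A = letter_value a A * phi \<theta> w (rescale (\<lambda>k. eta (\<theta> / 2) k (row a)) (\<lambda>l. eta (\<theta> / 2) (col a) l) A)"

definition ev :: "real \<Rightarrow> (letter list \<Rightarrow>\<^sub>0 complex) \<Rightarrow> point \<Rightarrow> complex" where
  "ev \<theta> p A = lin_functional (\<lambda>w. phi \<theta> w A) p"

lemma rescale_rescale: "rescale f h (rescale f' h' A) = rescale (\<lambda>k. f k * f' k) (\<lambda>l. h l * h' l) A"
  by (simp add: rescale_def mult_ac)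

lemma rescale_one: "rescale (\<lambda>_. 1) (\<lambda>_. 1) A = A" by (simp add: rescale_def)

lemma letter_value_rescale: "letter_value a (rescale f h A) = f (row a) * h (col a) * letter_value a A"
  by (simp add: letter_value_def rescale_def mult_ac)

lemma phi_rescale: "phi \<theta> w (rescale f h A) = (\<Prod>a\<leftarrow>w. f (row a) * h (col a)) * phi \<theta> w A"
proof (induction w arbitrary: A)
  case (Cons a w)
  let ?t = "rescale (\<lambda>k. eta (\<theta> / 2) k (row a)) (\<lambda>l. eta (\<theta> / 2) (col a) l)"
  have "?t (rescale f h A) = rescale f h (?t A)" by (simp add: rescale_rescale mult.commute)
  then show ?case by (simp add: letter_value_rescale Cons mult_ac)
qed simp

text \<open>\<open>ltw\<close> is the effect of a word on the point seen by a factor to its right,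
  \<open>rtw\<close> on the point seen by a factor to its left. The pair controls multiplication
  from both sides.\<close>

definition ltw :: "real \<Rightarrow> letter list \<Rightarrow> point \<Rightarrow> point" where
  "ltw \<theta> u = rescale (\<lambda>k. \<Prod>a\<leftarrow>u. eta (\<theta> / 2) k (row a)) (\<lambda>l. \<Prod>a\<leftarrow>u. eta (\<theta> / 2) (col a) l)"
definition rtw :: "real \<Rightarrow> letter list \<Rightarrow> point \<Rightarrow> point" where
  "rtw \<theta> v = rescale (\<lambda>k. \<Prod>b\<leftarrow>v. eta (\<theta> / 2) (row b) k) (\<lambda>l. \<Prod>b\<leftarrow>v. eta (\<theta> / 2) l (col b))"

lemma phi_append: "phi \<theta> (u @ v) A = phi \<theta> u A * phi \<theta> v (ltw \<theta> u A)"
proof (induction u arbitrary: A)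
  case Nil then show ?case by (simp add: ltw_def rescale_one)
next
  case (Cons a u) then show ?case by (simp add: ltw_def rescale_rescale mult_ac)
qed

lemma prod_list_swap: "(\<Prod>a\<leftarrow>u. \<Prod>b\<leftarrow>v. f a b) = (\<Prod>b\<leftarrow>v. \<Prod>a\<leftarrow>u. f a b :: 'a :: comm_monoid_mult)"
proof (induction u)
  case Nil show ?case by (induction v) auto
next
  case (Cons a u)
  have "(\<Prod>b\<leftarrow>v. g b) * (\<Prod>b\<leftarrow>v. h b) = (\<Prod>b\<leftarrow>v. g b * h b)" for g h :: "_ \<Rightarrow> 'a"
    by (induction v) (auto simp: mult_ac)
  then show ?case using Cons by simp
qed

lemma prod_list_mult: "(\<Prod>a\<leftarrow>u. f a * g a) = (\<Prod>a\<leftarrow>u. f a) * (\<Prod>a\<leftarrow>u. g a :: 'a :: comm_monoid_mult)"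
  by (induction u) (auto simp: mult_ac)

text \<open>The cross phase of \<open>u\<close> and \<open>v\<close> is a double product over pairs
  of letters, so it can be charged to either factor: \<open>phi_append\<close> charges it to
  \<open>v\<close>, here it goes to \<open>u\<close>.\<close>

lemma phi_append': "phi \<theta> (u @ v) A = phi \<theta> u (rtw \<theta> v A) * phi \<theta> v A"
proof -
  have "(\<Prod>b\<leftarrow>v. (\<Prod>a\<leftarrow>u. eta (\<theta> / 2) (row b) (row a)) * (\<Prod>a\<leftarrow>u. eta (\<theta> / 2) (col a) (col b)))
    = (\<Prod>a\<leftarrow>u. (\<Prod>b\<leftarrow>v. eta (\<theta> / 2) (row b) (row a)) * (\<Prod>b\<leftarrow>v. eta (\<theta> / 2) (col a) (col b)))"
    unfolding prod_list_mult prod_list_swap[of _ v u] ..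
  then show ?thesis unfolding phi_append ltw_def rtw_def phi_rescale by (simp add: mult_ac)
qed

lemma ev_linear:
  "ev \<theta> (p + q) A = ev \<theta> p A + ev \<theta> q A" "ev \<theta> (p - q) A = ev \<theta> p A - ev \<theta> q A"
  "ev \<theta> (- p) A = - ev \<theta> p A" "ev \<theta> (scale_pm c p) A = c * ev \<theta> p A" "ev \<theta> 0 A = 0"
  "ev \<theta> (single w c) A = c * phi \<theta> w A" "ev \<theta> (sum g S) A = (\<Sum>x\<in>S. ev \<theta> (g x) A)"
  by (simp_all add: ev_def lin_functional_add lin_functional_diff lin_functional_uminus lin_functional_scale lin_functional_sum)

lemma ev_mult_left: "ev \<theta> (single u c \<star> q) A = c * phi \<theta> u A * ev \<theta> q (ltw \<theta> u A)"
  by (induction q rule: free_induct) (auto simp: free_mult_linear ev_linear phi_append algebra_simps)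

lemma ev_mult_right: "ev \<theta> (p \<star> single v c) A = c * ev \<theta> p (rtw \<theta> v A) * phi \<theta> v A"
  by (induction p rule: free_induct) (auto simp: free_mult_linear ev_linear phi_append' algebra_simps)

text \<open>The diagonal matrices in Sp(4) for the form pairing 1 with 2 and 3 with 4. All phases
  picked up by reading words are of this kind.\<close>

definition torus :: "(nat \<Rightarrow> complex) \<Rightarrow> bool" where
  "torus f \<longleftrightarrow> f 1 * f 2 = 1 \<and> f 3 * f 4 = 1"

definition torus_stable :: "point set \<Rightarrow> bool" where
  "torus_stable Z \<longleftrightarrow> (\<forall>A\<in>Z. \<forall>f h. torus f \<longrightarrow> torus h \<longrightarrow> rescale f h A \<in> Z)"

lemma torus_eta: "i \<in> {1..4} \<Longrightarrow> torus (\<lambda>k. eta \<theta> k i)" "i \<in> {1..4} \<Longrightarrow> torus (eta \<theta> i)"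
  by (drule index_cases, elim disjE; simp add: torus_def)+

lemma torus_mult:
  assumes "torus f" "torus g"
  shows "torus (\<lambda>k. f k * g k)"
proof -
  have "f i * g i * (f j * g j) = (f i * f j) * (g i * g j)" for i j by (simp add: mult_ac)
  then show ?thesis using assms unfolding torus_def by (metis mult_1_right)
qed

lemma torus_prod_list: "(\<And>a. a \<in> set u \<Longrightarrow> torus (\<lambda>k. F k a)) \<Longrightarrow> torus (\<lambda>k. \<Prod>a\<leftarrow>u. F k a)"
proof (induction u)
  case (Cons a u)
  then show ?case using torus_mult[of "\<lambda>k. F k a" "\<lambda>k. \<Prod>a\<leftarrow>u. F k a"] by simp
qed (simp add: torus_def)

lemma torus_stable_tw:
  assumes "torus_stable Z" "A \<in> Z"
  shows "ltw \<theta> u A \<in> Z" "rtw \<theta> u A \<in> Z"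
proof -
  have "torus (\<lambda>k. \<Prod>a\<leftarrow>u. eta (\<theta> / 2) k (row a))" "torus (\<lambda>k. \<Prod>a\<leftarrow>u. eta (\<theta> / 2) (col a) k)"
    "torus (\<lambda>k. \<Prod>a\<leftarrow>u. eta (\<theta> / 2) (row a) k)" "torus (\<lambda>k. \<Prod>a\<leftarrow>u. eta (\<theta> / 2) k (col a))"
    by (rule torus_prod_list, rule torus_eta, rule row_range col_range)+
  then show "ltw \<theta> u A \<in> Z" "rtw \<theta> u A \<in> Z"
    using assms unfolding ltw_def rtw_def torus_stable_def by blast+
qed

definition vanishing :: "real \<Rightarrow> point set \<Rightarrow> (letter list \<Rightarrow>\<^sub>0 complex) set" where
  "vanishing \<theta> Z = {p. \<forall>A\<in>Z. ev \<theta> p A = 0}"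

text \<open>Multiplying by a word multiplies the value by a number and moves the point by a torus
  element. As the point stays in \<open>Z\<close>, vanishing on \<open>Z\<close> survives
  multiplication from both sides.\<close>

lemma vanishing_ideal:
  assumes "torus_stable Z"
  shows "ideal (vanishing \<theta> Z) free_star_algebra"
proof -
  interpret calg free_star_algebra by (rule calg_free)
  show ?thesis
  proof (rule idealI)
    show "ring free_star_algebra" ..
    show "subgroup (vanishing \<theta> Z) (add_monoid free_star_algebra)"
    proof (rule add.subgroupI)
      have "0 \<in> vanishing \<theta> Z" by (simp add: vanishing_def ev_linear)
      then show "vanishing \<theta> Z \<noteq> {}" by blast
    qed (auto simp: free_simps vanishing_def ev_linear)
    fix p x :: "letter list \<Rightarrow>\<^sub>0 complex" assume p: "p \<in> vanishing \<theta> Z"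
    show "x \<star> p \<in> vanishing \<theta> Z"
      by (induction x rule: free_induct)
        (use p assms in \<open>auto simp: vanishing_def free_mult_linear ev_linear ev_mult_left torus_stable_tw\<close>)
    show "p \<star> x \<in> vanishing \<theta> Z"
      by (induction x rule: free_induct)
        (use p assms in \<open>auto simp: vanishing_def free_mult_linear ev_linear ev_mult_right torus_stable_tw\<close>)
  qed
qed

text \<open>The conjugation of \<open>4 \<times> 4\<close> matrices whose fixed points are the quaternionic matrices.\<close>

definition quat_conj :: "point \<Rightarrow> point" where
  "quat_conj A = (\<lambda>k l. (- 1) ^ (k + l) * cnj (A (partner k) (partner l)))"

lemma letter_value_flip: "letter_value (flip_letter a) A = cnj (letter_value a (quat_conj A))"
proof -
  have "cnj (letter_sign a) = letter_sign a" by (cases a) (simp add: letter_sign.simps)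
  then show ?thesis
    by (simp add: letter_value_def quat_conj_def row_flip col_flip letter_sign_flip split del: prod.split)
qed

text \<open>The adjoint reverses a word and passes to partner indices. \<open>eta\<close> is
  unchanged when both arguments are replaced by their partners, and reversal swaps its arguments,
  which is complex conjugation of the phase.\<close>

lemma phi_star: "phi \<theta> (rev (map flip_letter w)) A = cnj (phi \<theta> w (quat_conj A))"
proof (induction w)
  case (Cons a w)
  have *: "eta (\<theta> / 2) (row (flip_letter a)) (row (flip_letter b)) = cnj (eta (\<theta> / 2) (row b) (row a))"
    "eta (\<theta> / 2) (col (flip_letter b)) (col (flip_letter a)) = cnj (eta (\<theta> / 2) (col a) (col b))" for b
    by (simp_all only: row_flip col_flip eta_partner eta_cnj row_range col_range)
  have "(\<Prod>b\<leftarrow>w. eta (\<theta> / 2) (row (flip_letter a)) (row (flip_letter b)) *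
            eta (\<theta> / 2) (col (flip_letter b)) (col (flip_letter a)))
      = cnj (\<Prod>b\<leftarrow>w. eta (\<theta> / 2) (row b) (row a) * eta (\<theta> / 2) (col a) (col b))"
    unfolding * by (induction w) auto
  moreover have "(\<Prod>b\<leftarrow>w. eta (\<theta> / 2) (row (flip_letter a)) (row (flip_letter b)) *
            eta (\<theta> / 2) (col (flip_letter b)) (col (flip_letter a))) =
    (\<Prod>b\<leftarrow>rev (map flip_letter w). eta (\<theta> / 2) (row (flip_letter a)) (row b)) *
    (\<Prod>b\<leftarrow>rev (map flip_letter w). eta (\<theta> / 2) (col b) (col (flip_letter a)))"
    by (induction w) (simp_all only: list.map rev.simps map_append prod_list.append, simp_all add: mult_ac)
  ultimately show ?case
    using Cons by (simp add: phi_append ltw_def letter_value_rescale phi_rescale letter_value_flip mult_ac)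
qed simp

lemma ev_star: "ev \<theta> (star\<^bsub>free_star_algebra\<^esub> p) A = cnj (ev \<theta> p (quat_conj A))"
  by (induction p rule: free_induct) (auto simp: free_simps ev_linear phi_star)

subsection \<open>The relations of \<open>M\<^sub>\<theta>(2, \<H>)\<close>\<close>

definition ent :: "nat \<Rightarrow> nat \<Rightarrow> (letter list \<Rightarrow>\<^sub>0 complex)" where
  "ent i j = single [letter i j] (letter_sign (letter i j))"

lemma quat_matrix_free:
  "i \<in> {1..4} \<Longrightarrow> j \<in> {1..4} \<Longrightarrow> quat_matrix free_star_algebra free_gen i j = ent i j"
  by (drule index_cases, drule index_cases, elim disjE;
      simp add: quat_matrix_def ent_def letter.simps letter_sign.simps free_gen_def free_simps single_uminus)

definition twist :: "real \<Rightarrow> letter \<Rightarrow> letter \<Rightarrow> complex" where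
  "twist \<theta> a b = eta \<theta> (row b) (row a) * eta \<theta> (col a) (col b)"

definition letter_relation :: "real \<Rightarrow> letter \<Rightarrow> letter \<Rightarrow> (letter list \<Rightarrow>\<^sub>0 complex)" where
  "letter_relation \<theta> a b = single [a, b] 1 - scale_pm (twist \<theta> a b) (single [b, a] 1)"

lemma M_relations_eq:
  "M_relations \<theta> = {scale_pm (letter_sign a * letter_sign b) (letter_relation \<theta> a b) | a b. True}" (is "?L = ?R")
proof -
  have *: "(ent i j \<star> ent k l) - scale_pm (eta \<theta> k i * eta \<theta> j l)
      (ent k l \<star> ent i j)
    = scale_pm (letter_sign (letter i j) * letter_sign (letter k l)) (letter_relation \<theta> (letter i j) (letter k l))"
    if "i \<in> {1..4}" "j \<in> {1..4}" "k \<in> {1..4}" "l \<in> {1..4}" for i j k l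
    using that by (simp add: ent_def letter_relation_def twist_def row_letter col_letter
        pm.scale_right_diff_distrib mult_ac)
  have L: "?L = {scale_pm (letter_sign (letter i j) * letter_sign (letter k l)) (letter_relation \<theta> (letter i j) (letter k l))
      | i j k l. i \<in> {1..4} \<and> j \<in> {1..4} \<and> k \<in> {1..4} \<and> l \<in> {1..4}}"
    unfolding M_relations_def Let_def free_simps
    by (intro Collect_cong ex_cong1) (metis quat_matrix_free *)
  show ?thesis unfolding L
  proof (intro equalityI subsetI)
    fix x assume "x \<in> ?R"
    then obtain a b where x: "x = scale_pm (letter_sign a * letter_sign b) (letter_relation \<theta> a b)" by auto
    show "x \<in> {scale_pm (letter_sign (letter i j) * letter_sign (letter k l)) (letter_relation \<theta> (letter i j) (letter k l))
      | i j k l. i \<in> {1..4} \<and> j \<in> {1..4} \<and> k \<in> {1..4} \<and> l \<in> {1..4}}"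
      unfolding x by (intro CollectI exI[of _ "row a"] exI[of _ "col a"] exI[of _ "row b"] exI[of _ "col b"])
       (metis letter_row_col row_range col_range)
  qed blast
qed

lemma ev_letter_relation: "ev \<theta> (letter_relation \<theta> a b) A = 0"
proof -
  let ?e = "eta (\<theta> / 2)"
  have "?e (row b) (row a) * ?e (col a) (col b)
      = twist \<theta> a b * (?e (row a) (row b) * ?e (col b) (col a))"
    using eta_half[OF row_range row_range, of \<theta> b a] eta_half[OF col_range col_range, of \<theta> a b]
    by (simp add: twist_def mult_ac)
  then have "letter_value a A * letter_value b A * (?e (row b) (row a) * ?e (col a) (col b)) =
      letter_value a A * letter_value b A * (twist \<theta> a b * (?e (row a) (row b) * ?e (col b) (col a)))" by simp
  then show ?thesis
    by (simp add: letter_relation_def ev_linear letter_value_rescale mult_ac)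
qed

text \<open>The adjoint of a relation is a multiple of the relation for the flipped letters in
  opposite order, so the star-ideal is controlled by the letter relations themselves.\<close>

lemma star_letter_relation:
  "star\<^bsub>free_star_algebra\<^esub> (scale_pm c (letter_relation \<theta> a b))
     = scale_pm (cnj c) (letter_relation \<theta> (flip_letter b) (flip_letter a))"
proof -
  have "cnj (twist \<theta> a b) = twist \<theta> (flip_letter b) (flip_letter a)"
    by (simp only: twist_def row_flip col_flip eta_partner row_range col_range complex_cnj_mult eta_cnj)
  moreover have "star\<^bsub>free_star_algebra\<^esub> (p - q) = star\<^bsub>free_star_algebra\<^esub> p - star\<^bsub>free_star_algebra\<^esub> q" for p q :: "letter list \<Rightarrow>\<^sub>0 complex"
    using free_simps(9)[of "p - q" q] by simp
  ultimately show ?thesis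
    by (simp add: letter_relation_def pm.scale_right_diff_distrib free_simps split del: prod.split)
qed

lemma M_ideal_ideal: "ideal (M_ideal \<theta>) free_star_algebra"
  and M_relations_M_ideal: "M_relations \<theta> \<subseteq> M_ideal \<theta>"
  and M_ideal_star: "p \<in> M_ideal \<theta> \<Longrightarrow> star\<^bsub>free_star_algebra\<^esub> p \<in> M_ideal \<theta>"
  using salg.star_ideal_gen_ideal[OF salg_free, of "M_relations \<theta>"]
  by (auto simp: M_ideal_def free_simps)

lemma M_ideal_least:
  assumes "ideal I free_star_algebra" "\<And>a b. letter_relation \<theta> a b \<in> I"
  shows "M_ideal \<theta> \<subseteq> I"
  unfolding M_ideal_def
proof (rule salg.star_ideal_gen_subset[OF salg_free assms(1)])
  have *: "scale_pm c (letter_relation \<theta> a b) \<in> I" for c a b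
    using calg.ideal_smult[OF calg_free assms(1,2)] by (simp add: free_simps)
  then show "M_relations \<theta> \<subseteq> I" by (auto simp: M_relations_eq)
  fix x assume "x \<in> M_relations \<theta>"
  then show "star\<^bsub>free_star_algebra\<^esub> x \<in> I"
    using * by (auto simp: M_relations_eq star_letter_relation simp del: complex_cnj_mult)
qed (simp add: star_star_free)

lemma letter_relation_M_ideal: "letter_relation \<theta> a b \<in> M_ideal \<theta>"
proof -
  have "scale_pm (letter_sign a * letter_sign b) (letter_relation \<theta> a b) \<in> M_ideal \<theta>"
    using M_relations_M_ideal[of \<theta>] unfolding M_relations_eq by blast
  from calg.ideal_smult[OF calg_free M_ideal_ideal this, of "letter_sign a * letter_sign b"]
  have "scale_pm ((letter_sign a * letter_sign b) * (letter_sign a * letter_sign b)) (letter_relation \<theta> a b) \<in> M_ideal \<theta>"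
    by (simp add: free_simps)
  also have "(letter_sign a * letter_sign b) * (letter_sign a * letter_sign b) = 1" by (simp add: mult_ac)
  finally show ?thesis by simp
qed

lemma ev_M_ideal: "p \<in> M_ideal \<theta> \<Longrightarrow> ev \<theta> p A = 0"
proof -
  have "M_ideal \<theta> \<subseteq> vanishing \<theta> UNIV"
    by (rule M_ideal_least[OF vanishing_ideal])
      (auto simp: torus_stable_def vanishing_def ev_letter_relation)
  then show "p \<in> M_ideal \<theta> \<Longrightarrow> ev \<theta> p A = 0" by (auto simp: vanishing_def)
qed

subsection \<open>Faithfulness of the twisted evaluations\<close>

lemma M_ideal_simps:
  "p \<in> M_ideal \<theta> \<Longrightarrow> q \<in> M_ideal \<theta> \<Longrightarrow> p + q \<in> M_ideal \<theta>"
  "p \<in> M_ideal \<theta> \<Longrightarrow> q \<in> M_ideal \<theta> \<Longrightarrow> p - q \<in> M_ideal \<theta>"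
  "0 \<in> M_ideal \<theta>"
  "p \<in> M_ideal \<theta> \<Longrightarrow> scale_pm c p \<in> M_ideal \<theta>"
  "p \<in> M_ideal \<theta> \<Longrightarrow> q \<star> p \<in> M_ideal \<theta>"
  "p \<in> M_ideal \<theta> \<Longrightarrow> p \<star> q \<in> M_ideal \<theta>"
proof -
  interpret ideal "M_ideal \<theta>" free_star_algebra by (rule M_ideal_ideal)
  show add: "p \<in> M_ideal \<theta> \<Longrightarrow> q \<in> M_ideal \<theta> \<Longrightarrow> p + q \<in> M_ideal \<theta>" for p q
    using additive_subgroup.a_closed[OF is_additive_subgroup] by (simp add: free_simps)
  show scale: "p \<in> M_ideal \<theta> \<Longrightarrow> scale_pm c p \<in> M_ideal \<theta>" for p c
    using calg.ideal_smult[OF calg_free M_ideal_ideal] by (simp add: free_simps)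
  show "p \<in> M_ideal \<theta> \<Longrightarrow> q \<in> M_ideal \<theta> \<Longrightarrow> p - q \<in> M_ideal \<theta>"
    using add[of p "- q"] scale[of q "-1"] by (simp add: scale_pm_minus1)
  show "0 \<in> M_ideal \<theta>" using additive_subgroup.zero_closed[OF is_additive_subgroup] by (simp add: free_simps)
  show "p \<in> M_ideal \<theta> \<Longrightarrow> q \<star> p \<in> M_ideal \<theta>"
    "p \<in> M_ideal \<theta> \<Longrightarrow> p \<star> q \<in> M_ideal \<theta>"
    using I_l_closed I_r_closed by (simp_all add: free_simps)
qed

lemma word_move_front: "\<exists>c. single (u @ a # v) 1 - scale_pm c (single (a # u @ v) 1) \<in> M_ideal \<theta>"
proof (induction u)
  case Nil
  have "single ([] @ a # v) 1 - scale_pm 1 (single (a # [] @ v) 1) \<in> M_ideal \<theta>" by (simp add: M_ideal_simps)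
  then show ?case by blast
next
  case (Cons x u)
  then obtain c where c: "single (u @ a # v) 1 - scale_pm c (single (a # u @ v) 1) \<in> M_ideal \<theta>" by blast
  have "single [x] 1 \<star> (single (u @ a # v) 1 - scale_pm c (single (a # u @ v) 1)) +
      scale_pm c (letter_relation \<theta> x a \<star> single (u @ v) 1) \<in> M_ideal \<theta>"
    by (intro M_ideal_simps c letter_relation_M_ideal)
  then have "single ((x # u) @ a # v) 1 - scale_pm (c * twist \<theta> x a) (single (a # (x # u) @ v) 1) \<in> M_ideal \<theta>"
    by (simp add: letter_relation_def free_mult_linear pm.scale_right_diff_distrib)
  then show ?case by blast
qed

text \<open>Words with the same letters are proportional modulo the relations. The scalar can stay
  unspecified: the lemma only serves to leave one spanning word for each multiset of
  letters.\<close>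

lemma word_perm: "mset w = mset w' \<Longrightarrow> \<exists>c. single w 1 - scale_pm c (single w' 1) \<in> M_ideal \<theta>"
proof (induction w' arbitrary: w)
  case Nil
  have "single w 1 - scale_pm 1 (single [] 1) \<in> M_ideal \<theta>" using Nil by (simp add: M_ideal_simps)
  then show ?case by blast
next
  case (Cons a w')
  then have "a \<in> set w" by (metis list.set_intros(1) mset_eq_setD)
  then obtain u v where w: "w = u @ a # v" by (meson split_list)
  obtain c where c: "single w 1 - scale_pm c (single (a # u @ v) 1) \<in> M_ideal \<theta>"
    using word_move_front w by blast
  have "mset (u @ v) = mset w'" using Cons.prems w by simp
  then obtain d where d: "single (u @ v) 1 - scale_pm d (single w' 1) \<in> M_ideal \<theta>" using Cons.IH by blast
  have "(single w 1 - scale_pm c (single (a # u @ v) 1)) +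
    scale_pm c (single [a] 1 \<star> (single (u @ v) 1 - scale_pm d (single w' 1))) \<in> M_ideal \<theta>"
    by (intro M_ideal_simps c d)
  then have "single w 1 - scale_pm (c * d) (single (a # w') 1) \<in> M_ideal \<theta>"
    by (simp add: free_mult_linear pm.scale_right_diff_distrib)
  then show ?case by blast
qed

text \<open>Monomials are characters of the multiplicative monoid of points, so Dedekind's argument for the
  independence of characters applies.\<close>

lemma monomials_independent:
  fixes c :: "'b list \<Rightarrow> complex"
  assumes "finite S" "inj_on mset S" "\<And>z. (\<Sum>w\<in>S. c w * (\<Prod>a\<leftarrow>w. z a)) = 0" "w \<in> S"
  shows "c w = 0"
  using assms
proof (induction S arbitrary: c w)
  case (insert u S)
  let ?X = "\<lambda>w (z :: 'b \<Rightarrow> complex). \<Prod>a\<leftarrow>w. z a"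
  have X: "?X w (\<lambda>a. y a * z a) = ?X w y * ?X w z" for w y z by (induction w) auto
  have S0: "c w = 0" if w: "w \<in> S" for w
  proof -
    have "c w * (?X w y - ?X u y) = 0" for y
    proof (rule insert.IH[OF _ _ w])
      show "inj_on mset S" using insert.prems by simp
      fix z
      \<comment> \<open>Evaluating the relation at the product of \<open>y\<close> and
        \<open>z\<close> and subtracting \<open>?X u y\<close> times the relation at
        \<open>z\<close> eliminates \<open>u\<close>.\<close>
      have "(\<Sum>w\<in>S. c w * (?X w y - ?X u y) * ?X w z)
        = (\<Sum>w\<in>insert u S. c w * ?X w (\<lambda>a. y a * z a)) - ?X u y * (\<Sum>w\<in>insert u S. c w * ?X w z)"
        using insert.hyps by (simp add: X algebra_simps sum_subtractf sum_distrib_left)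
      then show "(\<Sum>w\<in>S. c w * (?X w y - ?X u y) * ?X w z) = 0"
        by (simp only: insert.prems(2)) simp
    qed
    moreover have "\<exists>y. ?X w y \<noteq> ?X u y"
    proof -
      have "mset w \<noteq> mset u" using insert.hyps insert.prems w by (metis inj_onD insertI1 insertI2)
      then obtain a where a: "count (mset w) a \<noteq> count (mset u) a" by (meson multiset_eqI)
      have "?X v (\<lambda>b. if b = a then 2 else 1) = 2 ^ count (mset v) a" for v by (induction v) auto
      moreover have "(2 :: complex) ^ m \<noteq> 2 ^ n" if "m \<noteq> n" for m n :: nat
      proof
        assume "(2 :: complex) ^ m = 2 ^ n"
        then have "of_nat (2 ^ m) = (of_nat (2 ^ n) :: complex)" by simp
        then have "(2::nat) ^ m = 2 ^ n" by (simp only: of_nat_eq_iff)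
        then show False using that by simp
      qed
      ultimately show ?thesis using a by metis
    qed
    ultimately show ?thesis by auto
  qed
  have "(\<Sum>w\<in>S. c w * ?X w (\<lambda>_. 1)) = 0" using S0 by simp
  moreover have "?X u (\<lambda>_. 1) = 1" by (induction u) auto
  ultimately have "c u = 0" using insert.prems(2)[of "\<lambda>_. 1"] insert.hyps by simp
  then show ?case using S0 insert.prems by auto
qed simp

lemma phi_monomial: "\<exists>k. k \<noteq> 0 \<and> (\<forall>A. phi \<theta> w A = k * (\<Prod>a\<leftarrow>w. letter_value a A))"
proof (induction w)
  case Nil show ?case by (rule exI[of _ 1]) simp
next
  case (Cons a w)
  then obtain k where k: "k \<noteq> 0" "\<And>A. phi \<theta> w A = k * (\<Prod>a\<leftarrow>w. letter_value a A)" by blast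
  let ?t = "\<Prod>b\<leftarrow>w. eta (\<theta> / 2) (row b) (row a) * eta (\<theta> / 2) (col a) (col b)"
  have "?t \<noteq> 0" by (induction w) (use eta_nz row_range col_range in auto)
  then show ?case using k by (intro exI[of _ "?t * k"]) (simp add: phi_rescale mult_ac)
qed

text \<open>Modulo the ideal, \<open>p\<close> becomes a combination \<open>q\<close> of one word
  per multiset. The words of \<open>q\<close> evaluate to nonzero multiples of distinct monomials,
  and these are independent, so \<open>q\<close> is zero if all its values vanish.\<close>

lemma M_ideal_iff: "p \<in> M_ideal \<theta> \<longleftrightarrow> (\<forall>A. ev \<theta> p A = 0)"
proof (intro iffI allI)
  assume p: "\<forall>A. ev \<theta> p A = 0"
  define rep :: "letter multiset \<Rightarrow> letter list" where "rep = (\<lambda>X. SOME w. mset w = X)"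
  have rep: "mset (rep X) = X" for X unfolding rep_def by (rule someI_ex) (rule ex_mset)
  have "\<exists>c. single w 1 - scale_pm c (single (rep (mset w)) 1) \<in> M_ideal \<theta>" for w
    by (rule word_perm) (simp add: rep)
  then obtain c where c: "\<And>w. single w 1 - scale_pm (c w) (single (rep (mset w)) 1) \<in> M_ideal \<theta>" by metis
  define q where "q = lin (\<lambda>w. scale_pm (c w) (single (rep (mset w)) 1)) p"
  have pq: "p - q \<in> M_ideal \<theta>"
    unfolding q_def
  proof (induction p rule: free_induct)
    case (single w d)
    show ?case using M_ideal_simps(4)[OF c[of w], of d] by (simp add: pm.scale_right_diff_distrib)
  next
    case (add p q)
    show ?case using M_ideal_simps(1)[OF add] by (simp add: lin_add algebra_simps)
  qed (simp add: M_ideal_simps)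
  have evq: "ev \<theta> q A = 0" for A using ev_M_ideal[OF pq, of A] p by (simp add: ev_linear)
  have "keys q \<subseteq> range rep" unfolding q_def by (rule keys_lin) (auto simp: keys_single split: if_splits)
  then have inj: "inj_on mset (keys q)" by (intro inj_onI) (metis rangeE rep subsetD)
  obtain k where k: "\<And>w. k w \<noteq> 0" "\<And>w A. phi \<theta> w A = k w * (\<Prod>a\<leftarrow>w. letter_value a A)"
    using phi_monomial by metis
  have "lookup q w * k w = 0" if "w \<in> keys q" for w
  proof (rule monomials_independent[OF finite_keys inj _ that])
    fix z
    \<comment> \<open>Letters and positions correspond one to one, so letter values can be
      prescribed freely; the sign cancels the one in \<open>letter_value\<close>.\<close>
    define A :: point where "A = (\<lambda>i j. z (letter i j) * letter_sign (letter i j))"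
    have "letter_value a A = z a" for a by (simp add: letter_value_def A_def mult_ac)
    then show "(\<Sum>w\<in>keys q. lookup q w * k w * (\<Prod>a\<leftarrow>w. z a)) = 0"
      using evq[of A] by (simp add: ev_def lin_functional_def k mult_ac)
  qed
  then have "keys q = {}" using k(1) by (metis all_not_in_conv lookup_not_eq_zero_eq_in_keys mult_eq_0_iff)
  then have "q = 0" by simp
  then show "p \<in> M_ideal \<theta>" using pq by simp
qed (rule ev_M_ideal)

subsection \<open>The determinant\<close>

lemma sum_permutes_4:
  fixes F :: "int \<Rightarrow> nat \<Rightarrow> nat \<Rightarrow> nat \<Rightarrow> nat \<Rightarrow> 'a :: comm_monoid_add"
  shows "(\<Sum>\<sigma>\<in>{\<sigma>. \<sigma> permutes {1..4::nat}}. F (sign \<sigma>) (\<sigma> 1) (\<sigma> 2) (\<sigma> 3) (\<sigma> 4)) =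
    F 1 1 2 3 4 + F (-1) 1 2 4 3 + F (-1) 1 3 2 4 + F 1 1 3 4 2 + F 1 1 4 2 3 + F (-1) 1 4 3 2 +
    F (-1) 2 1 3 4 + F 1 2 1 4 3 + F 1 2 3 1 4 + F (-1) 2 3 4 1 + F (-1) 2 4 1 3 + F 1 2 4 3 1 +
    F 1 3 1 2 4 + F (-1) 3 1 4 2 + F (-1) 3 2 1 4 + F 1 3 2 4 1 + F 1 3 4 1 2 + F (-1) 3 4 2 1 +
    F (-1) 4 1 2 3 + F 1 4 1 3 2 + F 1 4 2 1 3 + F (-1) 4 2 3 1 + F (-1) 4 3 1 2 + F 1 4 3 2 1"
proof -
  have f: "finite {2,3,4::nat}" "1 \<notin> {2,3,4::nat}" "finite {3,4::nat}" "2 \<notin> {3,4::nat}" "finite {4::nat}" "3 \<notin> {4::nat}"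
    by auto
  have p4: "{p. p permutes {4::nat}} = {id}" by (auto simp: permutes_sing)
  have perm: "permutation (transpose a b)" for a b :: nat by (rule permutation_swap_id)
  show ?thesis
    unfolding atLeastAtMost_1_4 sum_over_permutations_insert[OF f(1,2)] sum_over_permutations_insert[OF f(3,4)]
      sum_over_permutations_insert[OF f(5,6)] p4
    by (simp add: sign_compose perm permutation_compose sign_swap_id sign_id transpose_def add_ac del: One_nat_def)
qed

lemma eps_eq: "eps \<theta> is =
  (if is \<in> {[1,3,2,4],[3,2,4,1],[2,4,1,3],[4,1,3,2]} then mu \<theta>
   else if is \<in> {[1,4,2,3],[4,2,3,1],[2,3,1,4],[3,1,4,2]} then cnj (mu \<theta>) else 1)"
proof -
  have "(\<exists>r. is = rotate r [a,b,c,d]) \<longleftrightarrow> is \<in> {[a,b,c,d],[b,c,d,a],[c,d,a,b],[d,a,b,c]}" for a b c d :: nat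
  proof -
    have R: "rotate 0 [a,b,c,d] = [a,b,c,d]" "rotate 1 [a,b,c,d] = [b,c,d,a]"
      "rotate 2 [a,b,c,d] = [c,d,a,b]" "rotate 3 [a,b,c,d] = [d,a,b,c]"
      by (simp_all add: rotate_def numeral_2_eq_2 numeral_3_eq_3)
    have "rotate r [a,b,c,d] \<in> {[a,b,c,d],[b,c,d,a],[c,d,a,b],[d,a,b,c]}" for r
    proof -
      have "r mod 4 < 4" by simp
      then have "r mod 4 = 0 \<or> r mod 4 = 1 \<or> r mod 4 = 2 \<or> r mod 4 = 3" by linarith
      moreover have "rotate r [a,b,c,d] = rotate (r mod 4) [a,b,c,d]"
        using rotate_conv_mod[of r "[a,b,c,d]"] by simp
      ultimately show ?thesis using R by (metis insertCI)
    qed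
    then show ?thesis using R by (metis empty_iff insert_iff)
  qed
  then show ?thesis unfolding eps_def by presburger
qed

text \<open>The determinant formula with arbitrary, possibly repeated, row indices: this is what the
  second tensor factor of \<Delta>(det) consists of.\<close>

definition rows_det :: "real \<Rightarrow> nat \<Rightarrow> nat \<Rightarrow> nat \<Rightarrow> nat \<Rightarrow> (letter list \<Rightarrow>\<^sub>0 complex)" where
  "rows_det \<theta> k1 k2 k3 k4 = (\<Sum>\<sigma>\<in>{\<sigma>. \<sigma> permutes {1..4::nat}}.
      scale_pm (of_int (sign \<sigma>) * eps \<theta> [\<sigma> 1, \<sigma> 2, \<sigma> 3, \<sigma> 4])
        (single [letter k1 (\<sigma> 1), letter k2 (\<sigma> 2), letter k3 (\<sigma> 3), letter k4 (\<sigma> 4)]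
          (letter_sign (letter k1 (\<sigma> 1)) * letter_sign (letter k2 (\<sigma> 2)) * letter_sign (letter k3 (\<sigma> 3)) * letter_sign (letter k4 (\<sigma> 4)))))"

definition det4 :: "(nat \<Rightarrow> complex) \<Rightarrow> (nat \<Rightarrow> complex) \<Rightarrow> (nat \<Rightarrow> complex) \<Rightarrow> (nat \<Rightarrow> complex) \<Rightarrow> complex" where
  "det4 r1 r2 r3 r4 = (\<Sum>\<sigma>\<in>{\<sigma>. \<sigma> permutes {1..4::nat}}.
      of_int (sign \<sigma>) * (r1 (\<sigma> 1) * r2 (\<sigma> 2) * r3 (\<sigma> 3) * r4 (\<sigma> 4)))"

text \<open>The phase of four letters in the rows \<open>k1, ..., k4\<close>; the columns contribute the same expression
  with the arguments reversed.\<close>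

definition eta6 :: "real \<Rightarrow> nat \<Rightarrow> nat \<Rightarrow> nat \<Rightarrow> nat \<Rightarrow> complex" where
  "eta6 \<theta> k1 k2 k3 k4 = eta (\<theta> / 2) k2 k1 * eta (\<theta> / 2) k3 k1 * eta (\<theta> / 2) k4 k1 *
     eta (\<theta> / 2) k3 k2 * eta (\<theta> / 2) k4 k2 * eta (\<theta> / 2) k4 k3"

lemma phi_word_4:
  assumes "k1 \<in> {1..4}" "k2 \<in> {1..4}" "k3 \<in> {1..4}" "k4 \<in> {1..4}"
    "j1 \<in> {1..4}" "j2 \<in> {1..4}" "j3 \<in> {1..4}" "j4 \<in> {1..4}"
  shows "(letter_sign (letter k1 j1) * letter_sign (letter k2 j2) * letter_sign (letter k3 j3) * letter_sign (letter k4 j4)) *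
    phi \<theta> [letter k1 j1, letter k2 j2, letter k3 j3, letter k4 j4] A =
    eta6 \<theta> k1 k2 k3 k4 * eta6 \<theta> j4 j3 j2 j1 * (A k1 j1 * A k2 j2 * A k3 j3 * A k4 j4)"
  using assms by (simp add: letter_value_def rescale_def row_letter col_letter eta6_def mult_ac del: atLeastAtMost_iff)

text \<open>The coefficients \<open>eps\<close> are exactly the inverses of the phases that the
  column indices produce; this is why the determinant evaluates to the classical one.\<close>

lemma eps_eta6:
  assumes "i \<in> {1..4}" "j \<in> {1..4}" "k \<in> {1..4}" "l \<in> {1..4}" and d: "distinct [i, j, k, l]"
  shows "eps \<theta> [i, j, k, l] * eta6 \<theta> l k j i = 1"
proof -
  have mu: "mu \<theta> = mu (\<theta> / 2) * mu (\<theta> / 2)" by (simp add: mu_half)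
  from assms(1-4)[THEN index_cases] d show ?thesis
    \<comment> \<open>Index choices with a repetition contradict \<open>d\<close>; for the
      permutations the phase is computed in powers of \<open>mu (\<theta> / 2)\<close>.\<close>
    by (elim disjE; hypsubst; (simp (no_asm_use); fail)?; simp (no_asm) add: eps_eq eta6_def mu mult.assoc)
qed

lemma ev_rows_det:
  assumes "k1 \<in> {1..4}" "k2 \<in> {1..4}" "k3 \<in> {1..4}" "k4 \<in> {1..4}"
  shows "ev \<theta> (rows_det \<theta> k1 k2 k3 k4) A = eta6 \<theta> k1 k2 k3 k4 * det4 (A k1) (A k2) (A k3) (A k4)"
proof -
  have e: "eps \<theta> [\<sigma> 1, \<sigma> 2, \<sigma> 3, \<sigma> 4] * eta6 \<theta> (\<sigma> 4) (\<sigma> 3) (\<sigma> 2) (\<sigma> 1) = 1"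
    if s: "\<sigma> permutes {1..4::nat}" for \<sigma>
  proof -
    have inj: "inj \<sigma>" using s by (rule permutes_inj)
    have r: "\<sigma> 1 \<in> {1..4}" "\<sigma> 2 \<in> {1..4}" "\<sigma> 3 \<in> {1..4}" "\<sigma> 4 \<in> {1..4}"
      by (simp_all only: permutes_in_image[OF s]) auto
    have d: "\<sigma> 1 \<noteq> \<sigma> 2" "\<sigma> 1 \<noteq> \<sigma> 3" "\<sigma> 1 \<noteq> \<sigma> 4" "\<sigma> 2 \<noteq> \<sigma> 3" "\<sigma> 2 \<noteq> \<sigma> 4" "\<sigma> 3 \<noteq> \<sigma> 4"
      using inj by (auto simp: inj_eq)
    show ?thesis by (rule eps_eta6[OF r]) (use d in simp)
  qed
  show ?thesis
    unfolding rows_det_def det4_def sum_distrib_left ev_linear(7)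
  proof (rule sum.cong[OF refl])
    fix \<sigma> :: "nat \<Rightarrow> nat" assume "\<sigma> \<in> {\<sigma>. \<sigma> permutes {1..4}}"
    then have s: "\<sigma> permutes {1..4}" by simp
    have r: "\<sigma> 1 \<in> {1..4}" "\<sigma> 2 \<in> {1..4}" "\<sigma> 3 \<in> {1..4}" "\<sigma> 4 \<in> {1..4}"
      by (simp_all only: permutes_in_image[OF s]) auto
    let ?s = "letter_sign (letter k1 (\<sigma> 1)) * letter_sign (letter k2 (\<sigma> 2)) * letter_sign (letter k3 (\<sigma> 3)) * letter_sign (letter k4 (\<sigma> 4))"
    let ?w = "[letter k1 (\<sigma> 1), letter k2 (\<sigma> 2), letter k3 (\<sigma> 3), letter k4 (\<sigma> 4)]"
    have "ev \<theta> (scale_pm (of_int (sign \<sigma>) * eps \<theta> [\<sigma> 1, \<sigma> 2, \<sigma> 3, \<sigma> 4]) (single ?w ?s)) A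
      = of_int (sign \<sigma>) * eps \<theta> [\<sigma> 1, \<sigma> 2, \<sigma> 3, \<sigma> 4] * (?s * phi \<theta> ?w A)"
      by (simp only: ev_linear)
    also have "\<dots> = (eps \<theta> [\<sigma> 1, \<sigma> 2, \<sigma> 3, \<sigma> 4] * eta6 \<theta> (\<sigma> 4) (\<sigma> 3) (\<sigma> 2) (\<sigma> 1)) *
        (eta6 \<theta> k1 k2 k3 k4 * (of_int (sign \<sigma>) * (A k1 (\<sigma> 1) * A k2 (\<sigma> 2) * A k3 (\<sigma> 3) * A k4 (\<sigma> 4))))"
      unfolding phi_word_4[OF assms r] by (simp only: mult_ac)
    also have "\<dots> = eta6 \<theta> k1 k2 k3 k4 * (of_int (sign \<sigma>) * (A k1 (\<sigma> 1) * A k2 (\<sigma> 2) * A k3 (\<sigma> 3) * A k4 (\<sigma> 4)))"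
      unfolding e[OF s] by simp
    finally show "ev \<theta> (scale_pm (of_int (sign \<sigma>) * eps \<theta> [\<sigma> 1, \<sigma> 2, \<sigma> 3, \<sigma> 4]) (single ?w ?s)) A = \<dots>" .
  qed
qed

lemma det4_explicit: "det4 r1 r2 r3 r4 =
    r1 1 * r2 2 * r3 3 * r4 4 - r1 1 * r2 2 * r3 4 * r4 3 - r1 1 * r2 3 * r3 2 * r4 4 + r1 1 * r2 3 * r3 4 * r4 2
  + r1 1 * r2 4 * r3 2 * r4 3 - r1 1 * r2 4 * r3 3 * r4 2 - r1 2 * r2 1 * r3 3 * r4 4 + r1 2 * r2 1 * r3 4 * r4 3
  + r1 2 * r2 3 * r3 1 * r4 4 - r1 2 * r2 3 * r3 4 * r4 1 - r1 2 * r2 4 * r3 1 * r4 3 + r1 2 * r2 4 * r3 3 * r4 1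
  + r1 3 * r2 1 * r3 2 * r4 4 - r1 3 * r2 1 * r3 4 * r4 2 - r1 3 * r2 2 * r3 1 * r4 4 + r1 3 * r2 2 * r3 4 * r4 1
  + r1 3 * r2 4 * r3 1 * r4 2 - r1 3 * r2 4 * r3 2 * r4 1 - r1 4 * r2 1 * r3 2 * r4 3 + r1 4 * r2 1 * r3 3 * r4 2
  + r1 4 * r2 2 * r3 1 * r4 3 - r1 4 * r2 2 * r3 3 * r4 1 - r1 4 * r2 3 * r3 1 * r4 2 + r1 4 * r2 3 * r3 2 * r4 1"
  unfolding det4_def
  by (subst sum_permutes_4[where F = "\<lambda>s i j k l. of_int s * (r1 i * r2 j * r3 k * r4 l)"])
    (simp del: One_nat_def)

text \<open>The symplectic form \<open>dx\<^sub>1 \<and> dx\<^sub>2 + dx\<^sub>3 \<and> dx\<^sub>4\<close> on columns, and the Pfaffian of the resulting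
  alternating matrix.\<close>

definition symp :: "point \<Rightarrow> nat \<Rightarrow> nat \<Rightarrow> complex" where
  "symp A i j = A 1 i * A 2 j - A 2 i * A 1 j + A 3 i * A 4 j - A 4 i * A 3 j"

definition pfaff :: "point \<Rightarrow> complex" where
  "pfaff A = symp A 1 2 * symp A 3 4 - symp A 1 3 * symp A 2 4 + symp A 1 4 * symp A 2 3"

text \<open>With J the matrix of the form, this is Pf(A^T J A) = det(A) Pf(J), where Pf(J) = 1,
  checked as an identity of polynomials in sixteen entries.\<close>

lemma det4_pfaff: "det4 (A 1) (A 2) (A 3) (A 4) = pfaff A"
  unfolding det4_explicit pfaff_def symp_def by (simp add: algebra_simps)

lemma symp_rescale: "torus f \<Longrightarrow> symp (rescale f h A) i j = h i * h j * symp A i j"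
proof -
  assume "torus f"
  then have f: "f 1 * f 2 = 1" "f 3 * f 4 = 1" by (auto simp: torus_def)
  have "symp (rescale f h A) i j = h i * h j * ((f 1 * f 2) * (A 1 i * A 2 j - A 2 i * A 1 j) + (f 3 * f 4) * (A 3 i * A 4 j - A 4 i * A 3 j))"
    unfolding symp_def rescale_def by (simp add: algebra_simps)
  then show ?thesis unfolding f by (simp add: symp_def)
qed

lemma pfaff_rescale: assumes "torus f" "torus h" shows "pfaff (rescale f h A) = pfaff A"
proof -
  have h: "h 1 * h 2 = 1" "h 3 * h 4 = 1" using assms by (auto simp: torus_def)
  have "pfaff (rescale f h A) = (h 1 * h 2) * (h 3 * h 4) * pfaff A"
    unfolding pfaff_def symp_rescale[OF assms(1)] by (simp only: ring_distribs mult_ac)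
  then show ?thesis unfolding h by simp
qed

lemma symp_quat_conj: "i \<in> {1..4} \<Longrightarrow> j \<in> {1..4} \<Longrightarrow>
    symp (quat_conj A) i j = (- 1) ^ (i + j) * cnj (symp A (partner i) (partner j))"
  by (drule index_cases, drule index_cases, elim disjE; simp add: symp_def quat_conj_def)

lemma pfaff_quat_conj: "pfaff (quat_conj A) = cnj (pfaff A)"
proof -
  have *: "(- 1) ^ (1 + 2) = (- 1 :: complex)" "(- 1) ^ (3 + 4) = (- 1 :: complex)" "(- 1) ^ (1 + 3) = (1 :: complex)"
    "(- 1) ^ (2 + 4) = (1 :: complex)" "(- 1) ^ (1 + 4) = (- 1 :: complex)" "(- 1) ^ (2 + 3) = (- 1 :: complex)"
    by simp_all
  have "symp A 2 1 = - symp A 1 2" "symp A 4 3 = - symp A 3 4" "symp A 3 2 = - symp A 2 3" "symp A 4 1 = - symp A 1 4"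
    by (simp_all add: symp_def)
  then show ?thesis unfolding pfaff_def by (simp add: symp_quat_conj * del: One_nat_def)
qed

text \<open>The Levi-Civita symbol, as a Vandermonde product normalized by its value 12 at \<open>(1, 2, 3, 4)\<close>.\<close>

definition levi :: "nat \<Rightarrow> nat \<Rightarrow> nat \<Rightarrow> nat \<Rightarrow> complex" where
  "levi i j k l = of_int ((int j - int i) * (int k - int i) * (int l - int i) * (int k - int j) * (int l - int j) *
     (int l - int k)) / 12"

lemma det4_swap:
  "det4 r2 r1 r3 r4 = - det4 r1 r2 r3 r4" "det4 r1 r3 r2 r4 = - det4 r1 r2 r3 r4"
  "det4 r1 r2 r4 r3 = - det4 r1 r2 r3 r4"
  by (simp_all add: det4_explicit algebra_simps)

lemma det4_repeat: "det4 r r s t = 0" "det4 s r r t = 0" "det4 s t r r = 0"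
  using det4_swap(1)[of r r s t] det4_swap(2)[of s r r t] det4_swap(3)[of s t r r] by simp_all

text \<open>The rules \<open>swaps\<close> apply only to rows in decreasing order, so rewriting
  sorts the rows by adjacent transpositions; a repeated row becomes adjacent to its copy and gives
  zero, as does \<open>levi\<close>.\<close>

lemma det4_rows:
  assumes "k1 \<in> {1..4}" "k2 \<in> {1..4}" "k3 \<in> {1..4}" "k4 \<in> {1..4}"
  shows "det4 (A k1) (A k2) (A k3) (A k4) = levi k1 k2 k3 k4 * det4 (A 1) (A 2) (A 3) (A 4)"
proof -
  have swaps: "i > j \<Longrightarrow> det4 (A i) (A j) r s = - det4 (A j) (A i) r s"
    "i > j \<Longrightarrow> det4 r (A i) (A j) s = - det4 r (A j) (A i) s"
    "i > j \<Longrightarrow> det4 r s (A i) (A j) = - det4 r s (A j) (A i)" for i j :: nat and r s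
    by (rule det4_swap)+
  show ?thesis
    using assms[THEN index_cases] by (elim disjE; simp add: levi_def swaps det4_repeat del: One_nat_def)
qed

lemma det4_levi: "(\<Sum>k1\<in>{1..4}. \<Sum>k2\<in>{1..4}. \<Sum>k3\<in>{1..4}. \<Sum>k4\<in>{1..4}.
    levi k1 k2 k3 k4 * (r1 k1 * r2 k2 * r3 k3 * r4 k4)) = det4 r1 r2 r3 r4"
  unfolding atLeastAtMost_1_4 by (simp add: levi_def det4_explicit)

declare One_nat_def [simp del]

section \<open>The algebras of \<open>M\<^sub>\<theta>(2, \<H>)\<close> and \<open>SL\<^sub>\<theta>(2, \<H>)\<close>\<close>

lemma salg_quot_M: "salg_quot free_star_algebra (M_ideal \<theta>)"
  by (intro salg_quot.intro calg_quot.intro salg_quot_axioms.intro salg_free calg_free M_ideal_ideal M_ideal_star)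

lemma salg_M: "salg (M_alg \<theta>)"
  unfolding M_alg_def by (rule salg_quot.salg_Q[OF salg_quot_M])

definition qM :: "real \<Rightarrow> (letter list \<Rightarrow>\<^sub>0 complex) \<Rightarrow> (letter list \<Rightarrow>\<^sub>0 complex) set" where
  "qM \<theta> p = M_ideal \<theta> +>\<^bsub>free_star_algebra\<^esub> p"

lemma qM_hom:
  "carrier (M_alg \<theta>) = range (qM \<theta>)"
  "qM \<theta> p \<oplus>\<^bsub>M_alg \<theta>\<^esub> qM \<theta> q = qM \<theta> (p + q)"
  "qM \<theta> p \<ominus>\<^bsub>M_alg \<theta>\<^esub> qM \<theta> q = qM \<theta> (p - q)"
  "\<ominus>\<^bsub>M_alg \<theta>\<^esub> (qM \<theta> p) = qM \<theta> (- p)"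
  "qM \<theta> p \<otimes>\<^bsub>M_alg \<theta>\<^esub> qM \<theta> q = qM \<theta> (p \<star> q)"
  "c \<odot>\<^bsub>M_alg \<theta>\<^esub> qM \<theta> p = qM \<theta> (scale_pm c p)"
  "\<one>\<^bsub>M_alg \<theta>\<^esub> = qM \<theta> (single [] 1)"
  "\<zero>\<^bsub>M_alg \<theta>\<^esub> = qM \<theta> 0"
  "star\<^bsub>M_alg \<theta>\<^esub> (qM \<theta> p) = qM \<theta> (star\<^bsub>free_star_algebra\<^esub> p)"
proof -
  interpret salg_quot free_star_algebra "M_ideal \<theta>" by (rule salg_quot_M)
  note [simp] = free_simps(1-7)
  show "carrier (M_alg \<theta>) = range (qM \<theta>)"
    "qM \<theta> p \<oplus>\<^bsub>M_alg \<theta>\<^esub> qM \<theta> q = qM \<theta> (p + q)"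
    "qM \<theta> p \<ominus>\<^bsub>M_alg \<theta>\<^esub> qM \<theta> q = qM \<theta> (p - q)"
    "\<ominus>\<^bsub>M_alg \<theta>\<^esub> (qM \<theta> p) = qM \<theta> (- p)"
    "qM \<theta> p \<otimes>\<^bsub>M_alg \<theta>\<^esub> qM \<theta> q = qM \<theta> (p \<star> q)"
    "c \<odot>\<^bsub>M_alg \<theta>\<^esub> qM \<theta> p = qM \<theta> (scale_pm c p)"
    "\<one>\<^bsub>M_alg \<theta>\<^esub> = qM \<theta> (single [] 1)"
    "\<zero>\<^bsub>M_alg \<theta>\<^esub> = qM \<theta> 0"
    "star\<^bsub>M_alg \<theta>\<^esub> (qM \<theta> p) = qM \<theta> (star\<^bsub>free_star_algebra\<^esub> p)"
    using carrier_Q cls_add[of p q] cls_minus[of p q] cls_uminus[of p] cls_mult[of p q] cls_smult[of p c]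
      cls_one cls_zero cls_star[of p]
    by (simp_all add: M_alg_def qM_def)
qed

lemma qM_eq_iff: "qM \<theta> p = qM \<theta> q \<longleftrightarrow> (\<forall>A. ev \<theta> p A = ev \<theta> q A)"
proof -
  interpret ideal "M_ideal \<theta>" free_star_algebra by (rule M_ideal_ideal)
  have "qM \<theta> p = qM \<theta> q \<longleftrightarrow> p - q \<in> M_ideal \<theta>"
    unfolding qM_def by (subst cls_eq_iff) (simp_all add: free_simps)
  then show ?thesis by (simp add: M_ideal_iff ev_linear)
qed

lemma qM_sum: "finite S \<Longrightarrow> (\<Oplus>\<^bsub>M_alg \<theta>\<^esub>x\<in>S. qM \<theta> (f x)) = qM \<theta> (sum f S)"
proof -
  assume "finite S"
  interpret salg_quot free_star_algebra "M_ideal \<theta>" by (rule salg_quot_M)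
  have "(\<Oplus>\<^bsub>free_star_algebra\<^esub>x\<in>S. f x) = sum f S" using \<open>finite S\<close>
    by (induction S) (auto simp: free_simps)
  then show ?thesis using cls_finsum[of S f] \<open>finite S\<close> by (simp add: qM_def M_alg_def free_simps)
qed

lemma M_gen_eq: "M_gen \<theta> x = qM \<theta> (free_gen x)"
  by (simp add: M_gen_def qM_def)

lemma M_matrix_eq: "i \<in> {1..4} \<Longrightarrow> j \<in> {1..4} \<Longrightarrow> quat_matrix (M_alg \<theta>) (M_gen \<theta>) i j = qM \<theta> (ent i j)"
  by (drule index_cases, drule index_cases, elim disjE;
      simp add: quat_matrix_def ent_def letter.simps letter_sign.simps M_gen_eq qM_hom free_gen_def free_simps single_uminus)

abbreviation "fdet \<theta> \<equiv> rows_det \<theta> 1 2 3 4"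

lemma ev_fdet: "ev \<theta> (fdet \<theta>) A = pfaff A"
proof -
  have "eta6 \<theta> 1 2 3 4 = 1" by (simp add: eta6_def mult_ac)
  then show ?thesis using ev_rows_det[of 1 2 3 4 \<theta> A] by (simp add: det4_pfaff)
qed

lemma M_det_eq: "M_det \<theta> = qM \<theta> (fdet \<theta>)"
proof -
  interpret salg "M_alg \<theta>" by (rule salg_M)
  let ?f = "\<lambda>\<sigma>. scale_pm (of_int (sign \<sigma>) * eps \<theta> [\<sigma> 1, \<sigma> 2, \<sigma> 3, \<sigma> 4])
        (single [letter 1 (\<sigma> 1), letter 2 (\<sigma> 2), letter 3 (\<sigma> 3), letter 4 (\<sigma> 4)]
          (letter_sign (letter 1 (\<sigma> 1)) * letter_sign (letter 2 (\<sigma> 2)) * letter_sign (letter 3 (\<sigma> 3)) * letter_sign (letter 4 (\<sigma> 4))))"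
  have "M_det \<theta> = (\<Oplus>\<^bsub>M_alg \<theta>\<^esub>\<sigma>\<in>{\<sigma>. \<sigma> permutes {1..4::nat}}. qM \<theta> (?f \<sigma>))"
    unfolding M_det_def Let_def
  proof (rule finsum_cong')
    fix \<sigma> :: "nat \<Rightarrow> nat" assume "\<sigma> \<in> {\<sigma>. \<sigma> permutes {1..4}}"
    then have s: "\<sigma> permutes {1..4}" by simp
    have r: "\<sigma> 1 \<in> {1..4}" "\<sigma> 2 \<in> {1..4}" "\<sigma> 3 \<in> {1..4}" "\<sigma> 4 \<in> {1..4}"
      by (simp_all only: permutes_in_image[OF s]) auto
    have i: "1 \<in> {1..4::nat}" "2 \<in> {1..4::nat}" "3 \<in> {1..4::nat}" "4 \<in> {1..4::nat}" by auto
    show "(of_int (sign \<sigma>) * eps \<theta> [\<sigma> 1, \<sigma> 2, \<sigma> 3, \<sigma> 4]) \<odot>\<^bsub>M_alg \<theta>\<^esub>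
       (quat_matrix (M_alg \<theta>) (M_gen \<theta>) 1 (\<sigma> 1) \<otimes>\<^bsub>M_alg \<theta>\<^esub> quat_matrix (M_alg \<theta>) (M_gen \<theta>) 2 (\<sigma> 2) \<otimes>\<^bsub>M_alg \<theta>\<^esub>
        quat_matrix (M_alg \<theta>) (M_gen \<theta>) 3 (\<sigma> 3) \<otimes>\<^bsub>M_alg \<theta>\<^esub> quat_matrix (M_alg \<theta>) (M_gen \<theta>) 4 (\<sigma> 4)) = qM \<theta> (?f \<sigma>)"
      unfolding M_matrix_eq[OF i(1) r(1)] M_matrix_eq[OF i(2) r(2)] M_matrix_eq[OF i(3) r(3)] M_matrix_eq[OF i(4) r(4)]
      by (simp add: qM_hom ent_def)
  qed (auto simp: qM_hom)
  then show ?thesis by (simp add: qM_sum finite_permutations rows_det_def)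
qed

section \<open>Imposing determinant 1\<close>

definition SL_points :: "point set" where "SL_points = {A. pfaff A = 1}"

lemma SL_ideal_eq: "SL_ideal \<theta> = Idl\<^bsub>M_alg \<theta>\<^esub> {qM \<theta> (fdet \<theta> - single [] 1)}"
  by (simp add: SL_ideal_def M_det_eq qM_hom)

lemma SL_ideal_ideal: "ideal (SL_ideal \<theta>) (M_alg \<theta>)"
  and SL_ideal_mem: "qM \<theta> (fdet \<theta> - single [] 1) \<in> SL_ideal \<theta>"
  and SL_ideal_least: "ideal J (M_alg \<theta>) \<Longrightarrow> qM \<theta> (fdet \<theta> - single [] 1) \<in> J \<Longrightarrow> SL_ideal \<theta> \<subseteq> J"
proof -
  interpret salg "M_alg \<theta>" by (rule salg_M)
  have "{qM \<theta> (fdet \<theta> - single [] 1)} \<subseteq> carrier (M_alg \<theta>)" by (simp add: qM_hom)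
  from genideal_ideal[OF this] genideal_self[OF this] genideal_minimal[of J "{qM \<theta> (fdet \<theta> - single [] 1)}"]
  show "ideal (SL_ideal \<theta>) (M_alg \<theta>)" "qM \<theta> (fdet \<theta> - single [] 1) \<in> SL_ideal \<theta>"
    "ideal J (M_alg \<theta>) \<Longrightarrow> qM \<theta> (fdet \<theta> - single [] 1) \<in> J \<Longrightarrow> SL_ideal \<theta> \<subseteq> J"
    unfolding SL_ideal_eq by auto
qed

text \<open>\<open>SL_ideal\<close> is generated as a plain ideal. Its generator is self-adjoint,
  since the determinant of the quaternionic conjugate of a matrix is the complex conjugate, so the
  star-stable part is the whole ideal.\<close>

lemma SL_ideal_star: "X \<in> SL_ideal \<theta> \<Longrightarrow> star\<^bsub>M_alg \<theta>\<^esub> X \<in> SL_ideal \<theta>"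
proof -
  interpret salg "M_alg \<theta>" by (rule salg_M)
  let ?d = "fdet \<theta> - single [] 1"
  have "qM \<theta> (star\<^bsub>free_star_algebra\<^esub> ?d) = qM \<theta> ?d"
    unfolding qM_eq_iff ev_star by (simp add: ev_linear ev_fdet pfaff_quat_conj)
  then have "SL_ideal \<theta> \<subseteq> {X \<in> SL_ideal \<theta>. star\<^bsub>M_alg \<theta>\<^esub> X \<in> SL_ideal \<theta>}"
    by (intro SL_ideal_least ideal_Int_star SL_ideal_ideal) (simp add: SL_ideal_mem qM_hom)
  then show "X \<in> SL_ideal \<theta> \<Longrightarrow> star\<^bsub>M_alg \<theta>\<^esub> X \<in> SL_ideal \<theta>" by blast
qed

lemma SL_ideal_image_least:
  assumes "ideal J free_star_algebra" "fdet \<theta> - single [] 1 \<in> J"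
  shows "SL_ideal \<theta> \<subseteq> qM \<theta> ` J"
proof -
  interpret salg_quot free_star_algebra "M_ideal \<theta>" by (rule salg_quot_M)
  show ?thesis using image_ideal[OF assms(1)] assms(2)
    by (intro SL_ideal_least) (auto simp: M_alg_def qM_def[abs_def])
qed

lemma torus_stable_SL: "torus_stable SL_points"
  by (simp add: torus_stable_def SL_points_def pfaff_rescale)

text \<open>The elements vanishing at determinant 1 form an ideal of the free algebra that contains
  det - 1; its image bounds \<open>SL_ideal\<close>, and evaluation does not see the passage to
  another lift.\<close>

lemma SL_ideal_ev: assumes "qM \<theta> p \<in> SL_ideal \<theta>" "A \<in> SL_points" shows "ev \<theta> p A = 0"
proof -
  have "fdet \<theta> - single [] 1 \<in> vanishing \<theta> SL_points"
    by (simp add: vanishing_def ev_linear ev_fdet SL_points_def)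
  then have "qM \<theta> p \<in> qM \<theta> ` vanishing \<theta> SL_points"
    using SL_ideal_image_least[OF vanishing_ideal[OF torus_stable_SL]] assms(1) by blast
  then obtain q where "q \<in> vanishing \<theta> SL_points" "qM \<theta> p = qM \<theta> q" by blast
  then show ?thesis using assms(2) by (simp add: qM_eq_iff vanishing_def)
qed

lemma salg_quot_SL: "salg_quot (M_alg \<theta>) (SL_ideal \<theta>)"
  by (intro salg_quot.intro calg_quot.intro salg_quot_axioms.intro salg_M SL_ideal_ideal SL_ideal_star
      salg.axioms(1)[OF salg_M])

lemma salg_SL: "salg (SL_alg \<theta>)"
  unfolding SL_alg_def by (rule salg_quot.salg_Q[OF salg_quot_SL])

definition qS :: "real \<Rightarrow> (letter list \<Rightarrow>\<^sub>0 complex) \<Rightarrow> (letter list \<Rightarrow>\<^sub>0 complex) set set" where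
  "qS \<theta> p = SL_ideal \<theta> +>\<^bsub>M_alg \<theta>\<^esub> qM \<theta> p"

lemma qS_hom:
  "carrier (SL_alg \<theta>) = range (qS \<theta>)"
  "qS \<theta> p \<oplus>\<^bsub>SL_alg \<theta>\<^esub> qS \<theta> q = qS \<theta> (p + q)"
  "qS \<theta> p \<ominus>\<^bsub>SL_alg \<theta>\<^esub> qS \<theta> q = qS \<theta> (p - q)"
  "\<ominus>\<^bsub>SL_alg \<theta>\<^esub> (qS \<theta> p) = qS \<theta> (- p)"
  "qS \<theta> p \<otimes>\<^bsub>SL_alg \<theta>\<^esub> qS \<theta> q = qS \<theta> (p \<star> q)"
  "c \<odot>\<^bsub>SL_alg \<theta>\<^esub> qS \<theta> p = qS \<theta> (scale_pm c p)"
  "\<one>\<^bsub>SL_alg \<theta>\<^esub> = qS \<theta> (single [] 1)"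
  "\<zero>\<^bsub>SL_alg \<theta>\<^esub> = qS \<theta> 0"
  "star\<^bsub>SL_alg \<theta>\<^esub> (qS \<theta> p) = qS \<theta> (star\<^bsub>free_star_algebra\<^esub> p)"
proof -
  interpret salg_quot "M_alg \<theta>" "SL_ideal \<theta>" by (rule salg_quot_SL)
  note [simp] = qM_hom
  show "carrier (SL_alg \<theta>) = range (qS \<theta>)"
    "qS \<theta> p \<oplus>\<^bsub>SL_alg \<theta>\<^esub> qS \<theta> q = qS \<theta> (p + q)"
    "qS \<theta> p \<ominus>\<^bsub>SL_alg \<theta>\<^esub> qS \<theta> q = qS \<theta> (p - q)"
    "\<ominus>\<^bsub>SL_alg \<theta>\<^esub> (qS \<theta> p) = qS \<theta> (- p)"
    "qS \<theta> p \<otimes>\<^bsub>SL_alg \<theta>\<^esub> qS \<theta> q = qS \<theta> (p \<star> q)"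
    "c \<odot>\<^bsub>SL_alg \<theta>\<^esub> qS \<theta> p = qS \<theta> (scale_pm c p)"
    "\<one>\<^bsub>SL_alg \<theta>\<^esub> = qS \<theta> (single [] 1)"
    "\<zero>\<^bsub>SL_alg \<theta>\<^esub> = qS \<theta> 0"
    "star\<^bsub>SL_alg \<theta>\<^esub> (qS \<theta> p) = qS \<theta> (star\<^bsub>free_star_algebra\<^esub> p)"
    using carrier_Q cls_add[of "qM \<theta> p" "qM \<theta> q"] cls_minus[of "qM \<theta> p" "qM \<theta> q"] cls_uminus[of "qM \<theta> p"]
      cls_mult[of "qM \<theta> p" "qM \<theta> q"] cls_smult[of "qM \<theta> p" c] cls_one cls_zero cls_star[of "qM \<theta> p"]
    by (simp_all add: SL_alg_def qS_def[abs_def] image_image)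
qed

lemma qS_mem_carrier [simp]: "qS \<theta> p \<in> carrier (SL_alg \<theta>)"
  by (simp add: qS_hom)

lemma qS_eq_iff: "qS \<theta> p = qS \<theta> q \<longleftrightarrow> qM \<theta> (p - q) \<in> SL_ideal \<theta>"
proof -
  interpret salg_quot "M_alg \<theta>" "SL_ideal \<theta>" by (rule salg_quot_SL)
  show ?thesis unfolding qS_def by (subst cls_eq_iff) (simp_all add: qM_hom)
qed

text \<open>The two directions differ: agreement at all matrices is an identity already in
  \<open>M_alg\<close>, whereas \<open>qS_eqD\<close> returns agreement only at determinant 1.
  Identities that use det = 1 pass through \<open>qS_det\<close>.\<close>

lemma qS_eqI: "(\<And>A. ev \<theta> p A = ev \<theta> q A) \<Longrightarrow> qS \<theta> p = qS \<theta> q"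
  unfolding qS_def by (metis qM_eq_iff)

lemma qS_eqD: "qS \<theta> p = qS \<theta> q \<Longrightarrow> A \<in> SL_points \<Longrightarrow> ev \<theta> p A = ev \<theta> q A"
  using SL_ideal_ev[of \<theta> "p - q" A] by (simp add: qS_eq_iff ev_linear)

lemma qS_det: "qS \<theta> (fdet \<theta>) = qS \<theta> (single [] 1)"
  unfolding qS_eq_iff by (rule SL_ideal_mem)

lemma SL_gen_eq: "SL_gen \<theta> x = qS \<theta> (free_gen x)"
  by (simp add: SL_gen_def qS_def M_gen_eq)

lemma SL_matrix_eq: "i \<in> {1..4} \<Longrightarrow> j \<in> {1..4} \<Longrightarrow> SL_matrix \<theta> i j = qS \<theta> (ent i j)"
  unfolding SL_matrix_def
  by (drule index_cases, drule index_cases, elim disjE;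
      simp add: quat_matrix_def ent_def letter.simps letter_sign.simps SL_gen_eq qS_hom free_gen_def free_simps single_uminus)

subsection \<open>The Gram matrix\<close>

lemma star_free_uminus: "star\<^bsub>free_star_algebra\<^esub> (- p) = - (star\<^bsub>free_star_algebra\<^esub> p)"
  using free_simps(9)[of "- p" p] by (simp add: free_simps eq_neg_iff_add_eq_0)

lemma star_ent: "i \<in> {1..4} \<Longrightarrow> j \<in> {1..4} \<Longrightarrow>
    star\<^bsub>free_star_algebra\<^esub> (ent i j) = scale_pm ((- 1) ^ (i + j)) (ent (partner i) (partner j))"
  by (drule index_cases, drule index_cases, elim disjE;
      simp add: ent_def free_simps star_free_uminus letter.simps letter_sign.simps single_uminus)

lemma ev_ent_ent: "i \<in> {1..4} \<Longrightarrow> j \<in> {1..4} \<Longrightarrow> k \<in> {1..4} \<Longrightarrow> l \<in> {1..4} \<Longrightarrow>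
    ev \<theta> (ent i j \<star> ent k l) A = eta (\<theta> / 2) k i * eta (\<theta> / 2) j l * (A i j * A k l)"
  by (simp add: ent_def ev_linear letter_value_def rescale_def row_letter col_letter mult_ac del: atLeastAtMost_iff)

definition gram :: "nat \<Rightarrow> nat \<Rightarrow> (letter list \<Rightarrow>\<^sub>0 complex)" where
  "gram i j = (\<Sum>k\<in>{1..4}. star\<^bsub>free_star_algebra\<^esub> (ent k i) \<star> ent k j)"

lemma SL_gram_eq: "i \<in> {1..4} \<Longrightarrow> j \<in> {1..4} \<Longrightarrow> SL_gram \<theta> i j = qS \<theta> (gram i j)"
proof -
  assume ij: "i \<in> {1..4}" "j \<in> {1..4}"
  interpret salg "SL_alg \<theta>" by (rule salg_SL)
  have "star\<^bsub>SL_alg \<theta>\<^esub> (SL_matrix \<theta> k i) \<otimes>\<^bsub>SL_alg \<theta>\<^esub> SL_matrix \<theta> k j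
     = qS \<theta> (star\<^bsub>free_star_algebra\<^esub> (ent k i) \<star> ent k j)" if "k \<in> {1..4}" for k
    using ij that by (simp add: SL_matrix_eq qS_hom del: atLeastAtMost_iff)
  then show ?thesis unfolding SL_gram_def gram_def atLeastAtMost_1_4
    by (simp add: qS_hom add.assoc)
qed

text \<open>The adjoint of an entry is, up to sign, the entry at the partner indices, so the sum
  over \<open>k\<close> pairs each row with its partner: this is the symplectic product of the
  columns \<open>partner i\<close> and \<open>j\<close>. The row phases are trivial because partner
  rows commute.\<close>

lemma ev_gram: "i \<in> {1..4} \<Longrightarrow> j \<in> {1..4} \<Longrightarrow>
    ev \<theta> (gram i j) A = (- 1) ^ i * eta (\<theta> / 2) (partner i) j * symp A (partner i) j"
proof -
  assume ij: "i \<in> {1..4}" "j \<in> {1..4}"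
  then have "ev \<theta> (gram i j) A = (\<Sum>k\<in>{1..4}. (- 1) ^ (k + i) *
      (eta (\<theta> / 2) k (partner k) * eta (\<theta> / 2) (partner i) j * (A (partner k) (partner i) * A k j)))"
    unfolding gram_def ev_linear
    by (intro sum.cong refl)
      (simp add: star_ent free_mult_linear ev_linear ev_ent_ent partner_range del: atLeastAtMost_iff)
  also have "\<dots> = (- 1) ^ i * eta (\<theta> / 2) (partner i) j * symp A (partner i) j"
    unfolding atLeastAtMost_1_4 by (simp add: symp_def power_add algebra_simps)
  finally show ?thesis .
qed

subsection \<open>The generators of the quotient space\<close>

text \<open>\<open>fm\<close>, \<open>fn\<close>, \<open>fg1\<close> and \<open>fg2\<close> lift m,
  n, g_1 and g_2 to the free algebra; \<open>fg1s\<close> and \<open>fg2s\<close> are the adjoints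
  of the last two, written out in words.\<close>

definition fm :: "letter list \<Rightarrow>\<^sub>0 complex" where
  "fm = single [(GA1, True), (GA1, False)] 1 + single [(GA2, True), (GA2, False)] 1 +
        single [(GC1, True), (GC1, False)] 1 + single [(GC2, True), (GC2, False)] 1"
definition fn :: "letter list \<Rightarrow>\<^sub>0 complex" where
  "fn = single [(GB1, True), (GB1, False)] 1 + single [(GB2, True), (GB2, False)] 1 +
        single [(GD1, True), (GD1, False)] 1 + single [(GD2, True), (GD2, False)] 1"
definition fg1 :: "real \<Rightarrow> (letter list \<Rightarrow>\<^sub>0 complex)" where
  "fg1 \<theta> = single [(GA1, True), (GB1, False)] 1 + single [(GB2, True), (GA2, False)] (mu \<theta>) +
        single [(GC1, True), (GD1, False)] 1 + single [(GD2, True), (GC2, False)] (mu \<theta>)"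
definition fg2 :: "real \<Rightarrow> (letter list \<Rightarrow>\<^sub>0 complex)" where
  "fg2 \<theta> = single [(GB2, True), (GA1, False)] 1 + single [(GA2, True), (GB1, False)] (- mu \<theta>) +
        single [(GD2, True), (GC1, False)] 1 + single [(GC2, True), (GD1, False)] (- mu \<theta>)"
definition fg1s :: "real \<Rightarrow> (letter list \<Rightarrow>\<^sub>0 complex)" where
  "fg1s \<theta> = single [(GB1, True), (GA1, False)] 1 + single [(GA2, True), (GB2, False)] (cnj (mu \<theta>)) +
        single [(GD1, True), (GC1, False)] 1 + single [(GC2, True), (GD2, False)] (cnj (mu \<theta>))"
definition fg2s :: "real \<Rightarrow> (letter list \<Rightarrow>\<^sub>0 complex)" where
  "fg2s \<theta> = single [(GA1, True), (GB2, False)] 1 + single [(GB1, True), (GA2, False)] (- cnj (mu \<theta>)) +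
        single [(GC1, True), (GD2, False)] 1 + single [(GD1, True), (GC2, False)] (- cnj (mu \<theta>))"

lemma star_generators:
  "star\<^bsub>free_star_algebra\<^esub> fm = fm" "star\<^bsub>free_star_algebra\<^esub> fn = fn"
  "star\<^bsub>free_star_algebra\<^esub> (fg1 \<theta>) = fg1s \<theta>" "star\<^bsub>free_star_algebra\<^esub> (fg2 \<theta>) = fg2s \<theta>"
  by (simp_all add: fm_def fn_def fg1_def fg2_def fg1s_def fg2s_def free_simps)

text \<open>Summands of g_1 and g_2 of the second kind meet the two columns in the opposite order,
  hence with the inverse half-phase; their coefficient \<open>mu \<theta>\<close> compensates this,
  and a single symplectic product remains.\<close>

lemma ev_generators:
  "ev \<theta> fm A = symp A 1 2" "ev \<theta> fn A = symp A 3 4"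
  "ev \<theta> (fg1 \<theta>) A = - mu (\<theta> / 2) * symp A 2 3" "ev \<theta> (fg1s \<theta>) A = cnj (mu (\<theta> / 2)) * symp A 1 4"
  "ev \<theta> (fg2 \<theta>) A = - mu (\<theta> / 2) * symp A 1 3" "ev \<theta> (fg2s \<theta>) A = - cnj (mu (\<theta> / 2)) * symp A 2 4"
  by (simp_all add: fm_def fn_def fg1_def fg2_def fg1s_def fg2s_def ev_linear letter_value_def rescale_def row.simps col.simps
      letter_sign.simps symp_def mu_half[of \<theta>, symmetric] algebra_simps)

text \<open>Left multiplication by a homogeneous element amounts to a rescaling of the columns of the
  point.\<close>

definition weight :: "real \<Rightarrow> (letter list \<Rightarrow>\<^sub>0 complex) \<Rightarrow> (nat \<Rightarrow> complex) \<Rightarrow> bool" where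
  "weight \<theta> p h \<longleftrightarrow> (\<forall>q A. ev \<theta> (p \<star> q) A = ev \<theta> p A * ev \<theta> q (rescale (\<lambda>_. 1) h A))"

lemma phi_cong: "(\<And>k l. k \<in> {1..4} \<Longrightarrow> l \<in> {1..4} \<Longrightarrow> A k l = A' k l) \<Longrightarrow> phi \<theta> w A = phi \<theta> w A'"
proof (induction w arbitrary: A A')
  case (Cons a w)
  have "letter_value a A = letter_value a A'" using Cons.prems row_range col_range by (simp add: letter_value_def)
  moreover have "phi \<theta> w (rescale f h A) = phi \<theta> w (rescale f h A')" for f h
    by (rule Cons.IH) (simp add: rescale_def Cons.prems del: atLeastAtMost_iff)
  ultimately show ?case by simp
qed simp

lemma ev_cong: "(\<And>k l. k \<in> {1..4} \<Longrightarrow> l \<in> {1..4} \<Longrightarrow> A k l = A' k l) \<Longrightarrow> ev \<theta> p A = ev \<theta> p A'"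
  unfolding ev_def using phi_cong[of A A'] by presburger

lemma weight_add: "weight \<theta> p h \<Longrightarrow> weight \<theta> q h \<Longrightarrow> weight \<theta> (p + q) h"
  by (simp add: weight_def free_mult_linear ev_linear algebra_simps)

lemma eta_row_partner: "i \<in> {1..4} \<Longrightarrow> k \<in> {1..4} \<Longrightarrow> eta \<theta> k i * eta \<theta> k (partner i) = 1"
  by (drule index_cases, drule index_cases, elim disjE; simp)

text \<open>Letters in partner rows have inverse effects on the rows of the point, so only a
  rescaling of the columns is left.\<close>

lemma weight_word:
  assumes "row b = partner (row a)" "\<And>l. l \<in> {1..4} \<Longrightarrow> eta (\<theta> / 2) (col a) l * eta (\<theta> / 2) (col b) l = h l"
  shows "weight \<theta> (single [a, b] c) h"
  unfolding weight_def
proof (intro allI)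
  fix q A
  have "ev \<theta> q (ltw \<theta> [a, b] A) = ev \<theta> q (rescale (\<lambda>_. 1) h A)"
    by (rule ev_cong) (simp add: ltw_def rescale_def assms eta_row_partner row_range del: atLeastAtMost_iff)
  then show "ev \<theta> (single [a, b] c \<star> q) A = ev \<theta> (single [a, b] c) A * ev \<theta> q (rescale (\<lambda>_. 1) h A)"
    by (simp only: ev_mult_left ev_linear)
qed

lemma weight_generators:
  "weight \<theta> fm (\<lambda>_. 1)" "weight \<theta> fn (\<lambda>_. 1)"
  "weight \<theta> (fg1 \<theta>) (\<lambda>l. eta (\<theta> / 2) 2 l * eta (\<theta> / 2) 3 l)"
  "weight \<theta> (fg1s \<theta>) (\<lambda>l. eta (\<theta> / 2) 1 l * eta (\<theta> / 2) 4 l)"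
  "weight \<theta> (fg2 \<theta>) (\<lambda>l. eta (\<theta> / 2) 1 l * eta (\<theta> / 2) 3 l)"
  "weight \<theta> (fg2s \<theta>) (\<lambda>l. eta (\<theta> / 2) 2 l * eta (\<theta> / 2) 4 l)"
  unfolding fm_def fn_def fg1_def fg2_def fg1s_def fg2s_def
  by (intro weight_add weight_word; (drule index_cases, elim disjE)?; simp add: row.simps col.simps)+

section \<open>Tensor products of algebras\<close>

lemma alg_homD:
  assumes "h \<in> alg_hom A B"
  shows "x \<in> carrier A \<Longrightarrow> h x \<in> carrier B"
    "x \<in> carrier A \<Longrightarrow> y \<in> carrier A \<Longrightarrow> h (x \<otimes>\<^bsub>A\<^esub> y) = h x \<otimes>\<^bsub>B\<^esub> h y"
    "x \<in> carrier A \<Longrightarrow> y \<in> carrier A \<Longrightarrow> h (x \<oplus>\<^bsub>A\<^esub> y) = h x \<oplus>\<^bsub>B\<^esub> h y"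
    "h \<one>\<^bsub>A\<^esub> = \<one>\<^bsub>B\<^esub>"
    "x \<in> carrier A \<Longrightarrow> h (c \<odot>\<^bsub>A\<^esub> x) = c \<odot>\<^bsub>B\<^esub> h x"
  using assms by (auto simp: alg_hom_def ring_hom_def)

locale tensor_pair = A: calg A + B: calg B
  for A :: "('a, 'c) star_algebra_scheme" and B :: "('b, 'd) star_algebra_scheme"
begin

lemma monoid_AB: "monoid (A \<times>\<times> B)"
  by (intro DirProd_monoid A.monoid_axioms B.monoid_axioms)

lemma calg_P: "calg (pair_algebra A B)"
  unfolding pair_algebra_def by (rule calg_monoid_algebra[OF monoid_AB])

lemma P_simps:
  "carrier (pair_algebra A B) = {p. keys p \<subseteq> carrier A \<times> carrier B}"
  "p \<otimes>\<^bsub>pair_algebra A B\<^esub> q = conv (A \<times>\<times> B) p q"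
  "\<one>\<^bsub>pair_algebra A B\<^esub> = single (\<one>\<^bsub>A\<^esub>, \<one>\<^bsub>B\<^esub>) 1"
  "\<zero>\<^bsub>pair_algebra A B\<^esub> = 0"
  "p \<oplus>\<^bsub>pair_algebra A B\<^esub> q = p + q"
  "c \<odot>\<^bsub>pair_algebra A B\<^esub> p = scale_pm c p"
  by (simp_all add: pair_algebra_def monoid_algebra_simps DirProd_def)

lemma P_minus: "keys q \<subseteq> carrier A \<times> carrier B \<Longrightarrow> p \<ominus>\<^bsub>pair_algebra A B\<^esub> q = p - q"
  using monoid_algebra_minus[OF monoid_AB, of q]
  by (simp add: a_minus_def P_simps) (simp add: pair_algebra_def DirProd_def)

lemma mult_AB: "(a, b) \<otimes>\<^bsub>A \<times>\<times> B\<^esub> (a', b') = (a \<otimes>\<^bsub>A\<^esub> a', b \<otimes>\<^bsub>B\<^esub> b')"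
  by (simp add: DirProd_def)

lemma keys_conv_AB:
  "keys p \<subseteq> carrier A \<times> carrier B \<Longrightarrow> keys q \<subseteq> carrier A \<times> carrier B \<Longrightarrow>
     keys (conv (A \<times>\<times> B) p q) \<subseteq> carrier A \<times> carrier B"
  using keys_conv[OF monoid_AB] by simp

lemma bilinear_relations_mem:
  assumes "a \<in> carrier A" "b \<in> carrier B"
  shows "a' \<in> carrier A \<Longrightarrow> single (a \<oplus>\<^bsub>A\<^esub> a', b) 1 - single (a, b) 1 - single (a', b) 1 \<in> bilinear_relations A B"
    "b' \<in> carrier B \<Longrightarrow> single (a, b \<oplus>\<^bsub>B\<^esub> b') 1 - single (a, b) 1 - single (a, b') 1 \<in> bilinear_relations A B"
    "single (c \<odot>\<^bsub>A\<^esub> a, b) 1 - single (a, b) c \<in> bilinear_relations A B"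
    "single (a, c \<odot>\<^bsub>B\<^esub> b) 1 - single (a, b) c \<in> bilinear_relations A B"
  using assms unfolding bilinear_relations_def pair_pm_def
     apply (simp_all only: scale_pm_single mult_1_right)
  by blast+

lemma bilinear_relations_cases:
  assumes "r \<in> bilinear_relations A B"
  obtains a a' b where "a \<in> carrier A" "a' \<in> carrier A" "b \<in> carrier B"
      "r = single (a \<oplus>\<^bsub>A\<^esub> a', b) 1 - single (a, b) 1 - single (a', b) 1"
  | a b b' where "a \<in> carrier A" "b \<in> carrier B" "b' \<in> carrier B"
      "r = single (a, b \<oplus>\<^bsub>B\<^esub> b') 1 - single (a, b) 1 - single (a, b') 1"
  | c a b where "a \<in> carrier A" "b \<in> carrier B" "r = single (c \<odot>\<^bsub>A\<^esub> a, b) 1 - single (a, b) c"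
  | c a b where "a \<in> carrier A" "b \<in> carrier B" "r = single (a, c \<odot>\<^bsub>B\<^esub> b) 1 - single (a, b) c"
  using assms unfolding bilinear_relations_def pair_pm_def by auto

abbreviation (input) "K \<equiv> bilinear_kernel A B"

lemma K_simps:
  "r \<in> bilinear_relations A B \<Longrightarrow> r \<in> K" "p \<in> K \<Longrightarrow> q \<in> K \<Longrightarrow> p + q \<in> K"
  "p \<in> K \<Longrightarrow> q \<in> K \<Longrightarrow> p - q \<in> K" "p \<in> K \<Longrightarrow> scale_pm c p \<in> K" "0 \<in> K" "p \<in> K \<Longrightarrow> - p \<in> K"
  "(\<And>x. x \<in> S \<Longrightarrow> f x \<in> K) \<Longrightarrow> sum f S \<in> K"
  unfolding bilinear_kernel_def
  by (auto intro: pm.span_base pm.span_add pm.span_diff pm.span_scale pm.span_zero pm.span_neg pm.span_sum)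

lemma K_induct [consumes 1, case_names zero add scale rel]:
  assumes "p \<in> K" "P 0" "\<And>p q. p \<in> K \<Longrightarrow> q \<in> K \<Longrightarrow> P p \<Longrightarrow> P q \<Longrightarrow> P (p + q)"
    "\<And>c p. p \<in> K \<Longrightarrow> P p \<Longrightarrow> P (scale_pm c p)" "\<And>r. r \<in> bilinear_relations A B \<Longrightarrow> P r"
  shows "P p"
proof -
  have "p \<in> K \<and> P p" using assms(1) unfolding bilinear_kernel_def
  proof (rule pm.span_induct)
    show "pm.subspace {p. p \<in> pm.span (bilinear_relations A B) \<and> P p}"
      using assms(2-4) unfolding pm.subspace_def bilinear_kernel_def
      by (auto intro: pm.span_add pm.span_scale pm.span_zero)
  qed (use assms(5) pm.span_base in auto)
  then show ?thesis by blast
qed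

lemma K_keys: "p \<in> K \<Longrightarrow> keys p \<subseteq> carrier A \<times> carrier B"
proof (induction rule: K_induct)
  case (add p q) then show ?case using keys_add[of p q] by blast
next
  case (scale c p) then show ?case using keys_scale_pm[of c p] by blast
next
  case (rel r)
  have *: "keys (single x c - q) \<subseteq> C" if "x \<in> C" "keys q \<subseteq> C" for x c C and q :: "'a \<times> 'b \<Rightarrow>\<^sub>0 complex"
    using keys_diff[of "single x c" q] that by (auto simp: keys_single split: if_splits)
  have **: "keys (p - single x c) \<subseteq> C" if "x \<in> C" "keys p \<subseteq> C" for x c C and p :: "'a \<times> 'b \<Rightarrow>\<^sub>0 complex"
    using keys_diff[of p "single x c"] that by (auto simp: keys_single split: if_splits)
  from rel show ?case
    by (cases rule: bilinear_relations_cases; simp only:; intro ** *) (auto simp: keys_single)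
qed simp

text \<open>The kernel is only a linear span by definition. It is an ideal because a bilinearity
  relation multiplied by a single pair is again a bilinearity relation.\<close>

lemma K_mult_l:
  assumes "keys x \<subseteq> carrier A \<times> carrier B" "p \<in> K"
  shows "conv (A \<times>\<times> B) x p \<in> K"
  using assms(1)
proof (induction x rule: pm_induct)
  case zero show ?case by (simp add: K_simps)
next
  case (add x y) then show ?case by (simp add: conv_add_left K_simps)
next
  case (single g c)
  obtain u v where g: "g = (u, v)" "u \<in> carrier A" "v \<in> carrier B" using single by auto
  from assms(2) show ?case
  proof (induction p rule: K_induct)
    case (rel r)
    from rel have "conv (A \<times>\<times> B) (single g 1) r \<in> K"
      by (cases rule: bilinear_relations_cases)
        (use g in \<open>auto simp: conv_diff_right mult_AB A.r_distr B.r_distr A.smult_assoc_r B.smult_assoc_r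
          intro!: K_simps(1) bilinear_relations_mem\<close>)
    then have "conv (A \<times>\<times> B) (scale_pm c (single g 1)) r \<in> K" unfolding conv_scale_left by (rule K_simps)
    then show ?case by simp
  qed (auto simp: conv_add_right conv_scale_right K_simps)
qed

lemma K_mult_r:
  assumes "keys x \<subseteq> carrier A \<times> carrier B" "p \<in> K"
  shows "conv (A \<times>\<times> B) p x \<in> K"
  using assms(1)
proof (induction x rule: pm_induct)
  case zero show ?case by (simp add: K_simps)
next
  case (add x y) then show ?case by (simp add: conv_add_right K_simps)
next
  case (single g c)
  obtain u v where g: "g = (u, v)" "u \<in> carrier A" "v \<in> carrier B" using single by auto
  from assms(2) show ?case
  proof (induction p rule: K_induct)
    case (rel r)
    from rel have "conv (A \<times>\<times> B) r (single g 1) \<in> K"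
      by (cases rule: bilinear_relations_cases)
        (use g in \<open>auto simp: conv_diff_left mult_AB A.l_distr B.l_distr A.smult_assoc_l B.smult_assoc_l
          intro!: K_simps(1) bilinear_relations_mem\<close>)
    then have "conv (A \<times>\<times> B) r (scale_pm c (single g 1)) \<in> K" unfolding conv_scale_right by (rule K_simps)
    then show ?case by simp
  qed (auto simp: conv_add_left conv_scale_left K_simps)
qed

lemma K_ideal: "ideal K (pair_algebra A B)"
proof -
  interpret P: calg "pair_algebra A B" by (rule calg_P)
  show ?thesis
  proof (rule idealI)
    show "ring (pair_algebra A B)" ..
    show "subgroup K (add_monoid (pair_algebra A B))"
    proof (rule P.add.subgroupI)
      show "K \<noteq> {}" using K_simps(5) by blast
      show "\<ominus>\<^bsub>pair_algebra A B\<^esub> p \<in> K" if "p \<in> K" for p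
        using that K_simps(6) K_keys[OF that] P_minus[of p 0] P.minus_eq[of 0 p]
        by (simp add: P_simps)
    qed (auto simp: P_simps K_simps dest: K_keys)
  qed (auto simp: P_simps K_mult_l K_mult_r)
qed

lemma calg_quot_K: "calg_quot (pair_algebra A B) K"
  by (intro calg_quot.intro calg_P K_ideal)

definition tcls :: "('a \<times> 'b \<Rightarrow>\<^sub>0 complex) \<Rightarrow> ('a \<times> 'b \<Rightarrow>\<^sub>0 complex) set" where
  "tcls p = K +>\<^bsub>pair_algebra A B\<^esub> p"

lemma tcls_carrier: "keys p \<subseteq> carrier A \<times> carrier B \<Longrightarrow> tcls p \<in> carrier (tensor_algebra A B)"
  and tcls_smult: "keys p \<subseteq> carrier A \<times> carrier B \<Longrightarrow> c \<odot>\<^bsub>tensor_algebra A B\<^esub> tcls p = tcls (scale_pm c p)"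
proof -
  interpret calg_quot "pair_algebra A B" K by (rule calg_quot_K)
  assume p: "keys p \<subseteq> carrier A \<times> carrier B"
  show "tcls p \<in> carrier (tensor_algebra A B)"
    "c \<odot>\<^bsub>tensor_algebra A B\<^esub> tcls p = tcls (scale_pm c p)"
    using cls_smult[of p c] cls_carrier[of p] p by (simp_all add: P_simps tcls_def tensor_algebra_def)
qed

lemma tcls_hom:
  assumes "keys p \<subseteq> carrier A \<times> carrier B" "keys q \<subseteq> carrier A \<times> carrier B"
  shows "tcls p \<oplus>\<^bsub>tensor_algebra A B\<^esub> tcls q = tcls (p + q)"
    "tcls p \<otimes>\<^bsub>tensor_algebra A B\<^esub> tcls q = tcls (conv (A \<times>\<times> B) p q)"
    "tcls p = tcls q \<longleftrightarrow> p - q \<in> K"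
proof -
  interpret calg_quot "pair_algebra A B" K by (rule calg_quot_K)
  show "tcls p \<oplus>\<^bsub>tensor_algebra A B\<^esub> tcls q = tcls (p + q)"
    "tcls p \<otimes>\<^bsub>tensor_algebra A B\<^esub> tcls q = tcls (conv (A \<times>\<times> B) p q)"
    "tcls p = tcls q \<longleftrightarrow> p - q \<in> K"
    using cls_add[of p q] cls_mult[of p q] cls_eq_iff[of p q] assms
    by (simp_all add: P_simps tcls_def tensor_algebra_def P_minus)
qed

lemma tcls_one: "\<one>\<^bsub>tensor_algebra A B\<^esub> = tcls (single (\<one>\<^bsub>A\<^esub>, \<one>\<^bsub>B\<^esub>) 1)"
proof -
  interpret calg_quot "pair_algebra A B" K by (rule calg_quot_K)
  show ?thesis using cls_one by (simp add: P_simps tcls_def tensor_algebra_def)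
qed

lemma calg_T: "calg (tensor_algebra A B)"
  unfolding tensor_algebra_def by (rule calg_quot.calg_Q[OF calg_quot_K])

lemma tcls_mem: "X \<in> tcls p \<Longrightarrow> keys p \<subseteq> carrier A \<times> carrier B \<Longrightarrow>
    keys X \<subseteq> carrier A \<times> carrier B \<and> X - p \<in> K"
proof -
  interpret calg_quot "pair_algebra A B" K by (rule calg_quot_K)
  assume "X \<in> tcls p" and p: "keys p \<subseteq> carrier A \<times> carrier B"
  then have "X \<in> carrier (pair_algebra A B)" "tcls X = tcls p"
    using cls_mem[of X p] by (auto simp: tcls_def P_simps)
  then show ?thesis using p tcls_hom(3)[of X p] by (simp add: P_simps)
qed

lemma tcls_self: "keys p \<subseteq> carrier A \<times> carrier B \<Longrightarrow> p \<in> tcls p"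
proof -
  interpret calg_quot "pair_algebra A B" K by (rule calg_quot_K)
  show "keys p \<subseteq> carrier A \<times> carrier B \<Longrightarrow> p \<in> tcls p"
    using cls_self[of p] by (simp add: tcls_def P_simps)
qed

lemma tensor_eq: "tensor A B a b = tcls (single (a, b) 1)"
  by (simp add: tensor_def tcls_def pair_pm_def)

lemma K_scale2:
  assumes "a \<in> carrier A" "b \<in> carrier B"
  shows "single (c \<odot>\<^bsub>A\<^esub> a, d \<odot>\<^bsub>B\<^esub> b) 1 - single (a, b) (c * d) \<in> K"
proof -
  have "(single (c \<odot>\<^bsub>A\<^esub> a, d \<odot>\<^bsub>B\<^esub> b) 1 - single (a, d \<odot>\<^bsub>B\<^esub> b) c) +
     scale_pm c (single (a, d \<odot>\<^bsub>B\<^esub> b) 1 - single (a, b) d) \<in> K"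
    by (intro K_simps(1,2,4) bilinear_relations_mem) (use assms in auto)
  then show ?thesis by (simp add: pm.scale_right_diff_distrib)
qed

end

definition push :: "('a \<Rightarrow> 'c) \<Rightarrow> ('b \<Rightarrow> 'd) \<Rightarrow> ('a \<times> 'b \<Rightarrow>\<^sub>0 complex) \<Rightarrow> ('c \<times> 'd \<Rightarrow>\<^sub>0 complex)" where
  "push f g = lin (\<lambda>(a, b). single (f a, g b) 1)"

lemma push_simps:
  "push f g (p + q) = push f g p + push f g q" "push f g (p - q) = push f g p - push f g q"
  "push f g (scale_pm c p) = scale_pm c (push f g p)" "push f g 0 = 0"
  "push f g (single (a, b) c) = single (f a, g b) c" "push f g (sum F S) = (\<Sum>x\<in>S. push f g (F x))"
  by (simp_all add: push_def lin_add lin_diff lin_scale lin_sum)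

locale tensor_hom = AB: tensor_pair A B + CD: tensor_pair C D
  for A :: "('a, 'c) star_algebra_scheme" and B :: "('b, 'd) star_algebra_scheme"
  and C :: "('e, 'f) star_algebra_scheme" and D :: "('g, 'h) star_algebra_scheme" +
  fixes f g
  assumes f: "f \<in> alg_hom A C" and g: "g \<in> alg_hom B D"
begin

lemma keys_push: "keys p \<subseteq> carrier A \<times> carrier B \<Longrightarrow> keys (push f g p) \<subseteq> carrier C \<times> carrier D"
  unfolding push_def by (rule keys_lin) (use alg_homD[OF f] alg_homD[OF g] in \<open>auto simp: keys_single\<close>)

lemma push_K: "p \<in> bilinear_kernel A B \<Longrightarrow> push f g p \<in> bilinear_kernel C D"
proof (induction rule: AB.K_induct)
  case (rel r)
  then show ?case
    by (cases rule: AB.bilinear_relations_cases)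
      (auto simp: push_simps alg_homD[OF f] alg_homD[OF g] intro!: CD.K_simps(1) CD.bilinear_relations_mem)
qed (auto simp: push_simps CD.K_simps)

lemma push_conv:
  assumes "keys p \<subseteq> carrier A \<times> carrier B" "keys q \<subseteq> carrier A \<times> carrier B"
  shows "push f g (conv (A \<times>\<times> B) p q) = conv (C \<times>\<times> D) (push f g p) (push f g q)"
  using assms(1)
proof (induction p rule: pm_induct)
  case (single x c)
  show ?case using assms(2)
    by (induction q rule: pm_induct)
      (use single in \<open>auto simp: conv_add_right push_simps AB.mult_AB CD.mult_AB alg_homD[OF f] alg_homD[OF g]\<close>)
qed (auto simp: conv_add_left push_simps)

text \<open>\<open>push\<close> carries bilinearity relations to bilinearity relations, so the union
  over representatives in \<open>tensor_map\<close> is a single coset.\<close>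

lemma tensor_map_tcls:
  assumes p: "keys p \<subseteq> carrier A \<times> carrier B"
  shows "tensor_map C D f g (AB.tcls p) = CD.tcls (push f g p)"
proof -
  have "CD.tcls (push f g X) = CD.tcls (push f g p)" if "X \<in> AB.tcls p" for X
  proof -
    have X: "keys X \<subseteq> carrier A \<times> carrier B" "X - p \<in> bilinear_kernel A B"
      using AB.tcls_mem[OF that p] by auto
    have "push f g X - push f g p \<in> bilinear_kernel C D" using push_K[OF X(2)] by (simp add: push_simps)
    then show ?thesis using CD.tcls_hom(3)[OF keys_push[OF X(1)] keys_push[OF p]] by simp
  qed
  moreover have "tensor_map C D f g (AB.tcls p) = (\<Union>X\<in>AB.tcls p. CD.tcls (push f g X))"
    unfolding tensor_map_def CD.tcls_def push_def lin_def
    by (simp add: case_prod_beta)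
  ultimately show ?thesis using AB.tcls_self[OF p] by blast
qed

end

section \<open>The coproduct\<close>

lemma calg_SL: "calg (SL_alg \<theta>)"
  by (rule salg.axioms(1)[OF salg_SL])

interpretation HH: tensor_pair "SL_alg \<theta>" "SL_alg \<theta>" for \<theta>
  by (intro tensor_pair.intro calg_SL)

abbreviation "convHH \<theta> \<equiv> conv (SL_alg \<theta> \<times>\<times> SL_alg \<theta>)"
abbreviation "KHH \<theta> \<equiv> bilinear_kernel (SL_alg \<theta>) (SL_alg \<theta>)"
abbreviation "funit \<equiv> single [] 1 :: letter list \<Rightarrow>\<^sub>0 complex"

definition pair_tensor :: "real \<Rightarrow> (letter list \<Rightarrow>\<^sub>0 complex) \<Rightarrow> (letter list \<Rightarrow>\<^sub>0 complex) \<Rightarrow>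
    ((letter list \<Rightarrow>\<^sub>0 complex) set set \<times> (letter list \<Rightarrow>\<^sub>0 complex) set set \<Rightarrow>\<^sub>0 complex)" where
  "pair_tensor \<theta> p q = single (qS \<theta> p, qS \<theta> q) 1"

lemma keys_pair_tensor: "keys (pair_tensor \<theta> p q) \<subseteq> carrier (SL_alg \<theta>) \<times> carrier (SL_alg \<theta>)"
  by (simp add: pair_tensor_def)

lemma pair_tensor_mult: "convHH \<theta> (pair_tensor \<theta> p q) (pair_tensor \<theta> p' q') =
    pair_tensor \<theta> (p \<star> p') (q \<star> q')"
  by (simp add: pair_tensor_def HH.mult_AB qS_hom)

lemma pair_tensor_linear:
  "pair_tensor \<theta> (p + p') q - (pair_tensor \<theta> p q + pair_tensor \<theta> p' q) \<in> KHH \<theta>"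
  "pair_tensor \<theta> p (q + q') - (pair_tensor \<theta> p q + pair_tensor \<theta> p q') \<in> KHH \<theta>"
  "pair_tensor \<theta> (scale_pm c p) q - scale_pm c (pair_tensor \<theta> p q) \<in> KHH \<theta>"
  "pair_tensor \<theta> p (scale_pm c q) - scale_pm c (pair_tensor \<theta> p q) \<in> KHH \<theta>"
  using HH.bilinear_relations_mem[THEN HH.K_simps(1), of "qS \<theta> p" \<theta> "qS \<theta> q"]
  by (auto simp: pair_tensor_def diff_diff_eq qS_hom(2,6) simp flip: qS_hom(2,6))

lemma K_trans: "p - q \<in> bilinear_kernel A B \<Longrightarrow> q - r \<in> bilinear_kernel A B \<Longrightarrow> p - r \<in> bilinear_kernel A B"
  unfolding bilinear_kernel_def using pm.span_add[of "p - q" _ "q - r"] by simp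

lemma K_sym: "p - q \<in> bilinear_kernel A B \<Longrightarrow> q - p \<in> bilinear_kernel A B"
  unfolding bilinear_kernel_def using pm.span_neg[of "p - q"] by simp

lemma K_sum: "(\<And>x. x \<in> S \<Longrightarrow> f x - g x \<in> bilinear_kernel A B) \<Longrightarrow> sum f S - sum g S \<in> bilinear_kernel A B"
  unfolding bilinear_kernel_def sum_subtractf[symmetric] by (rule pm.span_sum)

lemma pair_tensor_sum:
  assumes "finite S"
  shows "pair_tensor \<theta> (sum f S) q - (\<Sum>x\<in>S. pair_tensor \<theta> (f x) q) \<in> KHH \<theta>"
    "pair_tensor \<theta> q (sum f S) - (\<Sum>x\<in>S. pair_tensor \<theta> q (f x)) \<in> KHH \<theta>"
proof -
  show "pair_tensor \<theta> (sum f S) q - (\<Sum>x\<in>S. pair_tensor \<theta> (f x) q) \<in> KHH \<theta>" using assms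
  proof induction
    case empty show ?case using pair_tensor_linear(3)[of \<theta> 0 0 q] by simp
  next
    case (insert x S)
    have "pair_tensor \<theta> (f x + sum f S) q - (pair_tensor \<theta> (f x) q + pair_tensor \<theta> (sum f S) q) +
       (pair_tensor \<theta> (sum f S) q - (\<Sum>x\<in>S. pair_tensor \<theta> (f x) q)) \<in> KHH \<theta>"
      by (intro HH.K_simps pair_tensor_linear insert)
    then show ?case using insert by (simp add: algebra_simps)
  qed
  show "pair_tensor \<theta> q (sum f S) - (\<Sum>x\<in>S. pair_tensor \<theta> q (f x)) \<in> KHH \<theta>" using assms
  proof induction
    case empty show ?case using pair_tensor_linear(4)[of \<theta> q 0 0] by simp
  next
    case (insert x S)
    have "pair_tensor \<theta> q (f x + sum f S) - (pair_tensor \<theta> q (f x) + pair_tensor \<theta> q (sum f S)) +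
       (pair_tensor \<theta> q (sum f S) - (\<Sum>x\<in>S. pair_tensor \<theta> q (f x))) \<in> KHH \<theta>"
      by (intro HH.K_simps pair_tensor_linear insert)
    then show ?case using insert by (simp add: algebra_simps)
  qed
qed

definition delta_letter where
  "delta_letter \<theta> a = (\<Sum>k\<in>{1..4}. scale_pm (letter_sign a) (pair_tensor \<theta> (ent (row a) k) (ent k (col a))))"

fun delta_word where
  "delta_word \<theta> [] = pair_tensor \<theta> funit funit"
| "delta_word \<theta> (a # w) = convHH \<theta> (delta_letter \<theta> a) (delta_word \<theta> w)"

text \<open>A lift of the coproduct to the free algebra, with values in the algebra of formal combinations
  of pairs.\<close>

definition cop :: "real \<Rightarrow> (letter list \<Rightarrow>\<^sub>0 complex) \<Rightarrow>
    ((letter list \<Rightarrow>\<^sub>0 complex) set set \<times> (letter list \<Rightarrow>\<^sub>0 complex) set set \<Rightarrow>\<^sub>0 complex)" where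
  "cop \<theta> = lin (delta_word \<theta>)"

lemma keys_sumI: "(\<And>x. x \<in> S \<Longrightarrow> keys (f x) \<subseteq> C) \<Longrightarrow> keys (sum f S) \<subseteq> C"
  by (rule subset_trans[OF keys_sum]) blast

lemma keys_delta_letter: "keys (delta_letter \<theta> a) \<subseteq> carrier (SL_alg \<theta>) \<times> carrier (SL_alg \<theta>)"
  unfolding delta_letter_def by (intro keys_sumI subset_trans[OF keys_scale_pm] keys_pair_tensor)

lemma keys_delta_word: "keys (delta_word \<theta> w) \<subseteq> carrier (SL_alg \<theta>) \<times> carrier (SL_alg \<theta>)"
proof (induction w)
  case (Cons a w)
  then show ?case unfolding delta_word.simps by (intro HH.keys_conv_AB keys_delta_letter)
qed (simp add: keys_pair_tensor)

lemma keys_cop: "keys (cop \<theta> p) \<subseteq> carrier (SL_alg \<theta>) \<times> carrier (SL_alg \<theta>)"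
  unfolding cop_def by (intro keys_lin keys_delta_word)

lemma convHH_unit:
  assumes "keys x \<subseteq> carrier (SL_alg \<theta>) \<times> carrier (SL_alg \<theta>)"
  shows "convHH \<theta> (pair_tensor \<theta> funit funit) x = x" "convHH \<theta> x (pair_tensor \<theta> funit funit) = x"
  using conv_one[OF HH.monoid_AB[of \<theta>], of x] assms by (simp_all add: pair_tensor_def qS_hom)

lemma convHH_assoc:
  assumes "keys x \<subseteq> carrier (SL_alg \<theta>) \<times> carrier (SL_alg \<theta>)" "keys y \<subseteq> carrier (SL_alg \<theta>) \<times> carrier (SL_alg \<theta>)"
    "keys z \<subseteq> carrier (SL_alg \<theta>) \<times> carrier (SL_alg \<theta>)"
  shows "convHH \<theta> (convHH \<theta> x y) z = convHH \<theta> x (convHH \<theta> y z)"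
  using conv_assoc[OF HH.monoid_AB[of \<theta>], of x y z] assms by simp

lemma delta_word_append: "delta_word \<theta> (u @ v) = convHH \<theta> (delta_word \<theta> u) (delta_word \<theta> v)"
  by (induction u) (simp_all add: convHH_unit convHH_assoc keys_delta_word keys_delta_letter)

lemma cop_linear:
  "cop \<theta> (p + q) = cop \<theta> p + cop \<theta> q" "cop \<theta> (p - q) = cop \<theta> p - cop \<theta> q"
  "cop \<theta> (scale_pm c p) = scale_pm c (cop \<theta> p)" "cop \<theta> 0 = 0" "cop \<theta> (sum f S) = (\<Sum>x\<in>S. cop \<theta> (f x))"
  "cop \<theta> (single w c) = scale_pm c (delta_word \<theta> w)"
  by (simp_all add: cop_def lin_add lin_diff lin_scale lin_sum)

lemma cop_mult: "cop \<theta> (p \<star> q) = convHH \<theta> (cop \<theta> p) (cop \<theta> q)"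
proof (induction p rule: free_induct)
  case (single u c)
  show ?case
    by (induction q rule: free_induct)
      (simp_all add: free_mult_linear cop_linear conv_add_right delta_word_append conv_scale_left conv_scale_right mult.commute)
qed (simp_all add: free_mult_linear cop_linear conv_add_left)

lemma cop_unit: "cop \<theta> funit = pair_tensor \<theta> funit funit"
  by (simp add: cop_linear)

lemma cop_ent:
  assumes "i \<in> {1..4}" "j \<in> {1..4}"
  shows "cop \<theta> (ent i j) = (\<Sum>k\<in>{1..4}. pair_tensor \<theta> (ent i k) (ent k j))"
  using assms
  by (simp add: ent_def[of i j] cop_linear convHH_unit keys_delta_letter del: atLeastAtMost_iff)
    (simp add: delta_letter_def row_letter col_letter pm.scale_sum_right del: atLeastAtMost_iff)

text \<open>Unlike evaluation, \<open>cop\<close> is strictly multiplicative, so this preimage is an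
  ideal; well-definedness of the coproduct then has to be tested only on letter relations and the
  determinant.\<close>

lemma cop_kernel_ideal: "ideal {p. cop \<theta> p \<in> KHH \<theta>} free_star_algebra"
proof -
  interpret calg free_star_algebra by (rule calg_free)
  show ?thesis
  proof (rule idealI)
    show "ring free_star_algebra" ..
    show "subgroup {p. cop \<theta> p \<in> KHH \<theta>} (add_monoid free_star_algebra)"
    proof (rule add.subgroupI)
      have "0 \<in> {p. cop \<theta> p \<in> KHH \<theta>}" by (simp add: cop_linear HH.K_simps)
      then show "{p. cop \<theta> p \<in> KHH \<theta>} \<noteq> {}" by blast
      show "\<ominus>\<^bsub>free_star_algebra\<^esub> p \<in> {p. cop \<theta> p \<in> KHH \<theta>}" if "p \<in> {p. cop \<theta> p \<in> KHH \<theta>}" for p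
        using that cop_linear(2)[of \<theta> 0 p] by (simp add: free_simps cop_linear HH.K_simps)
    qed (auto simp: free_simps cop_linear HH.K_simps)
  qed (simp_all add: cop_mult HH.K_mult_l HH.K_mult_r keys_cop)
qed

lemma qS_ent_swap:
  assumes "i \<in> {1..4}" "j \<in> {1..4}" "k \<in> {1..4}" "l \<in> {1..4}"
  shows "qS \<theta> (ent i j \<star> ent k l)
     = (eta \<theta> k i * eta \<theta> j l) \<odot>\<^bsub>SL_alg \<theta>\<^esub> qS \<theta> (ent k l \<star> ent i j)"
  unfolding qS_hom
proof (rule qS_eqI)
  fix A
  have "eta (\<theta> / 2) k i * eta (\<theta> / 2) j l = eta \<theta> k i * eta \<theta> j l * (eta (\<theta> / 2) i k * eta (\<theta> / 2) l j)"
    by (subst eta_half[OF assms(3,1), symmetric], subst eta_half[OF assms(2,4), symmetric]) (simp only: mult_ac)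
  then show "ev \<theta> (ent i j \<star> ent k l) A =
    ev \<theta> (scale_pm (eta \<theta> k i * eta \<theta> j l) (ent k l \<star> ent i j)) A"
    using assms by (simp add: ev_ent_ent ev_linear del: atLeastAtMost_iff)
qed

text \<open>Exchanging the factors in both tensor legs produces phases
  \<open>eta \<theta> p q\<close> and \<open>eta \<theta> q p\<close> from the summation indices.
  They cancel, and what remains is the commutation factor of the two letters.\<close>

lemma cop_letter_relation: "cop \<theta> (letter_relation \<theta> a b) \<in> KHH \<theta>"
proof -
  let ?M = "\<lambda>p q. p \<star> q"
  let ?i = "row a" and ?j = "col a" and ?k = "row b" and ?l = "col b"
  let ?x = "\<lambda>p q. pair_tensor \<theta> (?M (ent ?i p) (ent ?k q)) (?M (ent p ?j) (ent q ?l))"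
  let ?y = "\<lambda>p q. pair_tensor \<theta> (?M (ent ?k q) (ent ?i p)) (?M (ent q ?l) (ent p ?j))"
  have *: "?x p q - scale_pm (twist \<theta> a b) (?y p q) \<in> KHH \<theta>" if pq: "p \<in> {1..4}" "q \<in> {1..4}" for p q
  proof -
    let ?c = "eta \<theta> ?k ?i * eta \<theta> p q" and ?d = "eta \<theta> q p * eta \<theta> ?j ?l"
    have "?c * ?d = (eta \<theta> p q * eta \<theta> q p) * twist \<theta> a b" by (simp only: twist_def mult_ac)
    then have cd: "?c * ?d = twist \<theta> a b" using eta_inverse[OF pq, of \<theta>] by simp
    show ?thesis
      using HH.K_scale2[of "qS \<theta> (?M (ent ?k q) (ent ?i p))" \<theta> "qS \<theta> (?M (ent q ?l) (ent p ?j))" ?c ?d]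
      unfolding cd pair_tensor_def qS_ent_swap[OF row_range pq(1) row_range pq(2)]
        qS_ent_swap[OF pq(1) col_range pq(2) col_range]
      by simp
  qed
  have 1: "convHH \<theta> (delta_letter \<theta> a) (delta_letter \<theta> b)
      = (\<Sum>p\<in>{1..4}. \<Sum>q\<in>{1..4}. scale_pm (letter_sign a * letter_sign b) (?x p q))"
    unfolding delta_letter_def conv_sum_left unfolding conv_sum_right
    by (simp add: conv_scale_left conv_scale_right pair_tensor_mult mult.commute)
  have "convHH \<theta> (delta_letter \<theta> b) (delta_letter \<theta> a)
      = (\<Sum>q\<in>{1..4}. \<Sum>p\<in>{1..4}. scale_pm (letter_sign a * letter_sign b) (?y p q))"
    unfolding delta_letter_def conv_sum_left unfolding conv_sum_right
    by (simp add: conv_scale_left conv_scale_right pair_tensor_mult)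
  also have "\<dots> = (\<Sum>p\<in>{1..4}. \<Sum>q\<in>{1..4}. scale_pm (letter_sign a * letter_sign b) (?y p q))" by (rule sum.swap)
  finally have 2: "convHH \<theta> (delta_letter \<theta> b) (delta_letter \<theta> a) = \<dots>" .
  have "cop \<theta> (letter_relation \<theta> a b) =
     convHH \<theta> (delta_letter \<theta> a) (delta_letter \<theta> b) - scale_pm (twist \<theta> a b) (convHH \<theta> (delta_letter \<theta> b) (delta_letter \<theta> a))"
    by (simp add: letter_relation_def cop_linear convHH_unit keys_delta_letter)
  also have "\<dots> = (\<Sum>p\<in>{1..4}. \<Sum>q\<in>{1..4}. scale_pm (letter_sign a * letter_sign b) (?x p q - scale_pm (twist \<theta> a b) (?y p q)))"
    unfolding 1 2 by (simp add: pm.scale_sum_right pm.scale_right_diff_distrib sum_subtractf mult_ac)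
  also have "\<dots> \<in> KHH \<theta>" by (intro HH.K_simps(4,7) *)
  finally show ?thesis .
qed

section \<open>Coproducts of words of length four and of the determinant\<close>

fun word4 :: "nat \<times> nat \<times> nat \<times> nat \<Rightarrow> nat \<times> nat \<times> nat \<times> nat \<Rightarrow> (letter list \<Rightarrow>\<^sub>0 complex)" where
  "word4 (i1, i2, i3, i4) (j1, j2, j3, j4) =
     ent i1 j1 \<star> (ent i2 j2 \<star>
       (ent i3 j3 \<star> ent i4 j4))"

abbreviation "quads \<equiv> {1..4::nat} \<times> {1..4::nat} \<times> {1..4::nat} \<times> {1..4::nat}"

lemma word4_eq: "word4 (i1, i2, i3, i4) (j1, j2, j3, j4) =
    single [letter i1 j1, letter i2 j2, letter i3 j3, letter i4 j4]
     (letter_sign (letter i1 j1) * letter_sign (letter i2 j2) * letter_sign (letter i3 j3) * letter_sign (letter i4 j4))"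
  by (simp add: ent_def mult.assoc)

lemma sum_quads: "(\<Sum>k\<in>quads. F k) = (\<Sum>k1\<in>{1..4}. \<Sum>k2\<in>{1..4}. \<Sum>k3\<in>{1..4}. \<Sum>k4\<in>{1..4}. F (k1, k2, k3, k4))"
  by (simp add: sum.cartesian_product')

lemma cop_word4:
  assumes "i \<in> quads" "j \<in> quads"
  shows "cop \<theta> (word4 i j) = (\<Sum>k\<in>quads. pair_tensor \<theta> (word4 i k) (word4 k j))"
proof -
  obtain i1 i2 i3 i4 j1 j2 j3 j4 where ij: "i = (i1, i2, i3, i4)" "j = (j1, j2, j3, j4)" by (metis prod_cases4)
  have r: "i1 \<in> {1..4}" "i2 \<in> {1..4}" "i3 \<in> {1..4}" "i4 \<in> {1..4}" "j1 \<in> {1..4}" "j2 \<in> {1..4}" "j3 \<in> {1..4}" "j4 \<in> {1..4}"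
    using assms ij by auto
  have "cop \<theta> (word4 i j) = (\<Sum>k1\<in>{1..4}. convHH \<theta> (pair_tensor \<theta> (ent i1 k1) (ent k1 j1))
     (\<Sum>k2\<in>{1..4}. convHH \<theta> (pair_tensor \<theta> (ent i2 k2) (ent k2 j2))
     (\<Sum>k3\<in>{1..4}. convHH \<theta> (pair_tensor \<theta> (ent i3 k3) (ent k3 j3)) (\<Sum>k4\<in>{1..4}. pair_tensor \<theta> (ent i4 k4) (ent k4 j4)))))"
    unfolding ij word4.simps cop_mult cop_ent[OF r(1,5)] cop_ent[OF r(2,6)] cop_ent[OF r(3,7)] cop_ent[OF r(4,8)]
      conv_sum_left ..
  also have "\<dots> = (\<Sum>k\<in>quads. pair_tensor \<theta> (word4 i k) (word4 k j))"
    unfolding sum_quads conv_sum_right pair_tensor_mult ij word4.simps ..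
  finally show ?thesis .
qed

lemma ev_word4:
  assumes "i1 \<in> {1..4}" "i2 \<in> {1..4}" "i3 \<in> {1..4}" "i4 \<in> {1..4}"
    "j1 \<in> {1..4}" "j2 \<in> {1..4}" "j3 \<in> {1..4}" "j4 \<in> {1..4}"
  shows "ev \<theta> (word4 (i1, i2, i3, i4) (j1, j2, j3, j4)) A =
    eta6 \<theta> i1 i2 i3 i4 * eta6 \<theta> j4 j3 j2 j1 * (A i1 j1 * A i2 j2 * A i3 j3 * A i4 j4)"
  unfolding word4_eq ev_linear phi_word_4[OF assms] ..

lemma eta6_inverse:
  assumes "i \<in> {1..4}" "j \<in> {1..4}" "k \<in> {1..4}" "l \<in> {1..4}"
  shows "eta6 \<theta> i j k l * eta6 \<theta> l k j i = 1"
proof -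
  let ?e = "eta (\<theta> / 2)"
  have "eta6 \<theta> i j k l * eta6 \<theta> l k j i = (?e j i * ?e i j) * (?e k i * ?e i k) * (?e l i * ?e i l) *
    (?e k j * ?e j k) * (?e l j * ?e j l) * (?e l k * ?e k l)"
    unfolding eta6_def by (simp only: mult_ac)
  then show ?thesis by (simp only: eta_inverse assms mult_1_right)
qed

text \<open>The determinant is group-like: expanding \<open>\<Delta>(det)\<close> along the rows, the second tensor factor
  becomes a determinant with permuted or repeated rows, hence a multiple of \<open>det = 1\<close>.\<close>

lemma cop_det: "cop \<theta> (fdet \<theta>) - cop \<theta> funit \<in> KHH \<theta>"
proof -
  let ?P = "{\<sigma>. \<sigma> permutes {1..4::nat}}"
  let ?c = "\<lambda>\<sigma>. of_int (sign \<sigma>) * eps \<theta> [\<sigma> 1, \<sigma> 2, \<sigma> 3, \<sigma> 4]"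
  let ?t = "\<lambda>\<sigma>::nat \<Rightarrow> nat. (\<sigma> 1, \<sigma> 2, \<sigma> 3, \<sigma> 4)"
  let ?o = "(1, 2, 3, 4) :: nat \<times> nat \<times> nat \<times> nat"
  let ?R = "\<lambda>(k1, k2, k3, k4). rows_det \<theta> k1 k2 k3 k4"
  \<comment> \<open>The multiple of det that the determinant with rows \<open>k\<close> equals: the
    phase of the rows times the sign of sorting them, zero if a row repeats.\<close>
  let ?d = "\<lambda>(k1, k2, k3, k4). eta6 \<theta> k1 k2 k3 k4 * levi k1 k2 k3 k4"
  have R: "?R k = (\<Sum>\<sigma>\<in>?P. scale_pm (?c \<sigma>) (word4 k (?t \<sigma>)))" for k
    by (cases k) (simp only: case_prod_conv rows_det_def word4_eq)
  have t: "?t \<sigma> \<in> quads" if "\<sigma> \<in> ?P" for \<sigma>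
  proof -
    have s: "\<sigma> permutes {1..4}" using that by simp
    have "\<sigma> 1 \<in> {1..4}" "\<sigma> 2 \<in> {1..4}" "\<sigma> 3 \<in> {1..4}" "\<sigma> 4 \<in> {1..4}"
      by (simp_all only: permutes_in_image[OF s]) auto
    then show ?thesis by blast
  qed
  have o: "?o \<in> quads" by simp
  have "fdet \<theta> = (\<Sum>\<sigma>\<in>?P. scale_pm (?c \<sigma>) (word4 ?o (?t \<sigma>)))" using R[of ?o] by (simp only: case_prod_conv)
  then have "cop \<theta> (fdet \<theta>) = (\<Sum>\<sigma>\<in>?P. scale_pm (?c \<sigma>) (cop \<theta> (word4 ?o (?t \<sigma>))))"
    by (simp only: cop_linear)
  also have "\<dots> = (\<Sum>\<sigma>\<in>?P. scale_pm (?c \<sigma>) (\<Sum>k\<in>quads. pair_tensor \<theta> (word4 ?o k) (word4 k (?t \<sigma>))))"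
    by (intro sum.cong refl) (simp only: cop_word4[OF o t])
  also have "\<dots> = (\<Sum>k\<in>quads. \<Sum>\<sigma>\<in>?P. scale_pm (?c \<sigma>) (pair_tensor \<theta> (word4 ?o k) (word4 k (?t \<sigma>))))"
    unfolding pm.scale_sum_right by (rule sum.swap)
  finally have 1: "cop \<theta> (fdet \<theta>) = \<dots>" .
  have 2: "(\<Sum>\<sigma>\<in>?P. scale_pm (?c \<sigma>) (pair_tensor \<theta> (word4 ?o k) (word4 k (?t \<sigma>)))) - pair_tensor \<theta> (word4 ?o k) (?R k) \<in> KHH \<theta>" for k
  proof -
    have "pair_tensor \<theta> (word4 ?o k) (?R k) - (\<Sum>\<sigma>\<in>?P. pair_tensor \<theta> (word4 ?o k) (scale_pm (?c \<sigma>) (word4 k (?t \<sigma>)))) \<in> KHH \<theta>"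
      unfolding R by (rule pair_tensor_sum) (simp add: finite_permutations)
    from K_sym[OF K_trans[OF this K_sum[OF pair_tensor_linear(4)]]] show ?thesis .
  qed
  have qR: "qS \<theta> (?R k) = qS \<theta> (scale_pm (?d k) funit)" if k: "k \<in> quads" for k
  proof -
    obtain k1 k2 k3 k4 where kk: "k = (k1, k2, k3, k4)" by (metis prod_cases4)
    with k have r: "k1 \<in> {1..4}" "k2 \<in> {1..4}" "k3 \<in> {1..4}" "k4 \<in> {1..4}" by auto
    have "qS \<theta> (?R k) = qS \<theta> (scale_pm (?d k) (fdet \<theta>))"
      by (rule qS_eqI) (simp only: kk case_prod_conv ev_linear ev_rows_det[OF r] ev_fdet det4_rows[OF r] det4_pfaff mult.assoc)
    also have "\<dots> = qS \<theta> (scale_pm (?d k) funit)" unfolding qS_hom(6)[symmetric] qS_det ..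
    finally show ?thesis .
  qed
  have 3: "pair_tensor \<theta> (word4 ?o k) (?R k) - pair_tensor \<theta> (scale_pm (?d k) (word4 ?o k)) funit \<in> KHH \<theta>" if k: "k \<in> quads" for k
  proof -
    have "pair_tensor \<theta> (word4 ?o k) (?R k) = pair_tensor \<theta> (word4 ?o k) (scale_pm (?d k) funit)"
      unfolding pair_tensor_def qR[OF k] ..
    have a: "pair_tensor \<theta> (word4 ?o k) (scale_pm (?d k) funit) - scale_pm (?d k) (pair_tensor \<theta> (word4 ?o k) funit) \<in> KHH \<theta>"
      by (rule pair_tensor_linear)
    have b: "scale_pm (?d k) (pair_tensor \<theta> (word4 ?o k) funit) - pair_tensor \<theta> (scale_pm (?d k) (word4 ?o k)) funit \<in> KHH \<theta>"
      by (rule K_sym) (rule pair_tensor_linear)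
    show ?thesis unfolding \<open>pair_tensor \<theta> (word4 ?o k) (?R k) = _\<close> by (rule K_trans[OF a b])
  qed
  \<comment> \<open>The column phase of \<open>word4 ?o k\<close> is inverse to the row phase in
    \<open>?d k\<close>, so the sum over all quadruples is the classical expansion of the
    determinant.\<close>
  have "qS \<theta> (\<Sum>k\<in>quads. scale_pm (?d k) (word4 ?o k)) = qS \<theta> (fdet \<theta>)"
  proof (rule qS_eqI)
    fix A
    have "?d k * ev \<theta> (word4 ?o k) A = (case k of (k1, k2, k3, k4) \<Rightarrow> levi k1 k2 k3 k4 * (A 1 k1 * A 2 k2 * A 3 k3 * A 4 k4))"
      if k: "k \<in> quads" for k
    proof -
      obtain k1 k2 k3 k4 where kk: "k = (k1, k2, k3, k4)" by (metis prod_cases4)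
      with k have r: "k1 \<in> {1..4}" "k2 \<in> {1..4}" "k3 \<in> {1..4}" "k4 \<in> {1..4}" by auto
      have o: "1 \<in> {1..4::nat}" "2 \<in> {1..4::nat}" "3 \<in> {1..4::nat}" "4 \<in> {1..4::nat}" by auto
      have e: "eta6 \<theta> 1 2 3 4 = 1" by (simp add: eta6_def mult_ac)
      have "?d k * ev \<theta> (word4 ?o k) A = (eta6 \<theta> k1 k2 k3 k4 * eta6 \<theta> k4 k3 k2 k1) *
          (levi k1 k2 k3 k4 * (A 1 k1 * A 2 k2 * A 3 k3 * A 4 k4))"
        unfolding kk ev_word4[OF o r] e case_prod_conv by (simp only: mult_ac mult_1_left)
      then show ?thesis unfolding eta6_inverse[OF r] kk by simp
    qed
    then have "ev \<theta> (\<Sum>k\<in>quads. scale_pm (?d k) (word4 ?o k)) A =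
      (\<Sum>k\<in>quads. case k of (k1, k2, k3, k4) \<Rightarrow> levi k1 k2 k3 k4 * (A 1 k1 * A 2 k2 * A 3 k3 * A 4 k4))"
      unfolding ev_linear by (intro sum.cong refl)
    also have "\<dots> = ev \<theta> (fdet \<theta>) A"
      unfolding sum_quads case_prod_conv det4_levi ev_fdet det4_pfaff ..
    finally show "ev \<theta> (\<Sum>k\<in>quads. scale_pm (?d k) (word4 ?o k)) A = ev \<theta> (fdet \<theta>) A" .
  qed
  then have 4: "pair_tensor \<theta> (\<Sum>k\<in>quads. scale_pm (?d k) (word4 ?o k)) funit = pair_tensor \<theta> funit funit"
    by (simp only: pair_tensor_def qS_det)
  have a: "cop \<theta> (fdet \<theta>) - (\<Sum>k\<in>quads. pair_tensor \<theta> (word4 ?o k) (?R k)) \<in> KHH \<theta>" unfolding 1 by (rule K_sum) (rule 2)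
  have b: "(\<Sum>k\<in>quads. pair_tensor \<theta> (word4 ?o k) (?R k)) - (\<Sum>k\<in>quads. pair_tensor \<theta> (scale_pm (?d k) (word4 ?o k)) funit) \<in> KHH \<theta>"
    by (rule K_sum) (rule 3)
  have c: "(\<Sum>k\<in>quads. pair_tensor \<theta> (scale_pm (?d k) (word4 ?o k)) funit) - pair_tensor \<theta> funit funit \<in> KHH \<theta>"
    unfolding 4[symmetric] by (rule K_sym, rule pair_tensor_sum) simp
  show ?thesis unfolding cop_unit by (rule K_trans[OF K_trans[OF a b] c])
qed

lemma cop_respects: "qS \<theta> p = qS \<theta> q \<Longrightarrow> cop \<theta> p - cop \<theta> q \<in> KHH \<theta>"
proof -
  assume "qS \<theta> p = qS \<theta> q"
  let ?N = "{p. cop \<theta> p \<in> KHH \<theta>}"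
  have "M_ideal \<theta> \<subseteq> ?N" by (rule M_ideal_least[OF cop_kernel_ideal]) (simp add: cop_letter_relation)
  have "SL_ideal \<theta> \<subseteq> qM \<theta> ` ?N"
    by (rule SL_ideal_image_least[OF cop_kernel_ideal]) (use cop_det in \<open>simp add: cop_linear(2)\<close>)
  then obtain n where n: "n \<in> ?N" "qM \<theta> (p - q) = qM \<theta> n"
    using \<open>qS \<theta> p = qS \<theta> q\<close> by (auto simp: qS_eq_iff)
  then have "(p - q) - n \<in> M_ideal \<theta>" by (simp add: qM_eq_iff M_ideal_iff ev_linear)
  then have "cop \<theta> ((p - q) - n) \<in> KHH \<theta>" using \<open>M_ideal \<theta> \<subseteq> ?N\<close> by blast
  then have "cop \<theta> ((p - q) - n) + cop \<theta> n \<in> KHH \<theta>" using n(1) by (intro HH.K_simps(2)) auto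
  then show ?thesis by (simp add: cop_linear)
qed

lemma tensor_sum_4:
  "(\<Oplus>\<^bsub>tensor_algebra (SL_alg \<theta>) (SL_alg \<theta>)\<^esub>k\<in>{1..4::nat}.
      tensor (SL_alg \<theta>) (SL_alg \<theta>) (qS \<theta> (f k)) (qS \<theta> (g k))) = HH.tcls \<theta> (\<Sum>k\<in>{1..4}. pair_tensor \<theta> (f k) (g k))"
proof -
  interpret T: calg "tensor_algebra (SL_alg \<theta>) (SL_alg \<theta>)" by (rule HH.calg_T)
  have k: "keys (pair_tensor \<theta> (f i) (g i) + x) \<subseteq> carrier (SL_alg \<theta>) \<times> carrier (SL_alg \<theta>)"
    if "keys x \<subseteq> carrier (SL_alg \<theta>) \<times> carrier (SL_alg \<theta>)" for i x
    using keys_add[of "pair_tensor \<theta> (f i) (g i)" x] that keys_pair_tensor by blast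
  show ?thesis
    unfolding HH.tensor_eq pair_tensor_def[symmetric] atLeastAtMost_1_4
    by (simp add: HH.tcls_hom HH.tcls_carrier keys_pair_tensor k)
qed

lemma SL_carrierD: "X \<in> carrier (SL_alg \<theta>) \<Longrightarrow> \<exists>p. X = qS \<theta> p"
  by (auto simp: qS_hom)

text \<open>\<open>coproduct\<close> is a choice, so a witness must be built: the lift
  \<open>cop\<close> applied to any representative, which is independent of the representative by
  \<open>cop_respects\<close>.\<close>

lemma is_coproduct_exists: "\<exists>h. is_coproduct \<theta> h"
proof -
  define h where "h X = HH.tcls \<theta> (cop \<theta> (SOME p. qS \<theta> p = X))" for X
  have h: "h (qS \<theta> p) = HH.tcls \<theta> (cop \<theta> p)" for p
  proof -
    have "qS \<theta> (SOME q. qS \<theta> q = qS \<theta> p) = qS \<theta> p" by (rule someI) (rule refl)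
    from cop_respects[OF this] show ?thesis unfolding h_def using HH.tcls_hom(3)[OF keys_cop keys_cop] by blast
  qed
  have "h \<in> alg_hom (SL_alg \<theta>) (tensor_algebra (SL_alg \<theta>) (SL_alg \<theta>))"
    unfolding alg_hom_def ring_hom_def
    by (auto simp: qS_hom(2-7) h HH.tcls_hom HH.tcls_carrier HH.tcls_smult keys_cop cop_mult cop_linear
          HH.tcls_one pair_tensor_def dest!: SL_carrierD)
  moreover have "h (SL_matrix \<theta> i j) = (\<Oplus>\<^bsub>tensor_algebra (SL_alg \<theta>) (SL_alg \<theta>)\<^esub>k\<in>{1..4}.
      tensor (SL_alg \<theta>) (SL_alg \<theta>) (SL_matrix \<theta> i k) (SL_matrix \<theta> k j))" if ij: "i \<in> {1..4}" "j \<in> {1..4}" for i j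
  proof -
    interpret T: calg "tensor_algebra (SL_alg \<theta>) (SL_alg \<theta>)" by (rule HH.calg_T)
    have "(\<Oplus>\<^bsub>tensor_algebra (SL_alg \<theta>) (SL_alg \<theta>)\<^esub>k\<in>{1..4}.
      tensor (SL_alg \<theta>) (SL_alg \<theta>) (SL_matrix \<theta> i k) (SL_matrix \<theta> k j)) =
      (\<Oplus>\<^bsub>tensor_algebra (SL_alg \<theta>) (SL_alg \<theta>)\<^esub>k\<in>{1..4}.
      tensor (SL_alg \<theta>) (SL_alg \<theta>) (qS \<theta> (ent i k)) (qS \<theta> (ent k j)))"
      using ij by (intro T.finsum_cong')
        (auto simp: SL_matrix_eq HH.tensor_eq HH.tcls_carrier pair_tensor_def[symmetric] keys_pair_tensor simp del: atLeastAtMost_iff)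
    then show ?thesis using ij unfolding tensor_sum_4 by (simp add: SL_matrix_eq h cop_ent del: atLeastAtMost_iff)
  qed
  ultimately show ?thesis unfolding is_coproduct_def Let_def by blast
qed

text \<open>Uniqueness: the values on matrix entries determine those on letters, which are signed
  entries, then on words by multiplicativity and on combinations by linearity. So the chosen map
  agrees with \<open>cop\<close>.\<close>

lemma coproduct_eq: "coproduct \<theta> (qS \<theta> p) = HH.tcls \<theta> (cop \<theta> p)"
proof -
  let ?h = "coproduct \<theta>" and ?T = "tensor_algebra (SL_alg \<theta>) (SL_alg \<theta>)"
  interpret T: calg ?T by (rule HH.calg_T)
  interpret H: calg "SL_alg \<theta>" by (rule calg_SL)
  have c: "is_coproduct \<theta> ?h" unfolding coproduct_def by (rule someI_ex[OF is_coproduct_exists])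
  then have hom: "?h \<in> alg_hom (SL_alg \<theta>) ?T" by (simp add: is_coproduct_def Let_def)
  have ent: "?h (qS \<theta> (ent i j)) = HH.tcls \<theta> (cop \<theta> (ent i j))" if ij: "i \<in> {1..4}" "j \<in> {1..4}" for i j
  proof -
    have "?h (SL_matrix \<theta> i j) = (\<Oplus>\<^bsub>?T\<^esub>k\<in>{1..4}. tensor (SL_alg \<theta>) (SL_alg \<theta>) (SL_matrix \<theta> i k) (SL_matrix \<theta> k j))"
      using c ij by (simp add: is_coproduct_def Let_def)
    also have "\<dots> = (\<Oplus>\<^bsub>?T\<^esub>k\<in>{1..4}. tensor (SL_alg \<theta>) (SL_alg \<theta>) (qS \<theta> (ent i k)) (qS \<theta> (ent k j)))"
      using ij by (intro T.finsum_cong')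
        (auto simp: SL_matrix_eq HH.tensor_eq HH.tcls_carrier pair_tensor_def[symmetric] keys_pair_tensor simp del: atLeastAtMost_iff)
    finally show ?thesis using ij unfolding tensor_sum_4 by (simp add: SL_matrix_eq cop_ent del: atLeastAtMost_iff)
  qed
  have letter: "?h (qS \<theta> (single [a] 1)) = HH.tcls \<theta> (cop \<theta> (single [a] 1))" for a
  proof -
    have *: "single [a] 1 = scale_pm (letter_sign a) (ent (row a) (col a))" by (simp add: ent_def)
    have "?h (qS \<theta> (single [a] 1)) = letter_sign a \<odot>\<^bsub>?T\<^esub> ?h (qS \<theta> (ent (row a) (col a)))"
      unfolding * qS_hom(6)[symmetric] by (rule alg_homD(5)[OF hom]) simp
    then show ?thesis unfolding ent[OF row_range col_range] * cop_linear by (simp add: HH.tcls_smult keys_cop keys_delta_word)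
  qed
  have word: "?h (qS \<theta> (single w 1)) = HH.tcls \<theta> (cop \<theta> (single w 1))" for w
  proof (induction w)
    case Nil
    then show ?case using alg_homD(4)[OF hom] by (simp add: qS_hom HH.tcls_one cop_unit pair_tensor_def)
  next
    case (Cons a w)
    have *: "single (a # w) 1 = single [a] 1 \<star> single w 1" by simp
    have "?h (qS \<theta> (single (a # w) 1)) = ?h (qS \<theta> (single [a] 1)) \<otimes>\<^bsub>?T\<^esub> ?h (qS \<theta> (single w 1))"
      unfolding * qS_hom(5)[symmetric] by (rule alg_homD(2)[OF hom]) simp_all
    then show ?case unfolding * cop_mult letter Cons by (simp add: HH.tcls_hom keys_cop)
  qed
  show ?thesis
  proof (induction p rule: free_induct)
    case zero
    \<comment> \<open>Zero is reached as 0 times the unit, since preservation of zero is not among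
      the clauses of \<open>alg_hom\<close>.\<close>
    have "?h (qS \<theta> (scale_pm 0 0)) = 0 \<odot>\<^bsub>?T\<^esub> ?h (qS \<theta> (single [] 1))"
      using alg_homD(5)[OF hom, of "qS \<theta> (single [] 1)" 0] by (simp add: qS_hom)
    then show ?case unfolding word by (simp add: HH.tcls_smult keys_cop keys_pair_tensor cop_linear)
  next
    case (single w c)
    have *: "single w c = scale_pm c (single w 1)" by simp
    have "?h (qS \<theta> (single w c)) = c \<odot>\<^bsub>?T\<^esub> ?h (qS \<theta> (single w 1))"
      unfolding * qS_hom(6)[symmetric] by (rule alg_homD(5)[OF hom]) simp
    then show ?case unfolding word * cop_linear by (simp add: HH.tcls_smult keys_cop keys_delta_word)
  next
    case (add p q)
    have "?h (qS \<theta> (p + q)) = ?h (qS \<theta> p) \<oplus>\<^bsub>?T\<^esub> ?h (qS \<theta> q)"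
      unfolding qS_hom(2)[symmetric] by (rule alg_homD(3)[OF hom]) simp_all
    then show ?case unfolding add by (simp add: HH.tcls_hom HH.tcls_smult keys_cop keys_delta_word cop_linear)
  qed
qed

section \<open>The algebra of \<open>Sp\<^sub>\<theta>(2)\<close> and the coinvariants\<close>

text \<open>The group Sp(4) of complex matrices preserving the form: the first column pairs to 1
  with the second, the third with the fourth, all other products vanish.\<close>

definition Sp_points :: "point set" where
  "Sp_points = {A. symp A 1 2 = 1 \<and> symp A 3 4 = 1 \<and> symp A 1 3 = 0 \<and> symp A 1 4 = 0 \<and> symp A 2 3 = 0 \<and> symp A 2 4 = 0}"

lemma symp_swap: "symp A j i = - symp A i j" and symp_self [simp]: "symp A i i = 0"
  by (simp_all add: symp_def)

lemma Sp_points_SL: "A \<in> Sp_points \<Longrightarrow> A \<in> SL_points"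
  by (simp add: Sp_points_def SL_points_def pfaff_def)

lemma torus_stable_Sp: "torus_stable Sp_points"
  by (auto simp: torus_stable_def Sp_points_def symp_rescale) (auto simp: torus_def)

lemma quat_conj_Sp: "A \<in> Sp_points \<Longrightarrow> quat_conj A \<in> Sp_points"
  by (simp add: Sp_points_def symp_quat_conj symp_swap[of A 2 1] symp_swap[of A 4 3] symp_swap[of A 3 2] symp_swap[of A 4 1])

definition unit_entry :: "nat \<Rightarrow> nat \<Rightarrow> (letter list \<Rightarrow>\<^sub>0 complex)" where
  "unit_entry i j = (if i = j then funit else 0)"

lemma gram_vanishing: "i \<in> {1..4} \<Longrightarrow> j \<in> {1..4} \<Longrightarrow> gram i j - unit_entry i j \<in> vanishing \<theta> Sp_points"
  unfolding vanishing_def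
  by (clarsimp simp: ev_linear ev_gram simp del: atLeastAtMost_iff, drule index_cases, drule index_cases, elim disjE;
      simp add: Sp_points_def unit_entry_def ev_linear symp_swap[of _ 2 1] symp_swap[of _ 4 3] symp_swap[of _ 3 2] symp_swap[of _ 4 1]
       symp_swap[of _ 3 1] symp_swap[of _ 4 2])

lemma Sp_ideal_eq: "Sp_ideal \<theta> = star_ideal_gen (SL_alg \<theta>)
    {qS \<theta> (gram i j - unit_entry i j) | i j. i \<in> {1..4} \<and> j \<in> {1..4}}"
proof -
  have "SL_gram \<theta> i j \<ominus>\<^bsub>SL_alg \<theta>\<^esub> (if i = j then \<one>\<^bsub>SL_alg \<theta>\<^esub> else \<zero>\<^bsub>SL_alg \<theta>\<^esub>) = qS \<theta> (gram i j - unit_entry i j)"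
    if "i \<in> {1..4}" "j \<in> {1..4}" for i j
    using that by (simp add: SL_gram_eq qS_hom unit_entry_def del: atLeastAtMost_iff)
  then show ?thesis unfolding Sp_ideal_def by (intro arg_cong[where f = "star_ideal_gen (SL_alg \<theta>)"]) blast
qed

lemma Sp_ideal_ideal: "ideal (Sp_ideal \<theta>) (SL_alg \<theta>)"
  and gram_Sp_ideal: "i \<in> {1..4} \<Longrightarrow> j \<in> {1..4} \<Longrightarrow> qS \<theta> (gram i j - unit_entry i j) \<in> Sp_ideal \<theta>"
proof -
  interpret salg "SL_alg \<theta>" by (rule salg_SL)
  let ?S = "{qS \<theta> (gram i j - unit_entry i j) | i j. i \<in> {1..4} \<and> j \<in> {1..4}}"
  have "?S \<subseteq> carrier (SL_alg \<theta>)" by auto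
  from star_ideal_gen_ideal[OF this]
  show "ideal (Sp_ideal \<theta>) (SL_alg \<theta>)"
    "i \<in> {1..4} \<Longrightarrow> j \<in> {1..4} \<Longrightarrow> qS \<theta> (gram i j - unit_entry i j) \<in> Sp_ideal \<theta>"
    unfolding Sp_ideal_eq by blast+
qed

lemma image_qS_ideal: "ideal J free_star_algebra \<Longrightarrow> ideal (qS \<theta> ` J) (SL_alg \<theta>)"
proof -
  assume J: "ideal J free_star_algebra"
  interpret M: salg_quot free_star_algebra "M_ideal \<theta>" by (rule salg_quot_M)
  interpret S: salg_quot "M_alg \<theta>" "SL_ideal \<theta>" by (rule salg_quot_SL)
  have "ideal (qM \<theta> ` J) (M_alg \<theta>)" using M.image_ideal[OF J] by (simp add: M_alg_def qM_def[abs_def])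
  from S.image_ideal[OF this] show ?thesis by (simp add: SL_alg_def qS_def[abs_def] image_image)
qed

lemma star_star_SL: "X \<in> carrier (SL_alg \<theta>) \<Longrightarrow> star\<^bsub>SL_alg \<theta>\<^esub> (star\<^bsub>SL_alg \<theta>\<^esub> X) = X"
  by (auto simp: qS_hom star_star_free)

text \<open>Quaternionic conjugation preserves the symplectic group, so the elements vanishing there
  are closed under adjoints and bound the star-ideal generated by the Gram relations.\<close>

lemma Sp_ideal_ev:
  assumes "qS \<theta> p \<in> Sp_ideal \<theta>" "A \<in> Sp_points"
  shows "ev \<theta> p A = 0"
proof -
  interpret salg "SL_alg \<theta>" by (rule salg_SL)
  let ?V = "vanishing \<theta> Sp_points"
  have st: "star\<^bsub>free_star_algebra\<^esub> q \<in> ?V" if "q \<in> ?V" for q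
    using that quat_conj_Sp by (auto simp: vanishing_def ev_star)
  have "Sp_ideal \<theta> \<subseteq> qS \<theta> ` ?V"
    unfolding Sp_ideal_eq
    by (rule star_ideal_gen_subset[OF image_qS_ideal[OF vanishing_ideal[OF torus_stable_Sp]]])
      (auto simp: gram_vanishing st qS_hom(9) star_star_SL simp del: atLeastAtMost_iff)
  then obtain q where "q \<in> ?V" "qS \<theta> p = qS \<theta> q" using assms(1) by auto
  then show ?thesis using qS_eqD[of \<theta> p q A] assms(2) Sp_points_SL by (simp add: vanishing_def)
qed

lemma calg_quot_Sp: "calg_quot (SL_alg \<theta>) (Sp_ideal \<theta>)"
  by (intro calg_quot.intro calg_SL Sp_ideal_ideal)

lemma calg_Sp: "calg (Sp_alg \<theta>)"
  unfolding Sp_alg_def by (rule calg_quot.calg_Q[OF calg_quot_Sp])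

lemma Sp_proj_eq_iff: "Sp_proj \<theta> (qS \<theta> p) = Sp_proj \<theta> (qS \<theta> q) \<longleftrightarrow> qS \<theta> (p - q) \<in> Sp_ideal \<theta>"
proof -
  interpret calg_quot "SL_alg \<theta>" "Sp_ideal \<theta>" by (rule calg_quot_Sp)
  show ?thesis unfolding Sp_proj_def by (subst cls_eq_iff) (simp_all add: qS_hom)
qed

lemma Sp_proj_hom: "Sp_proj \<theta> \<in> alg_hom (SL_alg \<theta>) (Sp_alg \<theta>)"
proof -
  interpret calg_quot "SL_alg \<theta>" "Sp_ideal \<theta>" by (rule calg_quot_Sp)
  show ?thesis unfolding alg_hom_def ring_hom_def Sp_proj_def[abs_def] Sp_alg_def
    by (auto simp: cls_carrier cls_mult cls_add cls_one cls_smult)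
qed

lemma Sp_carrierD: "Y \<in> carrier (Sp_alg \<theta>) \<Longrightarrow> \<exists>p. Y = Sp_proj \<theta> (qS \<theta> p)"
proof -
  interpret calg_quot "SL_alg \<theta>" "Sp_ideal \<theta>" by (rule calg_quot_Sp)
  show "Y \<in> carrier (Sp_alg \<theta>) \<Longrightarrow> \<exists>p. Y = Sp_proj \<theta> (qS \<theta> p)"
    by (auto simp: Sp_alg_def Sp_proj_def carrier_Q qS_hom(1))
qed

lemma id_hom: "id \<in> alg_hom A A"
  by (simp add: alg_hom_def ring_hom_def)

interpretation SH: tensor_pair "Sp_alg \<theta>" "SL_alg \<theta>" for \<theta>
  by (intro tensor_pair.intro calg_SL calg_Sp)

interpretation PH: tensor_hom "SL_alg \<theta>" "SL_alg \<theta>" "Sp_alg \<theta>" "SL_alg \<theta>" "Sp_proj \<theta>" id for \<theta>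
  by (intro tensor_hom.intro tensor_hom_axioms.intro tensor_pair.intro calg_SL calg_Sp Sp_proj_hom id_hom)

abbreviation "KSH \<theta> \<equiv> bilinear_kernel (Sp_alg \<theta>) (SL_alg \<theta>)"
abbreviation "pushSp \<theta> \<equiv> push (Sp_proj \<theta>) id"

definition coinv :: "real \<Rightarrow> (letter list \<Rightarrow>\<^sub>0 complex) \<Rightarrow> bool" where
  "coinv \<theta> p \<longleftrightarrow> pushSp \<theta> (cop \<theta> p) - single (\<one>\<^bsub>Sp_alg \<theta>\<^esub>, qS \<theta> p) 1 \<in> KSH \<theta>"

lemma Sp_one_closed: "\<one>\<^bsub>Sp_alg \<theta>\<^esub> \<in> carrier (Sp_alg \<theta>)"
proof -
  interpret calg "Sp_alg \<theta>" by (rule calg_Sp)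
  show ?thesis by simp
qed

lemma quotient_space_iff: "qS \<theta> p \<in> quotient_space \<theta> \<longleftrightarrow> coinv \<theta> p"
  unfolding quotient_space_def coinv_def coproduct_eq mem_Collect_eq PH.tensor_map_tcls[OF keys_cop] SH.tensor_eq
  by (subst SH.tcls_hom(3)) (simp_all add: PH.keys_push keys_cop Sp_one_closed)

subsection \<open>Coinvariants give invariant functions\<close>

text \<open>Evaluation of a class through a chosen representative. It is independent of the choice
  at matrices of determinant 1, and \<open>evSp\<close> likewise at symplectic matrices.\<close>

definition evS :: "real \<Rightarrow> point \<Rightarrow> (letter list \<Rightarrow>\<^sub>0 complex) set set \<Rightarrow> complex" where
  "evS \<theta> A X = ev \<theta> (SOME p. qS \<theta> p = X) A"

definition evSp :: "real \<Rightarrow> point \<Rightarrow> (letter list \<Rightarrow>\<^sub>0 complex) set set set \<Rightarrow> complex" where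
  "evSp \<theta> A Y = ev \<theta> (SOME p. Sp_proj \<theta> (qS \<theta> p) = Y) A"

lemma evS_qS: "A \<in> SL_points \<Longrightarrow> evS \<theta> A (qS \<theta> p) = ev \<theta> p A"
  unfolding evS_def by (rule qS_eqD) (rule someI, rule refl)

lemma evSp_proj: "A \<in> Sp_points \<Longrightarrow> evSp \<theta> A (Sp_proj \<theta> (qS \<theta> p)) = ev \<theta> p A"
proof -
  assume A: "A \<in> Sp_points"
  have "Sp_proj \<theta> (qS \<theta> (SOME q. Sp_proj \<theta> (qS \<theta> q) = Sp_proj \<theta> (qS \<theta> p))) = Sp_proj \<theta> (qS \<theta> p)"
    by (rule someI) (rule refl)
  then show ?thesis
    unfolding evSp_def Sp_proj_eq_iff using Sp_ideal_ev[OF _ A] by (force simp: ev_linear)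
qed

lemma lin_functional_lin: "lin_functional F (lin f p) = lin_functional (\<lambda>x. lin_functional F (f x)) p"
  by (simp add: lin_def lin_functional_def[of "\<lambda>x. lin_functional F (f x)"] lin_functional_sum lin_functional_scale)

text \<open>The product of the two evaluations is bilinear in the pair, so it annihilates the
  bilinearity relations and their span.\<close>

lemma lin_functional_KSH:
  assumes g: "g \<in> Sp_points" and A: "A \<in> SL_points" and "p \<in> KSH \<theta>"
  shows "lin_functional (\<lambda>(Y, X). evSp \<theta> g Y * evS \<theta> A X) p = 0"
  using assms(3)
proof (induction rule: SH.K_induct)
  case (rel r)
  note hom = alg_homD(3,5)[OF Sp_proj_hom, symmetric] qS_hom(2,6)
  from rel show ?case
    by (cases rule: SH.bilinear_relations_cases; simp only: lin_functional_diff lin_functional_single)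
      (auto simp: hom evSp_proj[OF g] evS_qS[OF A] ev_linear ring_distribs dest!: Sp_carrierD SL_carrierD)
qed (auto simp: lin_functional_add lin_functional_scale)

definition mmul :: "point \<Rightarrow> point \<Rightarrow> point" where
  "mmul g A = (\<lambda>i j. \<Sum>k\<in>{1..4}. g i k * A k j)"

text \<open>Evaluating \<Delta>(w) at the pair \<open>g\<close>, \<open>A\<close> is evaluating
  \<open>w\<close> at the product matrix. Reading an entry with summation index \<open>k\<close>
  rescales column \<open>r\<close> of \<open>g\<close> by \<open>eta (\<theta> / 2) k r\<close> and
  row \<open>r\<close> of \<open>A\<close> by its inverse, so the product matrix sees only the outer
  phases.\<close>

lemma lin_functional_delta_word:
  assumes "g \<in> SL_points" "A \<in> SL_points"
  shows "lin_functional (\<lambda>(X, X'). evS \<theta> g X * evS \<theta> A X') (delta_word \<theta> w) = phi \<theta> w (mmul g A)"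
  using assms
proof (induction w arbitrary: g A)
  case Nil
  then show ?case by (simp add: pair_tensor_def evS_qS ev_linear)
next
  case (Cons a w)
  let ?L = "\<lambda>g A. lin_functional (\<lambda>(X, X'). evS \<theta> g X * evS \<theta> A X')"
  have 1: "?L g A (convHH \<theta> (pair_tensor \<theta> (ent i k) (ent k j)) y)
      = g i k * A k j * ?L (ltw \<theta> [letter i k] g) (ltw \<theta> [letter k j] A) y"
    if ij: "i \<in> {1..4}" "j \<in> {1..4}" "k \<in> {1..4}" and y: "keys y \<subseteq> carrier (SL_alg \<theta>) \<times> carrier (SL_alg \<theta>)" for i j k y
    using y
  proof (induction y rule: pm_induct)
    case (single x c)
    then obtain p q where x: "x = (qS \<theta> p, qS \<theta> q)" by (auto dest!: SL_carrierD)
    have e: "ev \<theta> (ent i' j' \<star> r) B = B i' j' * ev \<theta> r (ltw \<theta> [letter i' j'] B)"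
      if "i' \<in> {1..4}" "j' \<in> {1..4}" for i' j' r B
      using that by (simp add: ent_def ev_mult_left letter_value_def row_letter col_letter del: atLeastAtMost_iff)
    have s: "ltw \<theta> [letter i k] g \<in> SL_points" "ltw \<theta> [letter k j] A \<in> SL_points"
      using torus_stable_tw(1)[OF torus_stable_SL] Cons.prems by blast+
    show ?case
      using Cons.prems s by (simp add: x pair_tensor_def HH.mult_AB qS_hom(5) evS_qS e ij del: atLeastAtMost_iff)
  qed (simp_all add: conv_add_right lin_functional_add algebra_simps)
  have 2: "phi \<theta> w (mmul (ltw \<theta> [letter (row a) k] g) (ltw \<theta> [letter k (col a)] A)) = phi \<theta> w (ltw \<theta> [a] (mmul g A))"
    if k: "k \<in> {1..4}" for k
  proof (rule phi_cong)
    fix p q :: nat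
    let ?e = "eta (\<theta> / 2)"
    have "?e p (row a) * ?e k r * g p r * (?e r k * ?e (col a) q * A r q) = ?e p (row a) * ?e (col a) q * (g p r * A r q)"
      if "r \<in> {1..4}" for r
    proof -
      have "?e p (row a) * ?e k r * g p r * (?e r k * ?e (col a) q * A r q)
          = (?e k r * ?e r k) * (?e p (row a) * ?e (col a) q * (g p r * A r q))" by (simp only: mult_ac)
      then show ?thesis using eta_inverse[OF k that, of "\<theta> / 2"] by simp
    qed
    then have *: "(\<Sum>r\<in>{1..4}. ?e p (row a) * ?e k r * g p r * (?e r k * ?e (col a) q * A r q))
        = (\<Sum>r\<in>{1..4}. ?e p (row a) * ?e (col a) q * (g p r * A r q))"
      by (rule sum.cong[OF refl])
    show "mmul (ltw \<theta> [letter (row a) k] g) (ltw \<theta> [letter k (col a)] A) p q = ltw \<theta> [a] (mmul g A) p q"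
      using k * by (simp add: mmul_def ltw_def rescale_def row_letter col_letter row_range col_range sum_distrib_left
          del: atLeastAtMost_iff)
  qed
  have "?L g A (delta_word \<theta> (a # w)) = (\<Sum>k\<in>{1..4}. letter_sign a * (g (row a) k * A k (col a) *
     ?L (ltw \<theta> [letter (row a) k] g) (ltw \<theta> [letter k (col a)] A) (delta_word \<theta> w)))"
    unfolding delta_word.simps delta_letter_def conv_sum_left conv_scale_left lin_functional_sum lin_functional_scale
    by (intro sum.cong refl) (simp only: 1[OF row_range col_range _ keys_delta_word])
  also have "\<dots> = (\<Sum>k\<in>{1..4}. letter_sign a * (g (row a) k * A k (col a) * phi \<theta> w (ltw \<theta> [a] (mmul g A))))"
  proof (intro sum.cong refl)
    fix k :: nat assume k: "k \<in> {1..4}"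
    have s: "ltw \<theta> [letter (row a) k] g \<in> SL_points" "ltw \<theta> [letter k (col a)] A \<in> SL_points"
      using torus_stable_tw(1)[OF torus_stable_SL] Cons.prems by blast+
    show "letter_sign a * (g (row a) k * A k (col a) *
     ?L (ltw \<theta> [letter (row a) k] g) (ltw \<theta> [letter k (col a)] A) (delta_word \<theta> w)) =
      letter_sign a * (g (row a) k * A k (col a) * phi \<theta> w (ltw \<theta> [a] (mmul g A)))"
      unfolding Cons.IH[OF s] 2[OF k] ..
  qed
  also have "\<dots> = phi \<theta> (a # w) (mmul g A)"
    by (simp add: letter_value_def mmul_def[of g A] ltw_def sum_distrib_left sum_distrib_right mult_ac)
  finally show ?case .
qed

text \<open>Evaluation at \<open>g\<close> on the left leg and at \<open>A\<close> on the right one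
  sends \<Delta>(p) to the value at the product and the tensor of 1 with p to the value at
  \<open>A\<close>.\<close>

lemma coinv_invariant:
  assumes p: "coinv \<theta> p" and g: "g \<in> Sp_points" and A: "A \<in> SL_points"
  shows "ev \<theta> p (mmul g A) = ev \<theta> p A"
proof -
  let ?F = "\<lambda>(Y, X). evSp \<theta> g Y * evS \<theta> A X"
  have "lin_functional ?F (pushSp \<theta> (cop \<theta> p)) = lin_functional (\<lambda>x. ?F (case x of (X, X') \<Rightarrow> (Sp_proj \<theta> X, X'))) (cop \<theta> p)"
    unfolding push_def lin_functional_lin by (simp add: case_prod_beta)
  also have "\<dots> = lin_functional (\<lambda>(X, X'). evS \<theta> g X * evS \<theta> A X') (cop \<theta> p)"
    by (rule lin_functional_cong[OF keys_cop]) (auto dest!: SL_carrierD simp: evSp_proj g evS_qS Sp_points_SL)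
  also have "\<dots> = ev \<theta> p (mmul g A)"
    unfolding cop_def lin_functional_lin ev_def lin_functional_delta_word[OF Sp_points_SL[OF g] A] ..
  finally have 1: "lin_functional ?F (pushSp \<theta> (cop \<theta> p)) = ev \<theta> p (mmul g A)" .
  have "\<one>\<^bsub>Sp_alg \<theta>\<^esub> = Sp_proj \<theta> (qS \<theta> funit)" using alg_homD(4)[OF Sp_proj_hom[of \<theta>]] by (simp add: qS_hom)
  then have "lin_functional ?F (single (\<one>\<^bsub>Sp_alg \<theta>\<^esub>, qS \<theta> p) 1) = ev \<theta> p A"
    by (simp add: evSp_proj g evS_qS A ev_linear)
  then show ?thesis using lin_functional_KSH[OF g A p[unfolded coinv_def]] 1 by (simp add: lin_functional_diff)
qed

subsection \<open>The coinvariants contain the Gram entries and form a subalgebra\<close>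

lemma coinv_unit: "coinv \<theta> funit"
  using alg_homD(4)[OF Sp_proj_hom[of \<theta>]]
  by (simp add: coinv_def cop_unit pair_tensor_def push_simps qS_hom SH.K_simps(5))

lemma coinv_mult:
  assumes "coinv \<theta> p" "coinv \<theta> q"
  shows "coinv \<theta> (p \<star> q)"
proof -
  interpret Sp: calg "Sp_alg \<theta>" by (rule calg_Sp)
  let ?c = "conv (Sp_alg \<theta> \<times>\<times> SL_alg \<theta>)" and ?s = "\<lambda>p. single (\<one>\<^bsub>Sp_alg \<theta>\<^esub>, qS \<theta> p) 1"
  let ?p = "pushSp \<theta> (cop \<theta> p)" and ?q = "pushSp \<theta> (cop \<theta> q)"
  have k: "keys ?q \<subseteq> carrier (Sp_alg \<theta>) \<times> carrier (SL_alg \<theta>)" "keys (?s p) \<subseteq> carrier (Sp_alg \<theta>) \<times> carrier (SL_alg \<theta>)"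
    by (simp_all add: PH.keys_push keys_cop)
  \<comment> \<open>The difference of the two products telescopes: one factor at a time is replaced
    by its coinvariant form.\<close>
  have "?c (?p - ?s p) ?q + ?c (?s p) (?q - ?s q) \<in> KSH \<theta>"
    using assms by (intro SH.K_simps(2) SH.K_mult_l SH.K_mult_r k) (simp_all only: coinv_def)
  also have "?c (?p - ?s p) ?q + ?c (?s p) (?q - ?s q) = ?c ?p ?q - ?c (?s p) (?s q)"
    by (simp only: conv_diff_left conv_diff_right) simp
  also have "?c (?s p) (?s q) = ?s (p \<star> q)" by (simp add: SH.mult_AB qS_hom(5))
  finally show ?thesis unfolding coinv_def cop_mult PH.push_conv[OF keys_cop keys_cop] .
qed

lemma coinv_add: "coinv \<theta> p \<Longrightarrow> coinv \<theta> q \<Longrightarrow> coinv \<theta> (p + q)"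
proof -
  let ?s = "\<lambda>p. single (\<one>\<^bsub>Sp_alg \<theta>\<^esub>, qS \<theta> p) 1 :: _ \<Rightarrow>\<^sub>0 complex"
  assume "coinv \<theta> p" "coinv \<theta> q"
  then have pq: "pushSp \<theta> (cop \<theta> p) - ?s p \<in> KSH \<theta>" "pushSp \<theta> (cop \<theta> q) - ?s q \<in> KSH \<theta>"
    by (simp_all only: coinv_def)
  have "?s (p + q) - ?s p - ?s q \<in> KSH \<theta>"
    using SH.K_simps(1)[OF SH.bilinear_relations_mem(2)[OF Sp_one_closed qS_mem_carrier qS_mem_carrier]]
    by (simp only: qS_hom(2))
  from SH.K_simps(3)[OF SH.K_simps(2)[OF pq] this]
  show ?thesis by (simp add: coinv_def cop_linear push_simps algebra_simps)
qed

lemma coinv_scale: "coinv \<theta> p \<Longrightarrow> coinv \<theta> (scale_pm c p)"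
proof -
  let ?s = "\<lambda>p. single (\<one>\<^bsub>Sp_alg \<theta>\<^esub>, qS \<theta> p) 1 :: _ \<Rightarrow>\<^sub>0 complex"
  assume "coinv \<theta> p"
  then have p: "pushSp \<theta> (cop \<theta> p) - ?s p \<in> KSH \<theta>" by (simp only: coinv_def)
  have "?s (scale_pm c p) - single (\<one>\<^bsub>Sp_alg \<theta>\<^esub>, qS \<theta> p) c \<in> KSH \<theta>"
    using SH.K_simps(1)[OF SH.bilinear_relations_mem(4)[OF Sp_one_closed qS_mem_carrier]]
    by (simp only: qS_hom(6))
  from SH.K_simps(3)[OF SH.K_simps(4)[OF p, of c] this]
  show ?thesis by (simp add: coinv_def cop_linear push_simps algebra_simps pm.scale_right_diff_distrib)
qed

lemma sum_partner: "(\<Sum>l\<in>{1..4}. F l) = (\<Sum>l\<in>{1..4}. F (partner l))"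
  unfolding atLeastAtMost_1_4 by (simp add: add_ac)

text \<open>The coproduct commutes with adjoints on entries: passing to partners permutes the
  summation index, and the two signs multiply to that of the outer indices.\<close>

lemma cop_star_ent:
  assumes "i \<in> {1..4}" "j \<in> {1..4}"
  shows "cop \<theta> (star\<^bsub>free_star_algebra\<^esub> (ent i j))
    - (\<Sum>k\<in>{1..4}. pair_tensor \<theta> (star\<^bsub>free_star_algebra\<^esub> (ent i k)) (star\<^bsub>free_star_algebra\<^esub> (ent k j))) \<in> KHH \<theta>"
proof -
  let ?e = "\<lambda>i j. ent (partner i) (partner j)"
  have "cop \<theta> (star\<^bsub>free_star_algebra\<^esub> (ent i j)) = (\<Sum>k\<in>{1..4}. scale_pm ((- 1) ^ (i + j)) (pair_tensor \<theta> (?e i k) (?e k j)))"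
    using assms sum_partner[of "\<lambda>k. pair_tensor \<theta> (ent (partner i) k) (ent k (partner j))"]
    by (simp add: star_ent cop_linear cop_ent partner_range pm.scale_sum_right del: atLeastAtMost_iff)
  moreover have "scale_pm ((- 1) ^ (i + j)) (pair_tensor \<theta> (?e i k) (?e k j))
      - pair_tensor \<theta> (star\<^bsub>free_star_algebra\<^esub> (ent i k)) (star\<^bsub>free_star_algebra\<^esub> (ent k j)) \<in> KHH \<theta>" if k: "k \<in> {1..4}" for k
  proof -
    have "(- 1 :: complex) ^ (i + k) * (- 1) ^ (k + j) = (- 1) ^ (i + j)"
      by (simp add: power_add mult_ac flip: power_mult_distrib)
    then show ?thesis
      using K_sym[OF HH.K_scale2[of "qS \<theta> (?e i k)" \<theta> "qS \<theta> (?e k j)" "(- 1) ^ (i + k)" "(- 1) ^ (k + j)"]]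
      unfolding star_ent[OF assms(1) k] star_ent[OF k assms(2)] by (simp add: pair_tensor_def qS_hom(6))
  qed
  ultimately show ?thesis by (simp only: K_sum)
qed

text \<open>Expanding \<Delta> of each factor and summing over the common row index first assembles
  a full Gram entry in the left leg.\<close>

lemma cop_gram:
  assumes "i \<in> {1..4}" "j \<in> {1..4}"
  shows "cop \<theta> (gram i j) - (\<Sum>l\<in>{1..4}. \<Sum>p\<in>{1..4}. pair_tensor \<theta> (gram l p)
      (star\<^bsub>free_star_algebra\<^esub> (ent l i) \<star> ent p j)) \<in> KHH \<theta>"
proof -
  let ?M = "\<lambda>p q. p \<star> q" and ?s = "\<lambda>p. star\<^bsub>free_star_algebra\<^esub> p"
  let ?t = "\<lambda>k l p. pair_tensor \<theta> (?M (?s (ent k l)) (ent k p)) (?M (?s (ent l i)) (ent p j))"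
  have 1: "cop \<theta> (?M (?s (ent k i)) (ent k j)) - (\<Sum>l\<in>{1..4}. \<Sum>p\<in>{1..4}. ?t k l p) \<in> KHH \<theta>" if k: "k \<in> {1..4}" for k
  proof -
    have "convHH \<theta> (cop \<theta> (?s (ent k i)) - (\<Sum>l\<in>{1..4}. pair_tensor \<theta> (?s (ent k l)) (?s (ent l i)))) (cop \<theta> (ent k j)) \<in> KHH \<theta>"
      by (rule HH.K_mult_r[OF keys_cop cop_star_ent[OF k assms(1)]])
    moreover have "convHH \<theta> (\<Sum>l\<in>{1..4}. pair_tensor \<theta> (?s (ent k l)) (?s (ent l i))) (cop \<theta> (ent k j))
        = (\<Sum>l\<in>{1..4}. \<Sum>p\<in>{1..4}. ?t k l p)"
      unfolding cop_ent[OF k assms(2)] conv_sum_left unfolding conv_sum_right pair_tensor_mult ..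
    ultimately show ?thesis unfolding cop_mult conv_diff_left by simp
  qed
  have "cop \<theta> (gram i j) - (\<Sum>k\<in>{1..4}. \<Sum>l\<in>{1..4}. \<Sum>p\<in>{1..4}. ?t k l p) \<in> KHH \<theta>"
    unfolding gram_def cop_linear by (rule K_sum) (rule 1)
  moreover have "(\<Sum>k\<in>{1..4}. \<Sum>l\<in>{1..4}. \<Sum>p\<in>{1..4}. ?t k l p) = (\<Sum>l\<in>{1..4}. \<Sum>p\<in>{1..4}. \<Sum>k\<in>{1..4}. ?t k l p)"
    by (subst sum.swap) (intro sum.cong refl sum.swap)
  moreover have "(\<Sum>l\<in>{1..4}. \<Sum>p\<in>{1..4}. \<Sum>k\<in>{1..4}. ?t k l p) - (\<Sum>l\<in>{1..4}. \<Sum>p\<in>{1..4}. pair_tensor \<theta> (gram l p)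
      (?M (?s (ent l i)) (ent p j))) \<in> KHH \<theta>"
    unfolding gram_def by (intro K_sum K_sym[OF pair_tensor_sum(1)]) simp
  ultimately show ?thesis by (simp only:) (rule K_trans)
qed

text \<open>Projecting the left leg of \<open>cop_gram\<close> to \<open>Sp_alg\<close> turns
  \<open>gram l p\<close> into a Kronecker delta, and the diagonal terms sum to 1 tensor the Gram
  entry itself.\<close>

lemma coinv_gram:
  assumes "i \<in> {1..4}" "j \<in> {1..4}"
  shows "coinv \<theta> (gram i j)"
proof -
  let ?M = "\<lambda>p q. p \<star> q" and ?s = "\<lambda>p. star\<^bsub>free_star_algebra\<^esub> p"
  let ?o = "\<one>\<^bsub>Sp_alg \<theta>\<^esub>"
  interpret Sp: calg "Sp_alg \<theta>" by (rule calg_Sp)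
  have one: "Sp_proj \<theta> (qS \<theta> funit) = ?o" using alg_homD(4)[OF Sp_proj_hom[of \<theta>]] by (simp add: qS_hom)
  \<comment> \<open>Off the diagonal the zero is written as 0 times the unit, so that a scalar
    relation with factor 0 removes the pair.\<close>
  have gr: "Sp_proj \<theta> (qS \<theta> (gram l p)) = (if l = p then ?o else 0 \<odot>\<^bsub>Sp_alg \<theta>\<^esub> ?o)"
    if lp: "l \<in> {1..4}" "p \<in> {1..4}" for l p
  proof -
    have "Sp_proj \<theta> (qS \<theta> (gram l p)) = Sp_proj \<theta> (qS \<theta> (unit_entry l p))"
      unfolding Sp_proj_eq_iff by (rule gram_Sp_ideal[OF lp])
    moreover have "Sp_proj \<theta> (qS \<theta> 0) = 0 \<odot>\<^bsub>Sp_alg \<theta>\<^esub> ?o"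
      using alg_homD(5)[OF Sp_proj_hom[of \<theta>], of "qS \<theta> funit" 0] unfolding one by (simp add: qS_hom(6))
    ultimately show ?thesis by (simp add: unit_entry_def one)
  qed
  have 1: "pushSp \<theta> (cop \<theta> (gram i j)) - (\<Sum>l\<in>{1..4}. \<Sum>p\<in>{1..4}. single (Sp_proj \<theta> (qS \<theta> (gram l p)),
      qS \<theta> (?M (?s (ent l i)) (ent p j))) 1) \<in> KSH \<theta>"
    using PH.push_K[OF cop_gram[OF assms]] by (simp add: push_simps pair_tensor_def)
  have 2: "(\<Sum>p\<in>{1..4}. single (Sp_proj \<theta> (qS \<theta> (gram l p)), qS \<theta> (?M (?s (ent l i)) (ent p j))) 1)
     - single (?o, qS \<theta> (?M (?s (ent l i)) (ent l j))) 1 \<in> KSH \<theta>" if l: "l \<in> {1..4}" for l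
  proof -
    let ?x = "\<lambda>p. qS \<theta> (?M (?s (ent l i)) (ent p j))"
    have "(\<Sum>p\<in>{1..4}. single (Sp_proj \<theta> (qS \<theta> (gram l p)), ?x p) 1)
      - (\<Sum>p\<in>{1..4}. if l = p then single (?o, ?x p) 1 else 0) \<in> KSH \<theta>"
    proof (rule K_sum)
      fix p :: nat assume p: "p \<in> {1..4}"
      show "single (Sp_proj \<theta> (qS \<theta> (gram l p)), ?x p) 1 - (if l = p then single (?o, ?x p) 1 else 0) \<in> KSH \<theta>"
        using SH.K_simps(1)[OF SH.bilinear_relations_mem(3)[of ?o \<theta> "?x p" 0]]
        by (simp add: gr[OF l p] SH.K_simps(5))
    qed
    moreover have "(\<Sum>p\<in>{1..4}. if l = p then single (?o, ?x p) 1 else 0) = single (?o, ?x l) (1::complex)"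
      using l by (simp add: sum.delta)
    ultimately show ?thesis by simp
  qed
  have 3: "(\<Sum>l\<in>S. single (?o, qS \<theta> (f l)) 1) - single (?o, qS \<theta> (sum f S)) 1 \<in> KSH \<theta>" if "finite S" for f :: "nat \<Rightarrow> _" and S
    using that
  proof induction
    case empty
    show ?case using SH.K_simps(6)[OF SH.K_simps(1)[OF SH.bilinear_relations_mem(4)[of ?o \<theta> "qS \<theta> 0" 0]]] by (simp add: qS_hom(6))
  next
    case (insert x S)
    have "((\<Sum>l\<in>S. single (?o, qS \<theta> (f l)) 1) - single (?o, qS \<theta> (sum f S)) 1) -
      (single (?o, qS \<theta> (f x) \<oplus>\<^bsub>SL_alg \<theta>\<^esub> qS \<theta> (sum f S)) 1 - single (?o, qS \<theta> (f x)) 1 - single (?o, qS \<theta> (sum f S)) 1) \<in> KSH \<theta>"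
      by (intro SH.K_simps(1,3) SH.bilinear_relations_mem insert) simp_all
    then show ?case using insert by (simp add: qS_hom(2) algebra_simps)
  qed
  show ?thesis unfolding coinv_def
    by (rule K_trans[OF 1], rule K_trans[OF K_sum[OF 2]], assumption) (unfold gram_def, rule 3, simp)
qed

section \<open>Polynomial functions\<close>

text \<open>Polynomials enter as functions, which makes substitution of polynomials mere
  composition. Algebraic facts such as the absence of zero divisors are drawn from restrictions to a
  line.\<close>

inductive polyfun :: "(('i \<Rightarrow> complex) \<Rightarrow> complex) \<Rightarrow> bool" where
  const: "polyfun (\<lambda>_. c)"
| var: "polyfun (\<lambda>x. x i)"
| add: "polyfun f \<Longrightarrow> polyfun g \<Longrightarrow> polyfun (\<lambda>x. f x + g x)"
| mult: "polyfun f \<Longrightarrow> polyfun g \<Longrightarrow> polyfun (\<lambda>x. f x * g x)"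

lemma polyfun_uminus: "polyfun f \<Longrightarrow> polyfun (\<lambda>x. - f x)"
  using polyfun.mult[OF polyfun.const[of "-1"]] by simp

lemma polyfun_diff: "polyfun f \<Longrightarrow> polyfun g \<Longrightarrow> polyfun (\<lambda>x. f x - g x)"
  using polyfun.add[OF _ polyfun_uminus] by simp

lemma polyfun_power: "polyfun f \<Longrightarrow> polyfun (\<lambda>x. f x ^ n)"
  by (induction n) (auto intro: polyfun.intros)

lemma polyfun_if: "polyfun f \<Longrightarrow> polyfun g \<Longrightarrow> polyfun (\<lambda>x. if c then f x else g x)"
  by (cases c) simp_all

lemma polyfun_sum: "(\<And>s. s \<in> S \<Longrightarrow> polyfun (f s)) \<Longrightarrow> polyfun (\<lambda>x. \<Sum>s\<in>S. f s x)"
  by (induction S rule: infinite_finite_induct) (auto intro: polyfun.intros)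

lemma polyfun_subst: "polyfun f \<Longrightarrow> (\<And>i. polyfun (s i)) \<Longrightarrow> polyfun (\<lambda>x. f (\<lambda>i. s i x))"
  by (induction rule: polyfun.induct) (auto intro: polyfun.intros)

lemma polyfun_line: "polyfun f \<Longrightarrow> \<exists>q. \<forall>t. f (\<lambda>i. x i + t * (y i - x i)) = poly q t"
proof (induction rule: polyfun.induct)
  case (const c)
  show ?case by (rule exI[of _ "[:c:]"]) simp
next
  case (var i)
  show ?case by (rule exI[of _ "[:x i, y i - x i:]"]) simp
next
  case (add f g)
  then show ?case by (metis poly_add)
next
  case (mult f g)
  then show ?case by (metis poly_mult)
qed

text \<open>Restricted to the line from \<open>x\<close> at \<open>t = 0\<close> to \<open>y\<close>
  at \<open>t = 1\<close>, both functions are polynomials in one variable, where there are no zero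
  divisors.\<close>

lemma polyfun_cancel:
  assumes f: "polyfun f" and h: "polyfun h" and y: "h y \<noteq> 0" and fh: "\<And>x. f x * h x = 0"
  shows "f x = 0"
proof -
  obtain p where p: "\<And>t. f (\<lambda>i. x i + t * (y i - x i)) = poly p t" using polyfun_line[OF f] by blast
  obtain q where q: "\<And>t. h (\<lambda>i. x i + t * (y i - x i)) = poly q t" using polyfun_line[OF h] by blast
  have "poly (p * q) t = 0" for t using fh by (simp flip: p q)
  then have "p * q = 0" using poly_all_0_iff_0 by blast
  moreover have "q \<noteq> 0" using q[of 1] y by auto
  ultimately have "p = 0" by simp
  then show ?thesis using p[of 0] by simp
qed

text \<open>By induction, every polynomial function differs from its restriction to
  \<open>x i = 0\<close> by a polynomial multiple of \<open>x i\<close>.\<close>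

lemma polyfun_divide:
  assumes "polyfun f" "\<And>x. x i = 0 \<Longrightarrow> f x = 0"
  obtains g where "polyfun g" "\<And>x. f x = x i * g x"
proof -
  have "\<exists>g. polyfun g \<and> (\<forall>x. f x = f (x(i := 0)) + x i * g x)"
    using assms(1)
  proof (induction rule: polyfun.induct)
    case (const c)
    show ?case by (rule exI[of _ "\<lambda>_. 0"]) (auto intro: polyfun.intros)
  next
    case (var j)
    show ?case
      by (rule exI[of _ "\<lambda>_. if i = j then 1 else 0"]) (auto intro: polyfun.intros)
  next
    case (add f1 f2)
    then obtain g1 g2 where g: "polyfun g1" "\<And>x. f1 x = f1 (x(i := 0)) + x i * g1 x"
      "polyfun g2" "\<And>x. f2 x = f2 (x(i := 0)) + x i * g2 x" by blast
    show ?case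
    proof (intro exI conjI allI)
      show "polyfun (\<lambda>x. g1 x + g2 x)" using g by (intro polyfun.add)
      show "f1 x + f2 x = f1 (x(i := 0)) + f2 (x(i := 0)) + x i * (g1 x + g2 x)" for x
        by (subst g(2), subst g(4)) (simp add: algebra_simps)
    qed
  next
    case (mult f1 f2)
    then obtain g1 g2 where g: "polyfun g1" "\<And>x. f1 x = f1 (x(i := 0)) + x i * g1 x"
      "polyfun g2" "\<And>x. f2 x = f2 (x(i := 0)) + x i * g2 x" by blast
    have "polyfun (\<lambda>x. if j = i then 0 else x j)" for j
      by (cases "j = i") (auto intro: polyfun.intros)
    from polyfun_subst[OF mult.hyps(1) this] have "polyfun (\<lambda>x. f1 (x(i := 0)))"
      by (simp add: fun_upd_def)
    then have "polyfun (\<lambda>x. g1 x * f2 x + f1 (x(i := 0)) * g2 x)" using g mult.hyps by (intro polyfun.intros)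
    moreover have "f1 x * f2 x = f1 (x(i := 0)) * f2 (x(i := 0)) + x i * (g1 x * f2 x + f1 (x(i := 0)) * g2 x)" for x
    proof -
      have "f1 x * f2 x = (f1 (x(i := 0)) + x i * g1 x) * f2 x" using g(2)[of x] by simp
      also have "\<dots> = f1 (x(i := 0)) * f2 x + x i * g1 x * f2 x" by (simp add: algebra_simps)
      also have "f1 (x(i := 0)) * f2 x = f1 (x(i := 0)) * (f2 (x(i := 0)) + x i * g2 x)" using g(4)[of x] by simp
      finally show ?thesis by (simp add: algebra_simps)
    qed
    ultimately show ?case by blast
  qed
  then obtain g where "polyfun g" "\<And>x. f x = f (x(i := 0)) + x i * g x" by blast
  moreover have "f (x(i := 0)) = 0" for x using assms(2)[of "x(i := 0)"] by simp
  ultimately show ?thesis using that[of g] by simp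
qed

lemma polyfun_induct_var [consumes 1, case_names const add scale var]:
  assumes "polyfun f" and const: "\<And>c. P (\<lambda>_. c)" and add: "\<And>f g. P f \<Longrightarrow> P g \<Longrightarrow> P (\<lambda>x. f x + g x)"
    and scale: "\<And>f c. P f \<Longrightarrow> P (\<lambda>x. c * f x)" and var: "\<And>f i. P f \<Longrightarrow> P (\<lambda>x. x i * f x)"
  shows "P f"
proof -
  have "P (\<lambda>x. f x * g x)" if "P g" for g
    using assms(1) that
  proof (induction arbitrary: g rule: polyfun.induct)
    case (add f1 f2)
    then show ?case using assms(3)[OF add.IH(1) add.IH(2)] by (simp add: ring_distribs)
  next
    case (mult f1 f2)
    then show ?case by (simp add: mult.assoc)
  qed (rule scale var, assumption)+
  from this[OF const[of 1]] show ?thesis by simp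
qed


section \<open>Polynomial functions of a matrix\<close>

definition poly_point :: "(point \<Rightarrow> complex) \<Rightarrow> bool" where
  "poly_point F \<longleftrightarrow> polyfun (\<lambda>x. F (curry x))"

lemma poly_point_intros:
  "poly_point (\<lambda>_. c)" "poly_point (\<lambda>A. A i j)"
  "poly_point F \<Longrightarrow> poly_point G \<Longrightarrow> poly_point (\<lambda>A. F A + G A)"
  "poly_point F \<Longrightarrow> poly_point G \<Longrightarrow> poly_point (\<lambda>A. F A * G A)"
  "poly_point F \<Longrightarrow> poly_point G \<Longrightarrow> poly_point (\<lambda>A. F A - G A)"
  "poly_point F \<Longrightarrow> poly_point (\<lambda>A. F A ^ n)"
  "(\<And>s. s \<in> S \<Longrightarrow> poly_point (H s)) \<Longrightarrow> poly_point (\<lambda>A. \<Sum>s\<in>S. H s A)"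
  unfolding poly_point_def curry_def
  by (auto intro: polyfun.intros polyfun_diff polyfun_power polyfun_sum)

lemma poly_point_cancel:
  assumes "poly_point F" "poly_point G" "G B \<noteq> 0" "\<And>A. F A * G A = 0"
  shows "F A = 0"
  using polyfun_cancel[of "\<lambda>x. F (curry x)" "\<lambda>x. G (curry x)" "case_prod B" "case_prod A"] assms
  by (simp add: poly_point_def)

lemma poly_point_phi: "poly_point (phi \<theta> w)"
proof -
  have "poly_point (\<lambda>A. phi \<theta> w (rescale f h A))" for f h
    unfolding phi_rescale
  proof (intro poly_point_intros)
    show "poly_point (phi \<theta> w)"
      by (induction w) (auto simp: letter_value_def phi_rescale mult.assoc intro!: poly_point_intros)
  qed
  from this[of "\<lambda>_. 1" "\<lambda>_. 1"] show ?thesis by (simp add: rescale_one)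
qed

lemma poly_point_ev: "poly_point (ev \<theta> p)"
  unfolding ev_def[abs_def] lin_functional_def by (intro poly_point_intros poly_point_phi)

lemma poly_point_symp: "poly_point (\<lambda>A. symp A i j)"
  unfolding symp_def by (intro poly_point_intros)

lemma poly_point_pfaff: "poly_point pfaff"
  unfolding pfaff_def[abs_def] by (intro poly_point_intros poly_point_symp)

section \<open>Invariant functions are polynomials in the symplectic products\<close>

datatype pair_index = I12 | I13 | I14 | I23 | I24 | I34

definition omega :: "point \<Rightarrow> pair_index \<Rightarrow> complex" where
  "omega A i = (case i of I12 \<Rightarrow> symp A 1 2 | I13 \<Rightarrow> symp A 1 3 | I14 \<Rightarrow> symp A 1 4
     | I23 \<Rightarrow> symp A 2 3 | I24 \<Rightarrow> symp A 2 4 | I34 \<Rightarrow> symp A 3 4)"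

lemma omega_simps [simp]:
  "omega A I12 = symp A 1 2" "omega A I13 = symp A 1 3" "omega A I14 = symp A 1 4"
  "omega A I23 = symp A 2 3" "omega A I24 = symp A 2 4" "omega A I34 = symp A 3 4"
  by (simp_all add: omega_def)

lemma poly_point_omega: "poly_point (\<lambda>A. omega A i)"
  by (cases i) (simp_all add: poly_point_symp)

lemma poly_point_polyfun_omega: "polyfun b \<Longrightarrow> poly_point (\<lambda>A. b (omega A))"
  using polyfun_subst[of b "\<lambda>i x. omega (curry x) i"] poly_point_omega by (simp add: poly_point_def)

definition point_of_cols :: "(nat \<Rightarrow> complex) \<Rightarrow> (nat \<Rightarrow> complex) \<Rightarrow> (nat \<Rightarrow> complex) \<Rightarrow> (nat \<Rightarrow> complex) \<Rightarrow> point" where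
  "point_of_cols c1 c2 c3 c4 = (\<lambda>i j. if j = 1 then c1 i else if j = 2 then c2 i else if j = 3 then c3 i else c4 i)"

definition vec4 :: "complex \<Rightarrow> complex \<Rightarrow> complex \<Rightarrow> complex \<Rightarrow> nat \<Rightarrow> complex" where
  "vec4 a b c d i = (if i = 1 then a else if i = 2 then b else if i = 3 then c else d)"

text \<open>The first two columns are the orthogonal basis vectors e_1 and e_3. Coordinates 2 and 4
  of the other columns then prescribe their products with these two, and the first coordinate of the
  last column adjusts the (3,4) product, whence the division by \<open>x I13\<close>.\<close>

lemma omega_surj_degenerate:
  assumes "x I12 = 0" "x I13 \<noteq> 0"
  shows "\<exists>A. omega A = x"
proof -
  let ?A = "point_of_cols (vec4 1 0 0 0) (vec4 0 0 1 0) (vec4 0 (x I13) 0 (x I23))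
      (vec4 (- (x I34) / x I13) (x I14) 0 (x I24))"
  have "omega ?A i = x i" for i
    using assms by (cases i) (simp_all add: symp_def point_of_cols_def vec4_def)
  then show ?thesis by blast
qed

lemma omega_divide:
  assumes "polyfun b" "poly_point F" "\<And>A. symp A 1 2 ^ n * F A = b (omega A)"
  shows "\<exists>b'. polyfun b' \<and> (\<forall>A. F A = b' (omega A))"
  using assms
proof (induction n arbitrary: b)
  case 0
  then show ?case by auto
next
  case (Suc n)
  have "b x = 0" if x: "x I12 = 0" for x
  proof -
    let ?b = "\<lambda>x. b (x(I12 := 0))"
    have "polyfun (\<lambda>x. if j = I12 then 0 else x j)" for j
      by (cases "j = I12") (auto intro: polyfun.intros)
    from polyfun_subst[OF Suc.prems(1) this] have b: "polyfun ?b" by (simp add: fun_upd_def)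
    \<comment> \<open>Degenerate forms are realized only where \<open>x I13\<close> is nonzero;
      multiplying by \<open>x I13\<close> covers the rest, and this factor is cancelled as a
      polynomial.\<close>
    have "?b x = 0"
    proof (rule polyfun_cancel[OF b polyfun.var[of I13], of "\<lambda>_. 1"])
      fix y :: "pair_index \<Rightarrow> complex"
      show "?b y * y I13 = 0"
      proof (cases "y I13 = 0")
        case False
        then obtain A where A: "omega A = y(I12 := 0)"
          using omega_surj_degenerate[of "y(I12 := 0)"] by auto
        then have "symp A 1 2 = 0" by (metis omega_simps(1) fun_upd_same)
        then have "b (omega A) = 0" using Suc.prems(3)[of A] by simp
        then show ?thesis unfolding A by (simp only: mult_zero_left)
      qed simp
    qed simp
    moreover have "x(I12 := 0) = x" using x by auto
    ultimately show ?thesis by simp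
  qed
  then obtain g where g: "polyfun g" "\<And>x. b x = x I12 * g x" using polyfun_divide[OF Suc.prems(1)] by metis
  \<comment> \<open>One factor \<open>symp A 1 2\<close> is cancelled as a polynomial function; it
    is nonzero at the matrix with columns e_1, e_2, 0, 0.\<close>
  have "symp A 1 2 ^ n * F A - g (omega A) = 0" for A
  proof (rule poly_point_cancel[where F = "\<lambda>A. symp A 1 2 ^ n * F A - g (omega A)" and G = "\<lambda>A. symp A 1 2" and B = "point_of_cols (vec4 1 0 0 0) (vec4 0 1 0 0) (vec4 0 0 0 0) (vec4 0 0 0 0)"])
    show "poly_point (\<lambda>A. symp A 1 2 ^ n * F A - g (omega A))"
      by (intro poly_point_intros poly_point_symp Suc.prems poly_point_polyfun_omega g)
    show "(symp A 1 2 ^ n * F A - g (omega A)) * symp A 1 2 = 0" for A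
      using Suc.prems(3)[of A] g(2)[of "omega A"] by (simp add: algebra_simps)
    show "poly_point (\<lambda>A. symp A 1 2)" by (rule poly_point_symp)
  qed (simp add: symp_def point_of_cols_def vec4_def)
  then show ?case using Suc.IH[OF g(1) Suc.prems(2)] by simp
qed

lemma symp_mmul_bilinear: "symp (mmul g A) i j = (\<Sum>k\<in>{1..4}. \<Sum>l\<in>{1..4}. A k i * A l j * symp g k l)"
  unfolding mmul_def symp_def atLeastAtMost_1_4 by (simp add: algebra_simps)

lemma symp_mmul: "g \<in> Sp_points \<Longrightarrow> symp (mmul g A) i j = symp A i j"
  unfolding symp_mmul_bilinear atLeastAtMost_1_4
  by (simp add: Sp_points_def symp_swap[of g 2 1] symp_swap[of g 4 3] symp_swap[of g 3 2] symp_swap[of g 4 1]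
       symp_swap[of g 3 1] symp_swap[of g 4 2] symp_def[of A])

lemma pfaff_mmul: "g \<in> Sp_points \<Longrightarrow> pfaff (mmul g A) = pfaff A"
  by (simp add: pfaff_def symp_mmul)

abbreviation scalar :: "complex \<Rightarrow> point \<Rightarrow> point" where
  "scalar c A \<equiv> (\<lambda>i j. c * A i j)"

lemma symp_scalar: "symp (scalar c A) i j = c ^ 2 * symp A i j"
  by (simp add: symp_def algebra_simps power2_eq_square)

lemma pfaff_scalar: "pfaff (scalar c A) = c ^ 4 * pfaff A"
proof -
  have "c ^ 4 = c ^ 2 * c ^ 2" by (simp flip: power_add)
  then show ?thesis by (simp add: pfaff_def symp_scalar algebra_simps)
qed

lemma mmul_scalar: "mmul g (scalar c A) = scalar c (mmul g A)"
  by (simp add: mmul_def sum_distrib_left mult_ac)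

text \<open>The symplectic Gram-Schmidt process: up to the scalar \<open>m\<close>, a matrix is a symplectic matrix
  times an upper triangular matrix whose entries are polynomials in the symplectic products.\<close>

definition normal_form :: "(pair_index \<Rightarrow> complex) \<Rightarrow> point" where
  "normal_form x = point_of_cols (vec4 (x I12) 0 0 0) (vec4 0 (x I12 ^ 2) 0 0)
     (vec4 (- x I23) (x I12 * x I13) (x I12) 0)
     (vec4 (- x I24) (x I12 * x I14) 0 (x I12 * x I34 - x I13 * x I24 + x I14 * x I23))"

lemma symplectic_gram_schmidt:
  assumes m: "symp A 1 2 \<noteq> 0" and pf: "pfaff A \<noteq> 0"
  obtains g where "g \<in> Sp_points"
    "\<And>i j. i \<in> {1..4} \<Longrightarrow> j \<in> {1..4} \<Longrightarrow> mmul g (normal_form (omega A)) i j = scalar (symp A 1 2) A i j"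
proof
  let ?m = "symp A 1 2" and ?P = "pfaff A"
  \<comment> \<open>Columns 3 and 4 are made orthogonal to columns 1 and 2. The corrected columns
    have symplectic product \<open>?P / ?m\<close>, which explains the factor \<open>?m / ?P\<close>
    in \<open>g\<close>.\<close>
  let ?c3 = "\<lambda>i. A i 3 + symp A 2 3 / ?m * A i 1 - symp A 1 3 / ?m * A i 2"
  let ?c4 = "\<lambda>i. A i 4 + symp A 2 4 / ?m * A i 1 - symp A 1 4 / ?m * A i 2"
  define g where "g = point_of_cols (\<lambda>i. A i 1) (\<lambda>i. A i 2 / ?m) ?c3 (\<lambda>i. ?m / ?P * ?c4 i)"
  have P: "symp A 1 2 * symp A 3 4 - symp A 1 3 * symp A 2 4 + symp A 1 4 * symp A 2 3 = ?P" by (simp add: pfaff_def)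
  define w where "w = (\<lambda>(u::nat \<Rightarrow> complex) (v::nat \<Rightarrow> complex). u 1 * v 2 - u 2 * v 1 + u 3 * v 4 - u 4 * v 3)"
  have w: "w (\<lambda>i. u i + v i) t = w u t + w v t" "w t (\<lambda>i. u i + v i) = w t u + w t v"
    "w (\<lambda>i. u i - v i) t = w u t - w v t" "w t (\<lambda>i. u i - v i) = w t u - w t v"
    "w (\<lambda>i. c * u i) t = c * w u t" "w t (\<lambda>i. c * u i) = c * w t u" "w (\<lambda>i. u i / c) t = w u t / c" "w t (\<lambda>i. u i / c) = w t u / c"
    for u v t :: "nat \<Rightarrow> complex" and c by (simp_all add: w_def algebra_simps add_divide_distrib diff_divide_distrib)
  have wA: "w (\<lambda>i. A i k) (\<lambda>i. A i l) = symp A k l" for k l by (simp add: w_def symp_def)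
  have g: "symp g k l = w (\<lambda>i. g i k) (\<lambda>i. g i l)" for k l by (simp add: w_def symp_def)
  have cols: "(\<lambda>i. g i 1) = (\<lambda>i. A i 1)" "(\<lambda>i. g i 2) = (\<lambda>i. A i 2 / ?m)" "(\<lambda>i. g i 3) = ?c3" "(\<lambda>i. g i 4) = (\<lambda>i. ?m / ?P * ?c4 i)"
    by (simp_all add: g_def point_of_cols_def)
  have sw: "symp A 2 1 = - symp A 1 2" "symp A 3 2 = - symp A 2 3" "symp A 3 1 = - symp A 1 3" "symp A 4 2 = - symp A 2 4"
    "symp A 4 1 = - symp A 1 4" "symp A 4 3 = - symp A 3 4" by (simp_all add: symp_def)
  have "symp g 3 4 = ?m / ?P * ((symp A 1 2 * symp A 3 4 - symp A 1 3 * symp A 2 4 + symp A 1 4 * symp A 2 3) / ?m)"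
    unfolding g cols w wA sw symp_self using m by (simp add: field_simps)
  also have "\<dots> = 1" unfolding P using m pf by simp
  finally have 34: "symp g 3 4 = 1" .
  show "g \<in> Sp_points"
    unfolding Sp_points_def mem_Collect_eq
  proof (intro conjI 34)
    show "symp g 1 2 = 1" "symp g 1 3 = 0" "symp g 1 4 = 0" "symp g 2 3 = 0" "symp g 2 4 = 0"
      unfolding g cols w wA sw symp_self using m by (simp_all add: field_simps)
  qed
  fix i j :: nat assume i: "i \<in> {1..4}" and j: "j \<in> {1..4}"
  from j show "mmul g (normal_form (omega A)) i j = scalar ?m A i j"
    unfolding mmul_def atLeastAtMost_1_4 using m pf
    by (elim insertE; simp add: normal_form_def g_def point_of_cols_def vec4_def P; simp add: field_simps power2_eq_square)
qed

text \<open>Where m and the Pfaffian are nonzero, invariance and homogeneity give \<open>F\<close>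
  at the normal form as m^N times \<open>F A\<close>. This polynomial identity holds everywhere, and
  \<open>omega_divide\<close> removes m^N. The hypothesis \<open>loc\<close> is there because
  Gram-Schmidt matches entries only at indices 1 to 4.\<close>

lemma symplectic_invariant_polynomial:
  assumes F: "poly_point F" and loc: "\<And>A B. (\<And>i j. i \<in> {1..4} \<Longrightarrow> j \<in> {1..4} \<Longrightarrow> A i j = B i j) \<Longrightarrow> F A = F B"
    and hom: "\<And>c A. F (scalar c A) = c ^ N * F A"
    and inv: "\<And>g A. g \<in> Sp_points \<Longrightarrow> pfaff A \<noteq> 0 \<Longrightarrow> F (mmul g A) = F A"
  shows "\<exists>b. polyfun b \<and> (\<forall>A. F A = b (omega A))"
proof -
  let ?b = "\<lambda>x. F (normal_form x)"
  have "polyfun (\<lambda>x. normal_form x i j)" for i j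
    unfolding normal_form_def point_of_cols_def vec4_def
    by (intro polyfun_if polyfun.intros polyfun_diff polyfun_uminus polyfun_power)
  then have b: "polyfun ?b"
    using polyfun_subst[of "\<lambda>x. F (curry x)" "\<lambda>(i, j) x. normal_form x i j"] F by (auto simp: poly_point_def curry_def)
  have "symp A 1 2 ^ N * F A - ?b (omega A) = 0" for A
  proof (rule poly_point_cancel[where F = "\<lambda>A. symp A 1 2 ^ N * F A - ?b (omega A)" and G = "\<lambda>A. symp A 1 2 * pfaff A" and
        B = "point_of_cols (vec4 1 0 0 0) (vec4 0 1 0 0) (vec4 0 0 1 0) (vec4 0 0 0 1)"])
    show "poly_point (\<lambda>A. symp A 1 2 ^ N * F A - ?b (omega A))"
      by (intro poly_point_intros poly_point_symp F poly_point_polyfun_omega b)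
    show "poly_point (\<lambda>A. symp A 1 2 * pfaff A)" by (intro poly_point_intros poly_point_symp poly_point_pfaff)
    show "(symp A 1 2 ^ N * F A - ?b (omega A)) * (symp A 1 2 * pfaff A) = 0" for A
    proof (cases "symp A 1 2 = 0 \<or> pfaff A = 0")
      case False
      let ?T = "normal_form (omega A)"
      from False obtain g where g: "g \<in> Sp_points"
        "\<And>i j. i \<in> {1..4} \<Longrightarrow> j \<in> {1..4} \<Longrightarrow> mmul g ?T i j = scalar (symp A 1 2) A i j"
        using symplectic_gram_schmidt[of A] by metis
      have "symp (mmul g ?T) i j = symp (scalar (symp A 1 2) A) i j" if "i \<in> {1..4}" "j \<in> {1..4}" for i j
        using that g(2) by (simp add: symp_def)
      then have "pfaff (mmul g ?T) = pfaff (scalar (symp A 1 2) A)" by (simp add: pfaff_def)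
      then have "pfaff ?T \<noteq> 0" using False by (simp add: pfaff_mmul[OF g(1)] pfaff_scalar)
      then have "F ?T = F (mmul g ?T)" using inv[OF g(1)] by simp
      also have "\<dots> = F (scalar (symp A 1 2) A)" by (rule loc) (rule g(2))
      finally show ?thesis by (simp add: hom)
    qed auto
  qed (simp add: pfaff_def symp_def point_of_cols_def vec4_def)
  then show ?thesis by (intro omega_divide[OF b F, of N]) simp
qed

section \<open>Relations among the generators\<close>

lemmas weight_ev = weight_generators[unfolded weight_def, rule_format]

lemma symp_rescale_cols: "symp (rescale (\<lambda>_. 1) h A) i j = h i * h j * symp A i j"
  by (rule symp_rescale) (simp add: torus_def)

lemma rescale_mult_cols: "rescale (\<lambda>_. 1) h (rescale (\<lambda>_. 1) h' A) = rescale (\<lambda>_. 1) (\<lambda>l. h l * h' l) A"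
  by (simp add: rescale_rescale)

lemma free_mult_assoc:
  "(p \<star> q) \<star> r = p \<star> (q \<star> r)"
  unfolding free_mult by (rule conv_assoc[OF monoid_word]) simp_all

lemma weight_mult: "weight \<theta> p h \<Longrightarrow> weight \<theta> q h' \<Longrightarrow> weight \<theta> (p \<star> q) (\<lambda>l. h' l * h l)"
  by (simp add: weight_def free_mult_assoc rescale_mult_cols)

lemma weight_scale: "weight \<theta> p h \<Longrightarrow> weight \<theta> (scale_pm c p) h"
  by (simp add: weight_def free_mult_linear ev_linear)

lemma weight_cong:
  assumes "weight \<theta> p h" "\<And>l. l \<in> {1..4} \<Longrightarrow> h l = h' l"
  shows "weight \<theta> p h'"
proof -
  have "ev \<theta> q (rescale (\<lambda>_. 1) h A) = ev \<theta> q (rescale (\<lambda>_. 1) h' A)" for q A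
    by (rule ev_cong) (simp add: rescale_def assms(2) del: atLeastAtMost_iff)
  then show ?thesis using assms(1) by (simp add: weight_def)
qed

definition fpf :: "real \<Rightarrow> (letter list \<Rightarrow>\<^sub>0 complex)" where
  "fpf \<theta> = (fm \<star> fn) - ((fg1s \<theta> \<star> fg1 \<theta>) + (fg2s \<theta> \<star> fg2 \<theta>))"

text \<open>The element evaluates to the Pfaffian, as the determinant does, so the two agree already
  in \<open>M_alg\<close>; the last relation of the theorem is then det = 1.\<close>

lemma ev_fpf: "ev \<theta> (fpf \<theta>) A = pfaff A"
  by (simp add: fpf_def ev_linear weight_ev ev_generators symp_rescale_cols pfaff_def algebra_simps)

lemma qS_fpf: "qS \<theta> (fpf \<theta>) = qS \<theta> funit"
  using qS_eqI[of \<theta> "fpf \<theta>" "fdet \<theta>"] qS_det by (simp add: ev_fpf ev_fdet)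

text \<open>In each of the three products the column weights multiply to 1, so multiplication by
  this element is pointwise multiplication by the Pfaffian.\<close>

lemma ev_fpf_mult: "ev \<theta> (fpf \<theta> \<star> q) A = pfaff A * ev \<theta> q A"
proof -
  have e: "eta (\<theta> / 2) 2 l * eta (\<theta> / 2) 3 l * (eta (\<theta> / 2) 1 l * eta (\<theta> / 2) 4 l) = 1"
    "eta (\<theta> / 2) 1 l * eta (\<theta> / 2) 3 l * (eta (\<theta> / 2) 2 l * eta (\<theta> / 2) 4 l) = 1" if "l \<in> {1..4}" for l
    using index_cases[OF that] by (elim disjE; simp)+
  have "weight \<theta> (fpf \<theta>) (\<lambda>_. 1)"
    unfolding fpf_def diff_conv_add_uminus scale_pm_minus1[symmetric]
    by (intro weight_add weight_scale; rule weight_cong[OF weight_mult], (rule weight_generators)+) (simp_all add: e)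
  then show ?thesis by (simp add: weight_def rescale_one ev_fpf)
qed

lemma ltw_torus: "\<exists>f h. torus f \<and> torus h \<and> ltw \<theta> u A = rescale f h A"
proof -
  have "torus (\<lambda>k. \<Prod>a\<leftarrow>u. eta (\<theta> / 2) k (row a))" "torus (\<lambda>k. \<Prod>a\<leftarrow>u. eta (\<theta> / 2) (col a) k)"
    by (rule torus_prod_list, rule torus_eta, rule row_range col_range)+
  then show ?thesis unfolding ltw_def by blast
qed

lemma ev_mult_invariant:
  assumes "\<And>f h A. torus f \<Longrightarrow> torus h \<Longrightarrow> ev \<theta> c (rescale f h A) = ev \<theta> c A"
  shows "ev \<theta> (q \<star> c) A = ev \<theta> q A * ev \<theta> c A"
proof (induction q rule: free_induct)
  case (single u d)
  then show ?case using ltw_torus[of \<theta> u A] assms by (auto simp: ev_mult_left ev_linear)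
qed (simp_all add: free_mult_linear ev_linear ring_distribs)

text \<open>The products of columns 1, 2 and of columns 3, 4 are torus-invariant, so right
  multiplication is pointwise; left multiplication is pointwise because the weights are trivial.
  Centrality thus holds in all of \<open>SL_alg\<close>.\<close>

lemma fm_fn_central:
  "qS \<theta> (fm \<star> q) = qS \<theta> (q \<star> fm)"
  "qS \<theta> (fn \<star> q) = qS \<theta> (q \<star> fn)"
proof -
  have "ev \<theta> fm (rescale f h A) = ev \<theta> fm A" "ev \<theta> fn (rescale f h A) = ev \<theta> fn A" if "torus f" "torus h" for f h A
    using that(2) by (simp_all add: ev_generators symp_rescale[OF that(1)]) (simp_all add: torus_def)
  note * = ev_mult_invariant[OF this(1)] ev_mult_invariant[OF this(2)]
  show "qS \<theta> (fm \<star> q) = qS \<theta> (q \<star> fm)"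
    "qS \<theta> (fn \<star> q) = qS \<theta> (q \<star> fn)"
    by (rule qS_eqI, simp add: * weight_ev rescale_one)+
qed

lemma gram_table:
  "qS \<theta> (gram 1 1) = qS \<theta> fm" "qS \<theta> (gram 1 2) = qS \<theta> 0" "qS \<theta> (gram 1 3) = qS \<theta> (fg1 \<theta>)"
  "qS \<theta> (gram 1 4) = qS \<theta> (fg2s \<theta>)" "qS \<theta> (gram 2 1) = qS \<theta> 0" "qS \<theta> (gram 2 2) = qS \<theta> fm"
  "qS \<theta> (gram 2 3) = qS \<theta> (- scale_pm (cnj (mu \<theta>)) (fg2 \<theta>))" "qS \<theta> (gram 2 4) = qS \<theta> (scale_pm (mu \<theta>) (fg1s \<theta>))"
  "qS \<theta> (gram 3 1) = qS \<theta> (fg1s \<theta>)" "qS \<theta> (gram 3 2) = qS \<theta> (- scale_pm (mu \<theta>) (fg2s \<theta>))"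
  "qS \<theta> (gram 3 3) = qS \<theta> fn" "qS \<theta> (gram 3 4) = qS \<theta> 0"
  "qS \<theta> (gram 4 1) = qS \<theta> (fg2 \<theta>)" "qS \<theta> (gram 4 2) = qS \<theta> (scale_pm (cnj (mu \<theta>)) (fg1 \<theta>))"
  "qS \<theta> (gram 4 3) = qS \<theta> 0" "qS \<theta> (gram 4 4) = qS \<theta> fn"
  by (rule qS_eqI; simp add: ev_gram ev_linear ev_generators symp_swap[of _ 2 1] symp_swap[of _ 4 3] symp_swap[of _ 3 2]
      symp_swap[of _ 4 1] symp_swap[of _ 3 1] symp_swap[of _ 4 2] mu_half[of \<theta>, symmetric] mult.assoc)+

text \<open>The weight of the left factor multiplies the symplectic product of the right one. For
  g_1 g_2 this gives \<open>mu \<theta>\<close>, for g_2 g_1 its inverse, hence the square; in the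
  first two relations the weights agree in both orders.\<close>

lemma generator_relations:
  "qS \<theta> (fg1 \<theta> \<star> fg1s \<theta>) = qS \<theta> (fg1s \<theta> \<star> fg1 \<theta>)"
  "qS \<theta> (fg2 \<theta> \<star> fg2s \<theta>) = qS \<theta> (fg2s \<theta> \<star> fg2 \<theta>)"
  "qS \<theta> (fg1 \<theta> \<star> fg2 \<theta>) = qS \<theta> (scale_pm ((mu \<theta>)\<^sup>2) (fg2 \<theta> \<star> fg1 \<theta>))"
  "qS \<theta> (fg2s \<theta> \<star> fg1s \<theta>) = qS \<theta> (scale_pm ((cnj (mu \<theta>))\<^sup>2) (fg1s \<theta> \<star> fg2s \<theta>))"
  "qS \<theta> (fg1 \<theta> \<star> fg2s \<theta>) = qS \<theta> (scale_pm ((cnj (mu \<theta>))\<^sup>2) (fg2s \<theta> \<star> fg1 \<theta>))"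
  "qS \<theta> (fg2 \<theta> \<star> fg1s \<theta>) = qS \<theta> (scale_pm ((mu \<theta>)\<^sup>2) (fg1s \<theta> \<star> fg2 \<theta>))"
  by (rule qS_eqI; simp add: ev_linear weight_ev ev_generators symp_rescale_cols mu_half[of \<theta>, symmetric] power2_eq_square mult_ac)+

section \<open>The coinvariants are generated by the six elements\<close>

abbreviation generators :: "real \<Rightarrow> (letter list \<Rightarrow>\<^sub>0 complex) set set set" where
  "generators \<theta> \<equiv> {qS \<theta> fm, qS \<theta> fn, qS \<theta> (fg1 \<theta>), qS \<theta> (fg1s \<theta>), qS \<theta> (fg2 \<theta>), qS \<theta> (fg2s \<theta>)}"

abbreviation "subalg \<theta> \<equiv> generated_subalgebra (SL_alg \<theta>) (generators \<theta>)"

lemma subalg_closed: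
  "X \<in> generators \<theta> \<Longrightarrow> X \<in> subalg \<theta>"
  "qS \<theta> p \<in> subalg \<theta> \<Longrightarrow> qS \<theta> q \<in> subalg \<theta> \<Longrightarrow> qS \<theta> (p + q) \<in> subalg \<theta>"
  "qS \<theta> p \<in> subalg \<theta> \<Longrightarrow> qS \<theta> q \<in> subalg \<theta> \<Longrightarrow> qS \<theta> (p \<star> q) \<in> subalg \<theta>"
  "qS \<theta> p \<in> subalg \<theta> \<Longrightarrow> qS \<theta> (scale_pm c p) \<in> subalg \<theta>"
  "qS \<theta> funit \<in> subalg \<theta>"
  unfolding generated_subalgebra_def qS_hom(2,5,6,7)[symmetric]
  by (blast intro: subringE)+

lemma generator_for_index:
  "\<exists>g h k. qS \<theta> g \<in> subalg \<theta> \<and> k \<noteq> 0 \<and> (\<forall>A. ev \<theta> g A = k * omega A i) \<and> weight \<theta> g h \<and> (\<forall>l\<in>{1..4}. h l \<noteq> 0)"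
proof -
  have nz: "mu (\<theta> / 2) \<noteq> 0" by (simp add: mu_def)
  have e: "eta (\<theta> / 2) a l * eta (\<theta> / 2) b l \<noteq> 0" if "a \<in> {1..4}" "b \<in> {1..4}" "l \<in> {1..4}" for a b l
    using eta_nz that by simp
  have P: "qS \<theta> g \<in> generators \<theta> \<Longrightarrow> k \<noteq> 0 \<Longrightarrow> (\<And>A. ev \<theta> g A = k * omega A i) \<Longrightarrow> weight \<theta> g h \<Longrightarrow>
     (\<And>l. l \<in> {1..4} \<Longrightarrow> h l \<noteq> 0) \<Longrightarrow> ?thesis" for g h k
    by (intro exI[of _ g] exI[of _ h] exI[of _ k] conjI ballI allI subalg_closed(1))
  show ?thesis
  proof (cases i)
    case I12 show ?thesis by (rule P[OF _ _ _ weight_generators(1), of 1]) (simp_all add: ev_generators I12)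
  next
    case I34 show ?thesis by (rule P[OF _ _ _ weight_generators(2), of 1]) (simp_all add: ev_generators I34)
  next
    case I23 show ?thesis
      by (rule P[OF _ _ _ weight_generators(3), of "- mu (\<theta> / 2)"]) (simp_all add: ev_generators I23 nz eta_nz)
  next
    case I14 show ?thesis
      by (rule P[OF _ _ _ weight_generators(4), of "cnj (mu (\<theta> / 2))"]) (simp_all add: ev_generators I14 nz eta_nz)
  next
    case I13 show ?thesis
      by (rule P[OF _ _ _ weight_generators(5), of "- mu (\<theta> / 2)"]) (simp_all add: ev_generators I13 nz eta_nz)
  next
    case I24 show ?thesis
      by (rule P[OF _ _ _ weight_generators(6), of "- cnj (mu (\<theta> / 2))"]) (simp_all add: ev_generators I24 nz eta_nz)
  qed
qed

lemma omega_rescale_cols: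
  assumes "\<forall>l\<in>{1..4}. h l \<noteq> 0"
  shows "\<exists>s. \<forall>i. s i \<noteq> 0 \<and> (\<forall>A. omega (rescale (\<lambda>_. 1) h A) i = s i * omega A i)"
proof -
  have "\<exists>s. s \<noteq> 0 \<and> (\<forall>A. omega (rescale (\<lambda>_. 1) h A) i = s * omega A i)" for i
  proof -
    have "\<exists>k\<in>{1..4}. \<exists>l\<in>{1..4}. \<forall>A. omega A i = symp A k l"
      by (cases i) (simp_all add: atLeastAtMost_1_4)
    then obtain k l where "k \<in> {1..4}" "l \<in> {1..4}" "\<And>A. omega A i = symp A k l" by blast
    then show ?thesis using assms by (intro exI[of _ "h k * h l"]) (simp add: symp_rescale_cols)
  qed
  then show ?thesis by metis
qed

text \<open>Multiplication by a generator rescales the symplectic products, so the induction has to be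
  carried out for all rescalings simultaneously.\<close>

lemma polynomial_in_generators:
  assumes "polyfun b"
  shows "\<exists>q. qS \<theta> q \<in> subalg \<theta> \<and> (\<forall>A. ev \<theta> q A = b (\<lambda>i. s i * omega A i))"
  using assms
proof (induction arbitrary: s rule: polyfun_induct_var)
  case (const c)
  show ?case using subalg_closed(4)[OF subalg_closed(5), of \<theta> c] by (intro exI[of _ "scale_pm c funit"]) (simp add: ev_linear)
next
  case (add f g)
  obtain p where p: "qS \<theta> p \<in> subalg \<theta>" "\<forall>A. ev \<theta> p A = f (\<lambda>i. s i * omega A i)" using add(1) by blast
  obtain q where q: "qS \<theta> q \<in> subalg \<theta>" "\<forall>A. ev \<theta> q A = g (\<lambda>i. s i * omega A i)" using add(2) by blast
  show ?case using p q subalg_closed(2)[OF p(1) q(1)] by (intro exI[of _ "p + q"]) (simp add: ev_linear)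
next
  case (scale f c)
  obtain p where p: "qS \<theta> p \<in> subalg \<theta>" "\<forall>A. ev \<theta> p A = f (\<lambda>i. s i * omega A i)" using scale by blast
  show ?case using p subalg_closed(4)[OF p(1), of c] by (intro exI[of _ "scale_pm c p"]) (simp add: ev_linear)
next
  case (var f i)
  obtain g h k where g: "qS \<theta> g \<in> subalg \<theta>" "k \<noteq> 0" "\<forall>A. ev \<theta> g A = k * omega A i" "weight \<theta> g h" "\<forall>l\<in>{1..4}. h l \<noteq> 0"
    using generator_for_index[of \<theta> i] by blast
  obtain r where r: "\<And>i. r i \<noteq> 0" "\<And>i A. omega (rescale (\<lambda>_. 1) h A) i = r i * omega A i"
    using omega_rescale_cols[OF g(5)] by metis
  obtain p where p: "qS \<theta> p \<in> subalg \<theta>" "\<forall>A. ev \<theta> p A = f (\<lambda>i. s i / r i * omega A i)"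
    using var[of "\<lambda>i. s i / r i"] by blast
  \<comment> \<open>Dividing \<open>s\<close> by \<open>r\<close> in the choice of \<open>p\<close>
    cancels the column rescaling caused by \<open>g\<close>, and \<open>s i / k\<close> corrects the
    constant of \<open>g\<close> itself.\<close>
  have "ev \<theta> (scale_pm (s i / k) (g \<star> p)) A = s i * omega A i * f (\<lambda>i. s i * omega A i)" for A
    using g r p by (simp add: ev_linear weight_def)
  then show ?case using subalg_closed(4)[OF subalg_closed(3)[OF g(1) p(1)]] by blast
qed

section \<open>Splitting by degree modulo 4\<close>

lemma phi_scalar: "phi \<theta> w (scalar c A) = c ^ length w * phi \<theta> w A"
proof -
  have "scalar c A = rescale (\<lambda>_. c) (\<lambda>_. 1) A" by (simp add: rescale_def)
  moreover have "(\<Prod>a\<leftarrow>w. c * 1) = c ^ length w" by (induction w) auto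
  ultimately show ?thesis by (simp only: phi_rescale)
qed

lemma SL_points_scalar: "A \<in> SL_points \<Longrightarrow> c ^ 4 = 1 \<Longrightarrow> scalar c A \<in> SL_points"
  by (simp add: SL_points_def pfaff_scalar)

text \<open>Words of length congruent to \<open>r\<close> modulo 4 are filtered out by averaging over the fourth roots
  of unity, which act on the points of determinant 1.\<close>

definition residue_part :: "nat \<Rightarrow> (letter list \<Rightarrow>\<^sub>0 complex) \<Rightarrow> (letter list \<Rightarrow>\<^sub>0 complex)" where
  "residue_part r p = (\<Sum>w\<in>{w \<in> keys p. length w mod 4 = r}. single w (lookup p w))"

lemma sum_fourth_roots:
  "1 + \<i> ^ n + (\<i> ^ n) ^ 2 + (\<i> ^ n) ^ 3 = (if n mod 4 = 0 then 4 else 0 :: complex)"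
proof -
  have "n mod 4 < 4" by simp
  then have c: "n mod 4 = 0 \<or> n mod 4 = 1 \<or> n mod 4 = 2 \<or> n mod 4 = 3" by linarith
  have "\<i> ^ n = \<i> ^ (4 * (n div 4) + n mod 4)" by simp
  also have "\<dots> = \<i> ^ (n mod 4)" by (simp only: power_add power_mult) simp
  finally have "\<i> ^ n = \<i> ^ (n mod 4)" .
  then show ?thesis using c by (auto simp: power2_eq_square power3_eq_cube)
qed

lemma ev_residue_part:
  assumes "r < 4"
  shows "4 * ev \<theta> (residue_part r p) A = (\<Sum>j<4. (\<i> ^ j) ^ (4 - r) * ev \<theta> p (scalar (\<i> ^ j) A))"
proof -
  have *: "(\<Sum>j<4. (\<i> ^ j) ^ (4 - r) * (\<i> ^ j) ^ length w) = (if length w mod 4 = r then 4 else 0)" for w :: "letter list"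
  proof -
    \<comment> \<open>The exponent \<open>4 - r\<close> stands for \<open>- r\<close>, which is the
      same for fourth roots of unity.\<close>
    let ?n = "4 - r + length w"
    have "(\<i> ^ j) ^ (4 - r) * (\<i> ^ j) ^ length w = (\<i> ^ ?n) ^ j" for j
    proof -
      have "(\<i> ^ j) ^ (4 - r) * (\<i> ^ j) ^ length w = (\<i> ^ j) ^ ?n" by (simp only: power_add)
      also have "\<dots> = (\<i> ^ ?n) ^ j" by (simp only: power_mult[symmetric] mult.commute)
      finally show ?thesis .
    qed
    moreover have "(\<Sum>j<4. (\<i> ^ ?n) ^ j) = 1 + \<i> ^ ?n + (\<i> ^ ?n) ^ 2 + (\<i> ^ ?n) ^ 3"
      by (simp add: numeral_eq_Suc)
    moreover have "?n mod 4 = 0 \<longleftrightarrow> length w mod 4 = r"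
    proof -
      have "r = 0 \<or> r = 1 \<or> r = 2 \<or> r = 3" using assms by linarith
      then show ?thesis by (elim disjE) (simp, presburger+)
    qed
    ultimately show ?thesis using sum_fourth_roots[of ?n] by simp
  qed
  have "(\<Sum>j<4. (\<i> ^ j) ^ (4 - r) * ev \<theta> p (scalar (\<i> ^ j) A)) =
     (\<Sum>w\<in>keys p. lookup p w * phi \<theta> w A * (\<Sum>j<4. (\<i> ^ j) ^ (4 - r) * (\<i> ^ j) ^ length w))"
    unfolding ev_def lin_functional_def phi_scalar sum_distrib_left
    by (subst sum.swap) (intro sum.cong refl, simp only: mult_ac)
  also have "\<dots> = (\<Sum>w\<in>{w \<in> keys p. length w mod 4 = r}. 4 * (lookup p w * phi \<theta> w A))"
    unfolding * by (rule sum.mono_neutral_cong_right) auto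
  finally show ?thesis by (simp add: residue_part_def ev_linear sum_distrib_left)
qed

lemma residue_part_sum: "(\<Sum>r<4. residue_part r p) = p"
proof -
  have "(\<Sum>r<4. residue_part r p) = (\<Sum>w\<in>keys p. single w (lookup p w))"
    unfolding residue_part_def
    by (rule sum.group) auto
  then show ?thesis by (simp add: poly_mapping_sum_singles)
qed

text \<open>Each factor raises the degree by 4 and multiplies the function by the Pfaffian, while
  the class in \<open>SL_alg\<close> is unchanged; this brings words to a common degree.\<close>

primrec fpf_power :: "real \<Rightarrow> nat \<Rightarrow> (letter list \<Rightarrow>\<^sub>0 complex) \<Rightarrow> (letter list \<Rightarrow>\<^sub>0 complex)" where
  "fpf_power \<theta> 0 q = q"
| "fpf_power \<theta> (Suc n) q = fpf \<theta> \<star> fpf_power \<theta> n q"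

lemma ev_fpf_power: "ev \<theta> (fpf_power \<theta> n q) A = pfaff A ^ n * ev \<theta> q A"
  by (induction n) (simp_all add: ev_fpf_mult mult_ac)

lemma qS_fpf_power: "qS \<theta> (fpf_power \<theta> n q) = qS \<theta> q"
proof (induction n)
  case (Suc n)
  have "qS \<theta> (funit \<star> q) = qS \<theta> q"
    by (rule qS_eqI) (simp add: ev_mult_left ltw_def rescale_one)
  then show ?case using Suc qS_fpf[of \<theta>] by (simp flip: qS_hom(5))
qed simp

lemma qS_sum_cong: "finite S \<Longrightarrow> (\<And>x. x \<in> S \<Longrightarrow> qS \<theta> (f x) = qS \<theta> (g x)) \<Longrightarrow> qS \<theta> (sum f S) = qS \<theta> (sum g S)"
proof (induction S rule: finite_induct)
  case (insert x S)
  then show ?case by (simp flip: qS_hom(2))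
qed simp

text \<open>Since \<open>det = 1\<close>, every residue part is represented by a homogeneous element, whose invariance
  extends from the points of determinant 1 to all invertible points by homogeneity.\<close>

lemma coinv_residue_part:
  assumes p: "coinv \<theta> p" and r: "r < 4"
  shows "qS \<theta> (residue_part r p) \<in> subalg \<theta>"
proof -
  \<comment> \<open>\<open>L\<close> bounds all word lengths, so \<open>N\<close> lies above each of
    them and in the same residue class as those in \<open>W\<close>; \<open>e w\<close> counts the
    missing factors of degree 4.\<close>
  define L where "L = (\<Sum>w\<in>keys p. length w)"
  define W where "W = {w \<in> keys p. length w mod 4 = r}"
  define N where "N = 4 * L + r"
  define e where "e w = (N - length w) div 4" for w :: "letter list"
  define G where "G = (\<Sum>w\<in>W. fpf_power \<theta> (e w) (single w (lookup p w)))"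
  have "finite W" by (simp add: W_def)
  have e: "4 * e w + length w = N" if "w \<in> W" for w
  proof -
    have "length w \<le> L" unfolding L_def using that by (intro member_le_sum) (auto simp: W_def)
    define d where "d = length w div 4"
    have "length w mod 4 = r" using that by (simp add: W_def)
    then have w: "length w = 4 * d + r" using mult_div_mod_eq[of 4 "length w"] unfolding d_def by linarith
    have "d \<le> L" using \<open>length w \<le> L\<close> by (simp add: d_def)
    have "N - length w = 4 * (L - d)" by (simp add: N_def w diff_mult_distrib2)
    then have "e w = L - d" by (simp add: e_def)
    then show ?thesis using \<open>d \<le> L\<close> by (simp add: w N_def diff_mult_distrib2)
  qed
  have GS: "qS \<theta> G = qS \<theta> (residue_part r p)"
    unfolding G_def residue_part_def W_def[symmetric]
    by (rule qS_sum_cong[OF \<open>finite W\<close> qS_fpf_power])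
  have evG: "ev \<theta> G A = (\<Sum>w\<in>W. pfaff A ^ e w * (lookup p w * phi \<theta> w A))" for A
    by (simp add: G_def ev_linear ev_fpf_power)
  have hom: "ev \<theta> G (scalar c A) = c ^ N * ev \<theta> G A" for c A
  proof -
    have "pfaff (scalar c A) ^ e w * (lookup p w * phi \<theta> w (scalar c A)) = c ^ N * (pfaff A ^ e w * (lookup p w * phi \<theta> w A))"
      if "w \<in> W" for w
      unfolding pfaff_scalar phi_scalar e[OF that, symmetric] power_add power_mult power_mult_distrib by (simp only: mult_ac)
    then show ?thesis unfolding evG sum_distrib_left by (rule sum.cong[OF refl])
  qed
  have SL: "ev \<theta> G (mmul g A) = ev \<theta> G A" if g: "g \<in> Sp_points" and A: "A \<in> SL_points" for g A
  proof -
    have gA: "mmul g A \<in> SL_points" using A by (simp add: SL_points_def pfaff_mmul[OF g])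
    have "ev \<theta> p (scalar (\<i> ^ j) (mmul g A)) = ev \<theta> p (scalar (\<i> ^ j) A)" for j
    proof -
      have "(\<i> ^ j) ^ 4 = 1" by (simp add: power_mult[symmetric] mult.commute)
      then show ?thesis using coinv_invariant[OF p g SL_points_scalar[OF A]] by (simp add: mmul_scalar)
    qed
    then have "4 * ev \<theta> (residue_part r p) (mmul g A) = 4 * ev \<theta> (residue_part r p) A"
      unfolding ev_residue_part[OF r] by simp
    then show ?thesis using qS_eqD[OF GS gA] qS_eqD[OF GS A] by simp
  qed
  have inv: "ev \<theta> G (mmul g A) = ev \<theta> G A" if g: "g \<in> Sp_points" and A: "pfaff A \<noteq> 0" for g A
  proof -
    \<comment> \<open>A fourth root of the inverse determinant moves \<open>A\<close> to determinant
      1. By homogeneity both sides acquire the factor \<open>c ^ N\<close>, which cancels.\<close>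
    define c where "c = csqrt (csqrt (1 / pfaff A))"
    have "c ^ 4 = (c ^ 2) ^ 2" by (simp flip: power_mult)
    then have c: "c ^ 4 = 1 / pfaff A" by (simp add: c_def)
    then have "c \<noteq> 0" using A by auto
    have "scalar c A \<in> SL_points" using c A by (simp add: SL_points_def pfaff_scalar)
    from SL[OF g this] show ?thesis using \<open>c \<noteq> 0\<close> by (simp add: mmul_scalar hom)
  qed
  obtain b where b: "polyfun b" "\<And>A. ev \<theta> G A = b (omega A)"
    using symplectic_invariant_polynomial[OF poly_point_ev[of \<theta> G] ev_cong hom inv] by blast
  obtain q where q: "qS \<theta> q \<in> subalg \<theta>" "\<And>A. ev \<theta> q A = b (\<lambda>i. 1 * omega A i)"
    using polynomial_in_generators[OF b(1), of \<theta> "\<lambda>_. 1"] by blast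
  have "qS \<theta> G = qS \<theta> q" by (rule qS_eqI) (simp add: b(2) q(2))
  then show ?thesis using GS q(1) by simp
qed

section \<open>Equality of the coinvariants and the generated subalgebra\<close>

lemma quotient_space_subset: "quotient_space \<theta> \<subseteq> subalg \<theta>"
proof
  fix X assume X: "X \<in> quotient_space \<theta>"
  then obtain p where p: "X = qS \<theta> p" using SL_carrierD[of X \<theta>] by (auto simp: quotient_space_def)
  have c: "coinv \<theta> p" using X unfolding p quotient_space_iff .
  have "qS \<theta> (\<Sum>r<n. residue_part r p) \<in> subalg \<theta>" if "n \<le> 4" for n
    using that
  proof (induction n)
    case 0
    show ?case using subalg_closed(4)[OF subalg_closed(5), of \<theta> 0] by simp
  next
    case (Suc n)
    then show ?case using coinv_residue_part[OF c, of n] by (simp add: subalg_closed(2))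
  qed
  from this[of 4] show "X \<in> subalg \<theta>" by (simp add: p residue_part_sum)
qed

lemma subalg_subset: "subalg \<theta> \<subseteq> quotient_space \<theta>"
proof -
  have "subring (quotient_space \<theta>) (SL_alg \<theta>)"
  proof (rule ring.subringI[OF calg.axioms(1)[OF calg_SL]])
    show "quotient_space \<theta> \<subseteq> carrier (SL_alg \<theta>)" by (auto simp: quotient_space_def)
    then have Q: "\<exists>p. X = qS \<theta> p \<and> coinv \<theta> p" if "X \<in> quotient_space \<theta>" for X
      using that SL_carrierD[of X \<theta>] quotient_space_iff by blast
    show "\<one>\<^bsub>SL_alg \<theta>\<^esub> \<in> quotient_space \<theta>" by (simp add: qS_hom quotient_space_iff coinv_unit)
    show "\<ominus>\<^bsub>SL_alg \<theta>\<^esub> X \<in> quotient_space \<theta>" if "X \<in> quotient_space \<theta>" for X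
      using Q[OF that] coinv_scale[of \<theta> _ "-1"] by (auto simp: qS_hom quotient_space_iff scale_pm_minus1)
    show "X \<otimes>\<^bsub>SL_alg \<theta>\<^esub> Y \<in> quotient_space \<theta>" if "X \<in> quotient_space \<theta>" "Y \<in> quotient_space \<theta>" for X Y
      using Q[OF that(1)] Q[OF that(2)] by (auto simp: qS_hom quotient_space_iff coinv_mult)
    show "X \<oplus>\<^bsub>SL_alg \<theta>\<^esub> Y \<in> quotient_space \<theta>" if "X \<in> quotient_space \<theta>" "Y \<in> quotient_space \<theta>" for X Y
      using Q[OF that(1)] Q[OF that(2)] by (auto simp: qS_hom quotient_space_iff coinv_add)
  qed
  moreover have "c \<odot>\<^bsub>SL_alg \<theta>\<^esub> X \<in> quotient_space \<theta>" if X: "X \<in> quotient_space \<theta>" for c X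
  proof -
    obtain p where "X = qS \<theta> p" using X SL_carrierD[of X \<theta>] by (auto simp: quotient_space_def)
    then show ?thesis using X by (simp add: qS_hom quotient_space_iff coinv_scale)
  qed
  \<comment> \<open>All six generators occur as entries of the Gram matrix, at (1,1), (1,3), (1,4),
    (3,1), (3,3) and (4,1).\<close>
  moreover have "generators \<theta> \<subseteq> quotient_space \<theta>"
    unfolding gram_table(1,3,4,9,11,13)[symmetric] by (simp add: quotient_space_iff coinv_gram)
  ultimately show ?thesis unfolding generated_subalgebra_def by (intro Inter_lower) blast
qed

theorem mainTheorem5:
  fixes \<theta> :: real
  shows
   "let A = SL_alg \<theta>; \<mu> = mu \<theta>;
        a1 = SL_gen \<theta> GA1; a2 = SL_gen \<theta> GA2; b1 = SL_gen \<theta> GB1; b2 = SL_gen \<theta> GB2;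
        c1 = SL_gen \<theta> GC1; c2 = SL_gen \<theta> GC2; d1 = SL_gen \<theta> GD1; d2 = SL_gen \<theta> GD2;
        m = (star\<^bsub>A\<^esub> a1 \<otimes>\<^bsub>A\<^esub> a1) \<oplus>\<^bsub>A\<^esub> (star\<^bsub>A\<^esub> a2 \<otimes>\<^bsub>A\<^esub> a2)
              \<oplus>\<^bsub>A\<^esub> (star\<^bsub>A\<^esub> c1 \<otimes>\<^bsub>A\<^esub> c1) \<oplus>\<^bsub>A\<^esub> (star\<^bsub>A\<^esub> c2 \<otimes>\<^bsub>A\<^esub> c2);
        n = (star\<^bsub>A\<^esub> b1 \<otimes>\<^bsub>A\<^esub> b1) \<oplus>\<^bsub>A\<^esub> (star\<^bsub>A\<^esub> b2 \<otimes>\<^bsub>A\<^esub> b2)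
              \<oplus>\<^bsub>A\<^esub> (star\<^bsub>A\<^esub> d1 \<otimes>\<^bsub>A\<^esub> d1) \<oplus>\<^bsub>A\<^esub> (star\<^bsub>A\<^esub> d2 \<otimes>\<^bsub>A\<^esub> d2);
        g1 = (star\<^bsub>A\<^esub> a1 \<otimes>\<^bsub>A\<^esub> b1) \<oplus>\<^bsub>A\<^esub> (\<mu> \<odot>\<^bsub>A\<^esub> (star\<^bsub>A\<^esub> b2 \<otimes>\<^bsub>A\<^esub> a2))
              \<oplus>\<^bsub>A\<^esub> (star\<^bsub>A\<^esub> c1 \<otimes>\<^bsub>A\<^esub> d1) \<oplus>\<^bsub>A\<^esub> (\<mu> \<odot>\<^bsub>A\<^esub> (star\<^bsub>A\<^esub> d2 \<otimes>\<^bsub>A\<^esub> c2));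
        g2 = ((star\<^bsub>A\<^esub> b2 \<otimes>\<^bsub>A\<^esub> a1) \<ominus>\<^bsub>A\<^esub> (\<mu> \<odot>\<^bsub>A\<^esub> (star\<^bsub>A\<^esub> a2 \<otimes>\<^bsub>A\<^esub> b1))
              \<oplus>\<^bsub>A\<^esub> (star\<^bsub>A\<^esub> d2 \<otimes>\<^bsub>A\<^esub> c1)) \<ominus>\<^bsub>A\<^esub> (\<mu> \<odot>\<^bsub>A\<^esub> (star\<^bsub>A\<^esub> c2 \<otimes>\<^bsub>A\<^esub> d1));
        g1s = star\<^bsub>A\<^esub> g1; g2s = star\<^bsub>A\<^esub> g2;
        M = [[m, \<zero>\<^bsub>A\<^esub>, g1, g2s],
             [\<zero>\<^bsub>A\<^esub>, m, \<ominus>\<^bsub>A\<^esub> (cnj \<mu> \<odot>\<^bsub>A\<^esub> g2), \<mu> \<odot>\<^bsub>A\<^esub> g1s],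
             [g1s, \<ominus>\<^bsub>A\<^esub> (\<mu> \<odot>\<^bsub>A\<^esub> g2s), n, \<zero>\<^bsub>A\<^esub>],
             [g2, cnj \<mu> \<odot>\<^bsub>A\<^esub> g1, \<zero>\<^bsub>A\<^esub>, n]]
    in star\<^bsub>A\<^esub> m = m \<and> star\<^bsub>A\<^esub> n = n
     \<and> quotient_space \<theta> = generated_subalgebra A {m, n, g1, g1s, g2, g2s}
     \<and> (\<forall>i\<in>{1..4}. \<forall>j\<in>{1..4}. SL_gram \<theta> i j = M ! (i - 1) ! (j - 1))
     \<and> (\<forall>x\<in>quotient_space \<theta>. m \<otimes>\<^bsub>A\<^esub> x = x \<otimes>\<^bsub>A\<^esub> m \<and> n \<otimes>\<^bsub>A\<^esub> x = x \<otimes>\<^bsub>A\<^esub> n)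
     \<and> g1 \<otimes>\<^bsub>A\<^esub> g1s = g1s \<otimes>\<^bsub>A\<^esub> g1
     \<and> g2 \<otimes>\<^bsub>A\<^esub> g2s = g2s \<otimes>\<^bsub>A\<^esub> g2
     \<and> g1 \<otimes>\<^bsub>A\<^esub> g2 = \<mu>\<^sup>2 \<odot>\<^bsub>A\<^esub> (g2 \<otimes>\<^bsub>A\<^esub> g1)
     \<and> g2s \<otimes>\<^bsub>A\<^esub> g1s = (cnj \<mu>)\<^sup>2 \<odot>\<^bsub>A\<^esub> (g1s \<otimes>\<^bsub>A\<^esub> g2s)
     \<and> g1 \<otimes>\<^bsub>A\<^esub> g2s = (cnj \<mu>)\<^sup>2 \<odot>\<^bsub>A\<^esub> (g2s \<otimes>\<^bsub>A\<^esub> g1)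
     \<and> g2 \<otimes>\<^bsub>A\<^esub> g1s = \<mu>\<^sup>2 \<odot>\<^bsub>A\<^esub> (g1s \<otimes>\<^bsub>A\<^esub> g2)
     \<and> (m \<otimes>\<^bsub>A\<^esub> n) \<ominus>\<^bsub>A\<^esub> ((g1s \<otimes>\<^bsub>A\<^esub> g1) \<oplus>\<^bsub>A\<^esub> (g2s \<otimes>\<^bsub>A\<^esub> g2)) = \<one>\<^bsub>A\<^esub>"
proof -
  let ?A = "SL_alg \<theta>"
  have m: "(star\<^bsub>?A\<^esub> SL_gen \<theta> GA1 \<otimes>\<^bsub>?A\<^esub> SL_gen \<theta> GA1) \<oplus>\<^bsub>?A\<^esub> (star\<^bsub>?A\<^esub> SL_gen \<theta> GA2 \<otimes>\<^bsub>?A\<^esub> SL_gen \<theta> GA2)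
              \<oplus>\<^bsub>?A\<^esub> (star\<^bsub>?A\<^esub> SL_gen \<theta> GC1 \<otimes>\<^bsub>?A\<^esub> SL_gen \<theta> GC1) \<oplus>\<^bsub>?A\<^esub> (star\<^bsub>?A\<^esub> SL_gen \<theta> GC2 \<otimes>\<^bsub>?A\<^esub> SL_gen \<theta> GC2) = qS \<theta> fm"
    and n: "(star\<^bsub>?A\<^esub> SL_gen \<theta> GB1 \<otimes>\<^bsub>?A\<^esub> SL_gen \<theta> GB1) \<oplus>\<^bsub>?A\<^esub> (star\<^bsub>?A\<^esub> SL_gen \<theta> GB2 \<otimes>\<^bsub>?A\<^esub> SL_gen \<theta> GB2)
              \<oplus>\<^bsub>?A\<^esub> (star\<^bsub>?A\<^esub> SL_gen \<theta> GD1 \<otimes>\<^bsub>?A\<^esub> SL_gen \<theta> GD1) \<oplus>\<^bsub>?A\<^esub> (star\<^bsub>?A\<^esub> SL_gen \<theta> GD2 \<otimes>\<^bsub>?A\<^esub> SL_gen \<theta> GD2) = qS \<theta> fn"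
    and g1: "(star\<^bsub>?A\<^esub> SL_gen \<theta> GA1 \<otimes>\<^bsub>?A\<^esub> SL_gen \<theta> GB1) \<oplus>\<^bsub>?A\<^esub> (mu \<theta> \<odot>\<^bsub>?A\<^esub> (star\<^bsub>?A\<^esub> SL_gen \<theta> GB2 \<otimes>\<^bsub>?A\<^esub> SL_gen \<theta> GA2))
              \<oplus>\<^bsub>?A\<^esub> (star\<^bsub>?A\<^esub> SL_gen \<theta> GC1 \<otimes>\<^bsub>?A\<^esub> SL_gen \<theta> GD1) \<oplus>\<^bsub>?A\<^esub> (mu \<theta> \<odot>\<^bsub>?A\<^esub> (star\<^bsub>?A\<^esub> SL_gen \<theta> GD2 \<otimes>\<^bsub>?A\<^esub> SL_gen \<theta> GC2)) = qS \<theta> (fg1 \<theta>)"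
    and g2: "((star\<^bsub>?A\<^esub> SL_gen \<theta> GB2 \<otimes>\<^bsub>?A\<^esub> SL_gen \<theta> GA1) \<ominus>\<^bsub>?A\<^esub> (mu \<theta> \<odot>\<^bsub>?A\<^esub> (star\<^bsub>?A\<^esub> SL_gen \<theta> GA2 \<otimes>\<^bsub>?A\<^esub> SL_gen \<theta> GB1))
              \<oplus>\<^bsub>?A\<^esub> (star\<^bsub>?A\<^esub> SL_gen \<theta> GD2 \<otimes>\<^bsub>?A\<^esub> SL_gen \<theta> GC1)) \<ominus>\<^bsub>?A\<^esub> (mu \<theta> \<odot>\<^bsub>?A\<^esub> (star\<^bsub>?A\<^esub> SL_gen \<theta> GC2 \<otimes>\<^bsub>?A\<^esub> SL_gen \<theta> GD1)) = qS \<theta> (fg2 \<theta>)"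
    by (simp_all add: SL_gen_eq qS_hom free_gen_def free_simps fm_def fn_def fg1_def fg2_def single_uminus)
  have gs: "star\<^bsub>?A\<^esub> (qS \<theta> (fg1 \<theta>)) = qS \<theta> (fg1s \<theta>)" "star\<^bsub>?A\<^esub> (qS \<theta> (fg2 \<theta>)) = qS \<theta> (fg2s \<theta>)"
    "star\<^bsub>?A\<^esub> (qS \<theta> fm) = qS \<theta> fm" "star\<^bsub>?A\<^esub> (qS \<theta> fn) = qS \<theta> fn"
    by (simp_all add: qS_hom star_generators)
  have gram: "SL_gram \<theta> i j =
      [[qS \<theta> fm, \<zero>\<^bsub>?A\<^esub>, qS \<theta> (fg1 \<theta>), qS \<theta> (fg2s \<theta>)],
       [\<zero>\<^bsub>?A\<^esub>, qS \<theta> fm, \<ominus>\<^bsub>?A\<^esub> (cnj (mu \<theta>) \<odot>\<^bsub>?A\<^esub> qS \<theta> (fg2 \<theta>)), mu \<theta> \<odot>\<^bsub>?A\<^esub> qS \<theta> (fg1s \<theta>)],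
       [qS \<theta> (fg1s \<theta>), \<ominus>\<^bsub>?A\<^esub> (mu \<theta> \<odot>\<^bsub>?A\<^esub> qS \<theta> (fg2s \<theta>)), qS \<theta> fn, \<zero>\<^bsub>?A\<^esub>],
       [qS \<theta> (fg2 \<theta>), cnj (mu \<theta>) \<odot>\<^bsub>?A\<^esub> qS \<theta> (fg1 \<theta>), \<zero>\<^bsub>?A\<^esub>, qS \<theta> fn]] ! (i - 1) ! (j - 1)"
    if "i \<in> {1..4}" "j \<in> {1..4}" for i j
    using index_cases[OF that(1)] index_cases[OF that(2)]
    by (elim disjE) (simp_all add: SL_gram_eq gram_table qS_hom)
  have central: "qS \<theta> fm \<otimes>\<^bsub>?A\<^esub> X = X \<otimes>\<^bsub>?A\<^esub> qS \<theta> fm \<and> qS \<theta> fn \<otimes>\<^bsub>?A\<^esub> X = X \<otimes>\<^bsub>?A\<^esub> qS \<theta> fn"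
    if X: "X \<in> quotient_space \<theta>" for X
  proof -
    obtain q where "X = qS \<theta> q" using X SL_carrierD[of X \<theta>] by (auto simp: quotient_space_def)
    then show ?thesis using fm_fn_central[of \<theta> q] by (simp add: qS_hom)
  qed
  have space: "quotient_space \<theta> = subalg \<theta>"
    using quotient_space_subset subalg_subset by blast
  have "qS \<theta> fm \<otimes>\<^bsub>?A\<^esub> qS \<theta> fn \<ominus>\<^bsub>?A\<^esub> (qS \<theta> (fg1s \<theta>) \<otimes>\<^bsub>?A\<^esub> qS \<theta> (fg1 \<theta>) \<oplus>\<^bsub>?A\<^esub> qS \<theta> (fg2s \<theta>) \<otimes>\<^bsub>?A\<^esub> qS \<theta> (fg2 \<theta>)) = \<one>\<^bsub>?A\<^esub>"
    using qS_fpf[of \<theta>] by (simp add: qS_hom fpf_def)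
  then show ?thesis
    unfolding Let_def m n g1 g2 gs
    using space gram central generator_relations[of \<theta>] by (simp add: qS_hom(5,6))
qed

end
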